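(* Let $\Omega\subset\mathbb{C}^n$ be a smoothly bounded domain, with Bergman projection $P$, and assume that Condition R holds on $\Omega$. Then there exist $2<p_0<\infty$ and a constant $C'>0$ (depending on the fixed domain $\Omega$, in particular on $n$, but not on $p$) such that $$C'\,\frac{p^2}{p-1}\le\|P\|_p$$ for all $p\in(1,q_0)\cup(p_0,\infty)$, where $\frac{1}{p_0}+\frac{1}{q_0}=1$.
   Context: All domains are bounded domains in $\mathbb{C}^n$, and $L^p(\Omega)$ is taken with respect to Lebesgue measure. $H(\Omega)$ denotes the holomorphic functions on $\Omega$, and $A^p(\Omega)=H(\Omega)\cap L^p(\Omega)$. The Bergman projection $P$ is the orthogonal projection of $L^2(\Omega)$ onto $A^2(\Omega)$. For $1<p<\infty$, $\|P\|_p$ denotes the operator norm of $P$ on $L^p(\Omega)$, i.e. $\|P\|_p=\sup\{\|Pf\|_{L^p(\Omega)}/\|f\|_{L^p(\Omega)} : f\in L^2(\Omega)\cap L^p(\Omega),\ f\ne0\}\in[0,\infty]$. $\Omega$ is smoothly bounded if it is bounded and there is a $C^\infty$ real-valued function $r$ on a neighborhood of $\overline\Omega$ such that $\Omega=\{z: r(z)<0\}$ and $dr\neq0$ where $r=0$. $\Omega$ satisfies Condition R if $P$ maps $C^\infty(\overline\Omega)$ into itself. *)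

theory Defs
  imports "HOL-Analysis.Analysis"
begin

section \<open>Smooth functions\<close>

(* Meant for open S: iterated directional derivatives of all orders up to k exist and are
   continuous. *)
fun C_k_on :: "nat \<Rightarrow> 'a::real_normed_vector set \<Rightarrow> ('a \<Rightarrow> 'b::real_normed_vector) \<Rightarrow> bool" where
  "C_k_on 0 S f \<longleftrightarrow> continuous_on S f"
| "C_k_on (Suc k) S f \<longleftrightarrow>
     (\<forall>x\<in>S. f differentiable (at x)) \<and> (\<forall>v. C_k_on k S (\<lambda>x. frechet_derivative f (at x) v))"

definition C_infinity_on :: "'a::real_normed_vector set \<Rightarrow> ('a \<Rightarrow> 'b::real_normed_vector) \<Rightarrow> bool" where
  "C_infinity_on S f \<longleftrightarrow> (\<forall>k. C_k_on k S f)"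

(* The space of functions on \<Omega> that are smooth up to the boundary: restrictions to \<Omega> of functions
   that are smooth on a neighbourhood of the closure. Values outside \<Omega> are irrelevant. *)
definition C_infinity_closure ::
  "'a::real_normed_vector set \<Rightarrow> ('a \<Rightarrow> 'b::real_normed_vector) set" where
  "C_infinity_closure \<Omega> =
     {f. \<exists>U g. open U \<and> closure \<Omega> \<subseteq> U \<and> C_infinity_on U g \<and> (\<forall>z\<in>\<Omega>. f z = g z)}"

section \<open>Lebesgue and Bergman spaces\<close>

(* Functions are total on the ambient space; only their values on \<Omega> matter, and functions that
   agree almost everywhere on \<Omega> are not identified. *)
definition Lp_space :: "real \<Rightarrow> (complex^'n) set \<Rightarrow> (complex^'n \<Rightarrow> complex) set" where
  "Lp_space p \<Omega> = {f. f \<in> borel_measurable (lebesgue_on \<Omega>) \<and>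
                      integrable (lebesgue_on \<Omega>) (\<lambda>z. cmod (f z) powr p)}"

definition Lp_norm :: "real \<Rightarrow> (complex^'n) set \<Rightarrow> (complex^'n \<Rightarrow> complex) \<Rightarrow> ennreal" where
  "Lp_norm p \<Omega> f =
     (if f \<in> Lp_space p \<Omega>
      then ennreal ((LINT z|lebesgue_on \<Omega>. cmod (f z) powr p) powr (1 / p)) else \<infinity>)"

(* For open \<Omega>: complex differentiability in several variables, i.e. the real derivative exists
   and is complex linear. *)
definition holomorphic_fun :: "(complex^'n) set \<Rightarrow> (complex^'n \<Rightarrow> complex) \<Rightarrow> bool" where
  "holomorphic_fun \<Omega> f \<longleftrightarrow>
     (\<forall>z\<in>\<Omega>. \<exists>D. (f has_derivative D) (at z) \<and> (\<forall>c v. D (c *s v) = c * D v))"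

definition bergman_space :: "real \<Rightarrow> (complex^'n) set \<Rightarrow> (complex^'n \<Rightarrow> complex) set" where
  "bergman_space p \<Omega> = {f. holomorphic_fun \<Omega> f} \<inter> Lp_space p \<Omega>"

(* The element g of the Bergman space such that f - g is orthogonal to the Bergman space, for f
   square integrable. Normalizing g to vanish off \<Omega> makes it unique as a total function. *)
definition bergman_projection ::
  "(complex^'n) set \<Rightarrow> (complex^'n \<Rightarrow> complex) \<Rightarrow> complex^'n \<Rightarrow> complex" where
  "bergman_projection \<Omega> f =
     (THE g. g \<in> bergman_space 2 \<Omega> \<and> (\<forall>z. z \<notin> \<Omega> \<longrightarrow> g z = 0) \<and>
        (\<forall>h\<in>bergman_space 2 \<Omega>. (LINT z|lebesgue_on \<Omega>. (f z - g z) * cnj (h z)) = 0))"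

definition bergman_norm :: "real \<Rightarrow> (complex^'n) set \<Rightarrow> ennreal" where
  "bergman_norm p \<Omega> =
     (SUP f \<in> {f \<in> Lp_space 2 \<Omega> \<inter> Lp_space p \<Omega>. Lp_norm p \<Omega> f \<noteq> 0}.
        Lp_norm p \<Omega> (bergman_projection \<Omega> f) / Lp_norm p \<Omega> f)"

section \<open>Hypotheses on the domain\<close>

definition smoothly_bounded_domain :: "(complex^'n) set \<Rightarrow> bool" where
  "smoothly_bounded_domain \<Omega> \<longleftrightarrow>
     open \<Omega> \<and> connected \<Omega> \<and> \<Omega> \<noteq> {} \<and> bounded \<Omega> \<and>
     (\<exists>U (r :: complex^'n \<Rightarrow> real).
        open U \<and> closure \<Omega> \<subseteq> U \<and> C_infinity_on U r \<and>
        \<Omega> = {z\<in>U. r z < 0} \<and>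
        (\<forall>z\<in>U. r z = 0 \<longrightarrow> frechet_derivative r (at z) \<noteq> (\<lambda>v. 0)))"

definition condition_R :: "(complex^'n) set \<Rightarrow> bool" where
  "condition_R \<Omega> \<longleftrightarrow>
     (\<forall>f\<in>C_infinity_closure \<Omega>. bergman_projection \<Omega> f \<in> C_infinity_closure \<Omega>)"

end

theory Submission
  imports Defs "HOL-Complex_Analysis.Cauchy_Integral_Formula" "HOL-Real_Asymp.Real_Asymp"
begin

text \<open>
  Let \<open>a\<close> be a point of \<open>closure \<Omega>\<close> farthest from the origin, and put
  \<open>w z = 1 - <z, a> / |a|\<^sup>2\<close> with the Hermitian inner product. Since \<open>\<Omega>\<close> lies in the ball of radius
  \<open>|a|\<close>, the real part of \<open>w\<close> is positive on \<open>\<Omega>\<close>, so \<open>g = Ln w\<close> is holomorphic there. It has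
  a logarithmic singularity at \<open>a\<close>, and \<open>\<Omega>\<close> contains balls of radius comparable to their distance
  from \<open>a\<close>; hence for large \<open>q\<close> the \<open>L\<^sup>q\<close> norm of \<open>g\<close> is at least a constant times \<open>q\<close> (lemma
  \<open>g_norm_lower_bound\<close>).

  The point of the proof is that \<open>g\<close> is the Bergman projection of a bounded function \<open>f\<close>.
  Write \<open>L F = DF(a) - \<i> DF(\<i> a)\<close>, which is twice the Wirtinger derivative of \<open>F\<close> in the complex
  direction \<open>a\<close>. It annihilates conjugates of holomorphic functions, so if \<open>r\<close> is a defining
  function, integration by parts shows that \<open>L (r g)\<close> is orthogonal to the Bergman space \<open>A\<^sup>2\<close>; the
  boundary term vanishes with \<open>r\<close> (lemma \<open>wirtinger_orthogonal\<close>). Let \<open>s = L r\<close>. The gradient of \<open>r\<close>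
  at \<open>a\<close> is a positive multiple of \<open>a\<close>, so \<open>s0 = s a\<close> is positive, and
  \<open>f = g - L (r g) / s0 = g (1 - s / s0) + (2 / s0) r / w\<close>
  projects to \<open>g\<close>. It is bounded (lemma \<open>f_bounded\<close>): \<open>s - s0 = O(|z - a|) = O(|w|\<^sup>1\<^sup>/\<^sup>2)\<close> outweighs
  the logarithm, and \<open>r = O(|w|)\<close> because the first order part of \<open>r\<close> at \<open>a\<close> is a multiple of
  \<open>Re w\<close> while the second order part is \<open>O(|z - a|\<^sup>2) = O(|w|)\<close>.

  For large \<open>p\<close> the quotient of the \<open>L\<^sup>p\<close> norms of \<open>g\<close> and \<open>f\<close> is therefore at least a constant
  times \<open>p\<close>. For \<open>p\<close> near \<open>1\<close>, with conjugate exponent \<open>q\<close>, the same function is used by duality: for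
  \<open>\<phi> = |g|\<^sup>q\<^sup>-\<^sup>2 g\<close> one has \<open><P \<phi>, f> = <\<phi>, P f> = <\<phi>, g>\<close>, which is the \<open>q\<close>-th power of the \<open>L\<^sup>q\<close> norm
  of \<open>g\<close>, and \<open>f\<close> is bounded, so \<open>P \<phi>\<close> is large in \<open>L\<^sup>p\<close>. This needs \<open>P \<phi>\<close> to exist, that is, \<open>A\<^sup>2\<close> to be
  closed in \<open>L\<^sup>2\<close>. Closedness follows from the mean value property over balls, which bounds point
  values of holomorphic functions by their \<open>L\<^sup>2\<close> norms (lemma \<open>bergman_pointwise_bound\<close>).
\<close>

section \<open>Invariance of Lebesgue measure\<close>

lemma nn_integral_lborel_translate:
  fixes f :: "'a::euclidean_space \<Rightarrow> ennreal"
  assumes [measurable]: "f \<in> borel_measurable borel"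
  shows "(\<integral>\<^sup>+x. f (c + x) \<partial>lborel) = (\<integral>\<^sup>+x. f x \<partial>lborel)"
proof -
  have "(\<integral>\<^sup>+x. f x \<partial>lborel) = (\<integral>\<^sup>+x. f x \<partial>distr lborel borel ((+) c))"
    by (simp add: lborel_distr_plus)
  also have "\<dots> = (\<integral>\<^sup>+x. f (c + x) \<partial>lborel)"
    by (subst nn_integral_distr) auto
  finally show ?thesis by simp
qed

lemma integral_lborel_translate:
  fixes f :: "'a::euclidean_space \<Rightarrow> complex"
  assumes [measurable]: "f \<in> borel_measurable borel"
  shows "(\<integral>x. f (c + x) \<partial>lborel) = (\<integral>x. f x \<partial>lborel)"
proof -
  have "(\<integral>x. f x \<partial>lborel) = (\<integral>x. f x \<partial>distr lborel borel ((+) c))"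
    by (simp add: lborel_distr_plus)
  also have "\<dots> = (\<integral>x. f (c + x) \<partial>lborel)"
    by (subst integral_distr) auto
  finally show ?thesis by simp
qed

text \<open>The uniqueness argument for Haar measure, with \<open>A\<close> the unit ball. Integrating
  \<open>1\<^sub>A x * 1\<^sub>B (x + T y)\<close> over \<open>x\<close> and \<open>y\<close> in the two possible orders, and using translation invariance,
  gives \<open>|A| |T\<^sup>-\<^sup>1 B|\<close> in one order and \<open>|B| |A|\<close> in the other, because \<open>A\<close> is invariant under \<open>T\<close>.\<close>

lemma lborel_distr_linear_isometry:
  fixes T :: "'a::euclidean_space \<Rightarrow> 'a"
  assumes T: "linear T" and iso: "\<And>x. norm (T x) = norm x"
  shows "distr lborel borel T = lborel"
proof (rule measure_eqI)
  have [measurable]: "T \<in> borel_measurable borel"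
    using T by (intro borel_measurable_continuous_onI linear_continuous_on linear_conv_bounded_linear[THEN iffD1])
  have "inj T"
    using T iso by (metis (no_types, lifting) injI linear_diff norm_eq_zero right_minus_eq)
  then have "surj T"
    using T linear_injective_imp_surjective by blast
  then obtain S where S: "\<And>x. T (S x) = x"
    by (metis surjD)
  show "emeasure (distr lborel borel T) B = emeasure lborel B" if B: "B \<in> sets (distr lborel borel T)" for B
  proof -
    have [measurable]: "B \<in> sets borel" using B by simp
    let ?A = "ball (0::'a) 1"
    have [measurable]: "?A \<in> sets borel" by simp
    have [simp]: "(indicator ?A :: 'a \<Rightarrow> ennreal) \<in> borel_measurable borel" by measurable
    have ball_shift: "(\<integral>\<^sup>+y. indicator ?A (x - T y) \<partial>lborel) = emeasure lborel ?A" for x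
    proof -
      have "indicator ?A (x - T y) = (indicator ?A (- S x + y) :: ennreal)" for y
      proof -
        have "norm (x - T y) = norm (T (S x - y))" using T S by (simp add: linear_diff)
        also have "\<dots> = norm (- S x + y)" using iso by (simp add: norm_minus_commute)
        finally show ?thesis by (simp add: indicator_def)
      qed
      then have "(\<integral>\<^sup>+y. indicator ?A (x - T y) \<partial>lborel)
          = (\<integral>\<^sup>+y. (indicator ?A (- S x + y) :: ennreal) \<partial>lborel)"
        by presburger
      also have "\<dots> = (\<integral>\<^sup>+y. indicator ?A y \<partial>lborel)"
        by (intro nn_integral_lborel_translate borel_measurable_indicator) auto
      finally show ?thesis by simp
    qed
    have "emeasure lborel ?A * emeasure (distr lborel borel T) B
       = (\<integral>\<^sup>+x. indicator ?A x * emeasure (distr lborel borel T) B \<partial>lborel)"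
      by (subst nn_integral_multc) auto
    also have "\<dots> = (\<integral>\<^sup>+x. \<integral>\<^sup>+y. indicator ?A x * indicator B (x + T y) \<partial>lborel \<partial>lborel)"
    proof (rule nn_integral_cong)
      fix x :: 'a
      have "emeasure (distr lborel borel T) B = (\<integral>\<^sup>+y. indicator B y \<partial>distr lborel borel T)"
        by (rule nn_integral_indicator[symmetric]) simp
      also have "\<dots> = (\<integral>\<^sup>+y. indicator B (T y) \<partial>lborel)"
        by (rule nn_integral_distr) auto
      also have "\<dots> = (\<integral>\<^sup>+y. indicator B (T (S x + y)) \<partial>lborel)"
        by (subst nn_integral_lborel_translate[where c="S x" and f="\<lambda>y. indicator B (T y)"]) auto
      finally show "indicator ?A x * emeasure (distr lborel borel T) B
          = (\<integral>\<^sup>+y. indicator ?A x * indicator B (x + T y) \<partial>lborel)"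
        using T S by (subst nn_integral_cmult) (auto simp: linear_add)
    qed
    also have "\<dots> = (\<integral>\<^sup>+y. \<integral>\<^sup>+x. indicator ?A x * indicator B (x + T y) \<partial>lborel \<partial>lborel)"
      by (rule lborel_pair.Fubini'[symmetric]) measurable
    also have "\<dots> = (\<integral>\<^sup>+y. \<integral>\<^sup>+x. indicator ?A (x - T y) * indicator B x \<partial>lborel \<partial>lborel)"
    proof (rule nn_integral_cong)
      fix y :: 'a
      show "(\<integral>\<^sup>+x. indicator ?A x * indicator B (x + T y) \<partial>lborel)
          = (\<integral>\<^sup>+x. indicator ?A (x - T y) * indicator B x \<partial>lborel)"
        using nn_integral_lborel_translate[where c="T y" and f="\<lambda>x. indicator ?A (x - T y) * indicator B x"]
        by (simp add: add.commute)
    qed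
    also have "\<dots> = (\<integral>\<^sup>+x. \<integral>\<^sup>+y. indicator ?A (x - T y) * indicator B x \<partial>lborel \<partial>lborel)"
      by (rule lborel_pair.Fubini') measurable
    also have "\<dots> = emeasure lborel ?A * emeasure lborel B"
      by (subst nn_integral_multc) (auto simp: ball_shift nn_integral_cmult)
    finally have eq: "emeasure lborel ?A * emeasure (distr lborel borel T) B = emeasure lborel ?A * emeasure lborel B" .
    have "emeasure lborel ?A \<noteq> 0"
      using emeasure_lborel_ball_finite[of "0::'a" 1] content_ball_pos[of 1 "0::'a"] by (auto simp: measure_def)
    moreover have "emeasure lborel ?A \<noteq> top"
      using emeasure_lborel_ball_finite[of "0::'a" 1] by auto
    ultimately show ?thesis using eq by (simp add: ennreal_mult_cancel_left)
  qed
qed simp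

lemma integral_lborel_linear_isometry:
  fixes T :: "'a::euclidean_space \<Rightarrow> 'a" and f :: "'a \<Rightarrow> complex"
  assumes T: "linear T" and iso: "\<And>x. norm (T x) = norm x" and [measurable]: "f \<in> borel_measurable borel"
  shows "(\<integral>x. f (T x) \<partial>lborel) = (\<integral>x. f x \<partial>lborel)"
proof -
  have [measurable]: "T \<in> borel_measurable borel"
    using T by (intro borel_measurable_continuous_onI linear_continuous_on linear_conv_bounded_linear[THEN iffD1])
  have "(\<integral>x. f x \<partial>lborel) = (\<integral>x. f x \<partial>distr lborel borel T)"
    using lborel_distr_linear_isometry[OF T iso] by simp
  also have "\<dots> = (\<integral>x. f (T x) \<partial>lborel)"
    by (subst integral_distr) auto
  finally show ?thesis by simp
qed

section \<open>Holomorphic functions of several variables\<close>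

lemma norm_smult_vec:
  fixes v :: "complex^'n"
  shows "norm (c *s v) = cmod c * norm v"
  by (simp add: norm_vec_def norm_mult L2_set_right_distrib)

lemma bounded_linear_smult_left: "bounded_linear (\<lambda>c. c *s (v :: complex^'n))"
  by (rule bounded_linear_intro[where K="norm v"])
     (auto simp: norm_smult_vec vector_sadd_rdistrib scaleR_vec_def vec_eq_iff algebra_simps)

lemma linear_smult_right: "linear (\<lambda>v. c *s (v :: complex^'n))"
  by (rule linearI) (auto simp: vec_eq_iff algebra_simps)

lemma DERIV_complex_line:
  fixes h :: "complex^'n \<Rightarrow> complex"
  assumes der: "(h has_derivative D) (at (z + \<zeta> *s v))" and lin: "\<And>c u. D (c *s u) = c * D u"
  shows "((\<lambda>\<zeta>. h (z + \<zeta> *s v)) has_field_derivative D v) (at \<zeta>)"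
proof -
  have "((\<lambda>\<zeta>. z + \<zeta> *s v) has_derivative (\<lambda>\<zeta>. \<zeta> *s v)) (at \<zeta>)"
    using bounded_linear_imp_has_derivative[OF bounded_linear_smult_left[of v], of "at \<zeta>"]
    by (auto intro!: derivative_eq_intros)
  then have "((\<lambda>\<zeta>. h (z + \<zeta> *s v)) has_derivative (\<lambda>\<zeta>. D (\<zeta> *s v))) (at \<zeta>)"
    using has_derivative_compose der by blast
  then show ?thesis
    by (simp add: has_field_derivative_def lin mult_commute_abs)
qed

lemma holomorphic_on_complex_line:
  assumes hol: "holomorphic_fun \<Omega> h" and "\<And>\<zeta>. \<zeta> \<in> A \<Longrightarrow> z + \<zeta> *s v \<in> \<Omega>"
  shows "(\<lambda>\<zeta>. h (z + \<zeta> *s v)) holomorphic_on A"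
  unfolding holomorphic_on_def
proof
  fix \<zeta> assume "\<zeta> \<in> A"
  then have in\<Omega>: "z + \<zeta> *s v \<in> \<Omega>" using assms by auto
  then obtain D where "(h has_derivative D) (at (z + \<zeta> *s v))" "\<And>c u. D (c *s u) = c * D u"
    using hol unfolding holomorphic_fun_def by blast
  from DERIV_complex_line[OF this]
  show "(\<lambda>\<zeta>. h (z + \<zeta> *s v)) field_differentiable (at \<zeta> within A)"
    using field_differentiable_def field_differentiable_at_within by blast
qed

lemma holomorphic_fun_continuous_on:
  "holomorphic_fun \<Omega> h \<Longrightarrow> continuous_on \<Omega> h"
  unfolding holomorphic_fun_def
  by (meson continuous_at_imp_continuous_on has_derivative_continuous)

text \<open>The one-variable Cauchy inequality on the disc of radius \<open>\<rho> / norm v\<close> in the complex line through \<open>z\<close>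
  in direction \<open>v\<close>.\<close>

lemma directional_cauchy_estimate:
  assumes hol: "holomorphic_fun \<Omega> h" and sub: "cball z \<rho> \<subseteq> \<Omega>" and \<rho>: "\<rho> > 0"
    and bd: "\<And>x. x \<in> cball z \<rho> \<Longrightarrow> cmod (h x) \<le> B"
    and der: "(h has_derivative D) (at z)" and lin: "\<And>c u. D (c *s u) = c * D u"
  shows "cmod (D v) \<le> B / \<rho> * norm v"
proof (cases "v = 0")
  case True
  then show ?thesis using lin[of 0 0] by simp
next
  case False
  let ?H = "\<lambda>\<zeta>. h (z + \<zeta> *s v)" and ?r = "\<rho> / norm v"
  have r: "?r > 0" using False \<rho> by simp
  have in_cball: "z + \<zeta> *s v \<in> cball z \<rho>" if "cmod \<zeta> \<le> ?r" for \<zeta>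
    using that False by (simp add: dist_norm norm_smult_vec field_simps)
  have holH: "?H holomorphic_on cball 0 ?r"
    using in_cball sub by (intro holomorphic_on_complex_line[OF hol]) auto
  have "cmod ((deriv ^^ 1) ?H 0) \<le> fact 1 * B / ?r ^ 1"
  proof (rule Cauchy_inequality)
    show "?H holomorphic_on ball 0 ?r" using holH by (rule holomorphic_on_subset) auto
    show "continuous_on (cball 0 ?r) ?H" using holH by (rule holomorphic_on_imp_continuous_on)
    show "\<And>x. cmod (0 - x) = ?r \<Longrightarrow> cmod (h (z + x *s v)) \<le> B"
      using in_cball bd by simp
  qed (fact r)
  moreover have "deriv ?H 0 = D v"
    using DERIV_complex_line[of h D z 0 v] der lin
    by (intro DERIV_imp_deriv) auto
  ultimately show ?thesis by simp
qed

lemma circle_mean: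
  assumes hol: "H holomorphic_on cball 0 1"
  shows "(\<integral>t. indicator {0..2*pi} t *\<^sub>R H (cis t) \<partial>lborel) = of_real (2 * pi) * H 0"
proof -
  have cont: "continuous_on (cball 0 1) H" using hol by (rule holomorphic_on_imp_continuous_on)
  have "((\<lambda>u. H u / (u - 0)) has_contour_integral (2 * of_real pi * \<i> * H 0)) (circlepath 0 1)"
    using hol by (intro Cauchy_integral_circlepath cont) (auto intro: holomorphic_on_subset)
  then have "((\<lambda>t. H (cis t) * \<i>) has_integral (2 * of_real pi * \<i> * H 0)) {0..2*pi}"
    unfolding circlepath_def by (simp add: has_contour_integral_part_circlepath_iff mult.assoc)
  then have "((\<lambda>t. H (cis t) * \<i> * (-\<i>)) has_integral (2 * of_real pi * \<i> * H 0 * (-\<i>))) {0..2*pi}"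
    by (rule has_integral_mult_left)
  then have A: "((\<lambda>t. H (cis t)) has_integral (of_real (2 * pi) * H 0)) {0..2*pi}"
    by (simp add: mult_ac)
  have "continuous_on {0..2*pi} (\<lambda>t. H (cis t))"
    by (rule continuous_on_compose2[OF cont]) (auto intro!: continuous_intros)
  then have "set_integrable lborel {0..2*pi} (\<lambda>t. H (cis t))"
    unfolding set_integrable_def by (intro borel_integrable_compact) auto
  from set_borel_integral_eq_integral(2)[OF this] A show ?thesis
    by (simp add: set_lebesgue_integral_def integral_unique)
qed

text \<open>The ball and Lebesgue measure are invariant under \<open>v \<mapsto> cis t *s v\<close>. Averaging over \<open>t\<close> and
  exchanging the integrals reduces the claim to the mean value property on circles in the complex
  lines through the centre.\<close>

lemma holomorphic_fun_mean_value:
  fixes h :: "complex^'n \<Rightarrow> complex"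
  assumes hol: "holomorphic_fun \<Omega> h" and sub: "cball z \<rho> \<subseteq> \<Omega>"
  shows "(\<integral>v. indicator (cball z \<rho>) v *\<^sub>R h v \<partial>lborel) = of_real (measure lborel (cball z \<rho>)) * h z"
proof -
  let ?B = "cball 0 \<rho> :: (complex^'n) set" and ?I = "{0..2*pi}"
  define F where "F v = indicator ?B v *\<^sub>R h (z + v)" for v
  have cont_h: "continuous_on ?B (\<lambda>v. h (z + v))"
    by (rule continuous_on_compose2[OF holomorphic_fun_continuous_on[OF hol]])
       (use sub in \<open>auto intro!: continuous_intros simp: subset_iff dist_norm\<close>)
  have F_int: "integrable lborel F"
    unfolding F_def using cont_h by (intro borel_integrable_compact) auto
  then have [measurable]: "F \<in> borel_measurable borel" by auto
  have rot: "(\<integral>v. F (cis t *s v) \<partial>lborel) = (\<integral>v. F v \<partial>lborel)" for t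
    by (rule integral_lborel_linear_isometry) (auto simp: linear_smult_right norm_smult_vec)
  define G where "G = (\<lambda>(v, t). indicator (?B \<times> ?I) (v, t) *\<^sub>R h (z + cis t *s v))"
  have G_eq: "G (v, t) = indicator ?I t *\<^sub>R F (cis t *s v)" for v t
    by (auto simp: G_def F_def indicator_def norm_smult_vec)
  have cont_s: "continuous_on (?B \<times> ?I) (\<lambda>p. cis (snd p) *s (fst p))"
    unfolding vector_scalar_mult_def by (intro continuous_intros)
  have "continuous_on (?B \<times> ?I) (\<lambda>p. h (z + cis (snd p) *s fst p))"
    by (rule continuous_on_compose2[OF cont_h cont_s]) (auto simp: norm_smult_vec)
  then have "integrable lborel (\<lambda>p. indicator (?B \<times> ?I) p *\<^sub>R h (z + cis (snd p) *s fst p))"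
    by (intro borel_integrable_compact compact_Times) auto
  then have G_int: "integrable (lborel \<Otimes>\<^sub>M lborel) G"
    unfolding lborel_prod G_def by (simp add: case_prod_beta')
  have "of_real (2 * pi) * (\<integral>v. F v \<partial>lborel) = (\<integral>t. \<integral>v. G (v, t) \<partial>lborel \<partial>lborel)"
    by (simp add: G_eq rot scaleR_conv_of_real)
  also have "\<dots> = (\<integral>v. \<integral>t. G (v, t) \<partial>lborel \<partial>lborel)"
    using lborel_pair.Fubini_integral[of "\<lambda>v t. G (v, t)"] G_int by simp
  also have "\<dots> = (\<integral>v. indicator ?B v *\<^sub>R (of_real (2 * pi) * h z) \<partial>lborel)"
  proof (intro Bochner_Integration.integral_cong refl)
    fix v :: "complex^'n"
    show "(\<integral>t. G (v, t) \<partial>lborel) = indicator ?B v *\<^sub>R (of_real (2 * pi) * h z)"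
    proof (cases "v \<in> ?B")
      case True
      have "(\<lambda>\<zeta>. h (z + \<zeta> *s v)) holomorphic_on cball 0 1"
      proof (rule holomorphic_on_complex_line[OF hol])
        fix \<zeta> :: complex assume "\<zeta> \<in> cball 0 1"
        then have "cmod \<zeta> * norm v \<le> 1 * \<rho>" using True by (intro mult_mono) auto
        then show "z + \<zeta> *s v \<in> \<Omega>" using sub by (auto simp: subset_iff dist_norm norm_smult_vec)
      qed
      from circle_mean[OF this] show ?thesis using True by (simp add: G_def indicator_def)
    next
      case False
      then have "G (v, t) = 0" for t by (auto simp: G_def)
      then show ?thesis using False by simp
    qed
  qed
  also have "\<dots> = of_real (2 * pi) * (of_real (measure lborel ?B) * h z)"
    by (subst integral_scaleR_left)
       (auto simp: scaleR_conv_of_real intro!: integrable_real_indicator emeasure_lborel_cball_finite)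
  finally have "(\<integral>v. F v \<partial>lborel) = of_real (measure lborel ?B) * h z"
    by (simp del: of_real_mult)
  moreover have "(\<integral>v. indicator (cball z \<rho>) v *\<^sub>R h v \<partial>lborel) = (\<integral>v. F v \<partial>lborel)"
  proof -
    have "continuous_on (cball z \<rho>) h"
      using holomorphic_fun_continuous_on[OF hol] sub continuous_on_subset by blast
    then have [measurable]: "(\<lambda>v. indicator (cball z \<rho>) v *\<^sub>R h v) \<in> borel_measurable borel"
      by (intro borel_measurable_continuous_on_indicator) auto
    have "(\<integral>v. indicator (cball z \<rho>) v *\<^sub>R h v \<partial>lborel)
        = (\<integral>v. indicator (cball z \<rho>) (z + v) *\<^sub>R h (z + v) \<partial>lborel)"
      by (rule integral_lborel_translate[symmetric]) fact
    also have "\<dots> = (\<integral>v. F v \<partial>lborel)"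
      by (intro Bochner_Integration.integral_cong) (auto simp: F_def indicator_def dist_norm)
    finally show ?thesis .
  qed
  moreover have "measure lborel (cball z \<rho>) = measure lborel ?B"
    by (cases "\<rho> \<ge> 0") (auto simp: content_cball)
  ultimately show ?thesis by simp
qed

lemma holomorphic_fun_power2:
  "holomorphic_fun \<Omega> h \<Longrightarrow> holomorphic_fun \<Omega> (\<lambda>z. (h z)\<^sup>2)"
  unfolding holomorphic_fun_def
proof
  fix z assume "\<forall>z\<in>\<Omega>. \<exists>D. (h has_derivative D) (at z) \<and> (\<forall>c v. D (c *s v) = c * D v)" "z \<in> \<Omega>"
  then obtain D where D: "(h has_derivative D) (at z)" "\<And>c v. D (c *s v) = c * D v" by blast
  have "((\<lambda>z. (h z)\<^sup>2) has_derivative (\<lambda>v. 2 * h z * D v)) (at z)"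
    using D by (auto intro!: derivative_eq_intros simp: fun_eq_iff)
  then show "\<exists>D. ((\<lambda>z. (h z)\<^sup>2) has_derivative D) (at z) \<and> (\<forall>c v. D (c *s v) = c * D v)"
    using D by (intro exI[where x="\<lambda>v. 2 * h z * D v"]) auto
qed

lemma borel_measurable_lebesgue_on_continuous:
  assumes "open \<Omega>" "continuous_on \<Omega> f"
  shows "f \<in> borel_measurable (lebesgue_on \<Omega>)"
  using assms by (intro continuous_imp_measurable_on_sets_lebesgue) auto

text \<open>The mean value property of the holomorphic function \<open>h\<^sup>2\<close>, followed by the triangle inequality for
  the integral.\<close>

lemma bergman_pointwise_bound:
  fixes h :: "complex^'n \<Rightarrow> complex"
  assumes op: "open \<Omega>" and hol: "holomorphic_fun \<Omega> h" and sub: "cball z \<rho> \<subseteq> \<Omega>"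
    and int: "integrable (lebesgue_on \<Omega>) (\<lambda>z. (cmod (h z))\<^sup>2)"
  shows "(cmod (h z))\<^sup>2 * measure lborel (cball z \<rho>) \<le> (LINT z|lebesgue_on \<Omega>. (cmod (h z))\<^sup>2)"
proof -
  have cont: "continuous_on (cball z \<rho>) (\<lambda>z. (cmod (h z))\<^sup>2)"
    using holomorphic_fun_continuous_on[OF hol] sub by (intro continuous_intros) (rule continuous_on_subset)
  have cint: "integrable lborel (\<lambda>v. indicator (cball z \<rho>) v *\<^sub>R (cmod (h v))\<^sup>2)"
    using cont by (intro borel_integrable_compact) auto
  have "(cmod (h z))\<^sup>2 * measure lborel (cball z \<rho>) = cmod (of_real (measure lborel (cball z \<rho>)) * (h z)\<^sup>2)"
    by (simp add: norm_mult norm_power mult.commute)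
  also have "\<dots> = cmod (\<integral>v. indicator (cball z \<rho>) v *\<^sub>R (h v)\<^sup>2 \<partial>lborel)"
    by (subst holomorphic_fun_mean_value[OF holomorphic_fun_power2[OF hol] sub]) simp
  also have "\<dots> \<le> (\<integral>v. cmod (indicator (cball z \<rho>) v *\<^sub>R (h v)\<^sup>2) \<partial>lborel)"
    by (rule integral_norm_bound)
  also have "\<dots> = (\<integral>v. indicator (cball z \<rho>) v *\<^sub>R (cmod (h v))\<^sup>2 \<partial>lborel)"
    by (intro Bochner_Integration.integral_cong) (auto simp: norm_power)
  also have "\<dots> = (\<integral>v. indicator (cball z \<rho>) v *\<^sub>R (cmod (h v))\<^sup>2 \<partial>lebesgue)"
    using cint by (intro integral_completion[symmetric]) auto
  also have "\<dots> \<le> (\<integral>v. indicator \<Omega> v *\<^sub>R (cmod (h v))\<^sup>2 \<partial>lebesgue)"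
  proof (rule integral_mono)
    show "integrable lebesgue (\<lambda>v. indicator (cball z \<rho>) v *\<^sub>R (cmod (h v))\<^sup>2)"
      using cint by (subst integrable_completion) auto
    show "integrable lebesgue (\<lambda>v. indicator \<Omega> v *\<^sub>R (cmod (h v))\<^sup>2)"
      using int op by (subst (asm) integrable_restrict_space) auto
  qed (use sub in \<open>auto simp: indicator_def\<close>)
  also have "\<dots> = (LINT z|lebesgue_on \<Omega>. (cmod (h z))\<^sup>2)"
    using op by (subst integral_restrict_space) auto
  finally show ?thesis .
qed

section \<open>Integration by parts\<close>

text \<open>By translation invariance the difference quotients of \<open>F\<close> in direction \<open>v\<close> have integral \<open>0\<close>. The bound
  on the derivative makes them uniformly bounded on a fixed ball, so dominated convergence applies.\<close>

lemma integral_directional_derivative_eq_0: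
  fixes F :: "'a::euclidean_space \<Rightarrow> complex"
  assumes der: "\<And>x. (F has_derivative D x) (at x)"
    and bd: "\<And>x. cmod (D x v) \<le> L"
    and S: "bounded S" and supp: "\<And>x. x \<notin> S \<Longrightarrow> F x = 0"
  shows "integrable lborel (\<lambda>x. D x v)" "(\<integral>x. D x v \<partial>lborel) = 0"
proof -
  obtain r where r: "\<And>x. x \<in> S \<Longrightarrow> norm x \<le> r"
    using S by (auto simp: bounded_iff)
  have contF: "continuous_on UNIV F"
    using der by (meson continuous_at_imp_continuous_on has_derivative_continuous)
  have [measurable]: "F \<in> borel_measurable borel"
    using contF by (rule borel_measurable_continuous_onI)
  have "integrable lborel (\<lambda>x. indicator (cball 0 r) x *\<^sub>R F x)"
    using contF by (intro borel_integrable_compact) (auto intro: continuous_on_subset)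
  moreover have "(\<lambda>x. indicator (cball 0 r) x *\<^sub>R F x) = F"
    using r supp by (force simp: fun_eq_iff indicator_def)
  ultimately have F_int: "integrable lborel F" by simp
  define t where "t k = inverse (real (Suc k))" for k
  have t: "0 < t k" "t k \<le> 1" for k by (auto simp: t_def field_simps)
  have t_lim: "t \<longlonglongrightarrow> 0" unfolding t_def by (rule LIMSEQ_inverse_real_of_nat)
  define q where "q k x = (F (t k *\<^sub>R v + x) - F x) /\<^sub>R t k" for k x
  have [measurable]: "q k \<in> borel_measurable lborel" for k unfolding q_def by measurable
  have q_lim: "(\<lambda>k. q k x) \<longlonglongrightarrow> D x v" for x
  proof -
    have lin: "bounded_linear (D x)" using der by (rule has_derivative_bounded_linear)
    show ?thesis
    proof (cases "v = 0")
      case True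
      then show ?thesis using lin by (simp add: q_def linear_simps)
    next
      case False
      have "((\<lambda>h. cmod (F (x + h) - F x - D x h) / norm h) \<longlongrightarrow> 0) (at 0)"
        using der[of x] by (simp add: has_derivative_at)
      moreover have "filterlim (\<lambda>k. t k *\<^sub>R v) (at 0) sequentially"
        unfolding filterlim_at using tendsto_scaleR[OF t_lim tendsto_const, of v] t False
        by (auto simp: less_imp_neq[THEN not_sym])
      ultimately have "(\<lambda>k. cmod (F (x + t k *\<^sub>R v) - F x - D x (t k *\<^sub>R v)) / norm (t k *\<^sub>R v)) \<longlonglongrightarrow> 0"
        by (rule filterlim_compose)
      from tendsto_mult_left[OF this, of "norm v"]
      have lim0: "(\<lambda>k. norm v * (cmod (F (x + t k *\<^sub>R v) - F x - D x (t k *\<^sub>R v)) / norm (t k *\<^sub>R v))) \<longlonglongrightarrow> 0"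
        by simp
      have "norm v * (cmod (F (x + t k *\<^sub>R v) - F x - D x (t k *\<^sub>R v)) / norm (t k *\<^sub>R v)) = cmod (q k x - D x v)" for k
      proof -
        have "q k x - D x v = (F (x + t k *\<^sub>R v) - F x - D x (t k *\<^sub>R v)) /\<^sub>R t k"
          using t(1)[of k] by (simp add: q_def linear_simps(5)[OF lin] add.commute scaleR_diff_right)
        then have "cmod (q k x - D x v) = cmod (F (x + t k *\<^sub>R v) - F x - D x (t k *\<^sub>R v)) / t k"
          using t(1)[of k] by (simp only: norm_scaleR norm_inverse) (simp add: divide_inverse mult.commute)
        then show ?thesis using False t(1)[of k] by simp
      qed
      with lim0 have "(\<lambda>k. cmod (q k x - D x v)) \<longlonglongrightarrow> 0" by simp
      then show ?thesis by (rule LIM_zero_cancel[OF tendsto_norm_zero_cancel])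
    qed
  qed
  have incr: "cmod (F (s *\<^sub>R v + x) - F x) \<le> L * s" if "s > 0" for s x
  proof -
    have "cmod (F (x + s *\<^sub>R v) - F (x + 0 *\<^sub>R v)) \<le> L * norm (s - 0)"
    proof (rule differentiable_bound[where S=UNIV and f="\<lambda>s. F (x + s *\<^sub>R v)" and f'="\<lambda>s c. D (x + s *\<^sub>R v) (c *\<^sub>R v)"])
      fix s
      show "((\<lambda>s. F (x + s *\<^sub>R v)) has_derivative (\<lambda>c. D (x + s *\<^sub>R v) (c *\<^sub>R v))) (at s within UNIV)"
        by (rule has_derivative_compose[where g=F and f="\<lambda>s. x + s *\<^sub>R v"])
           (auto intro!: derivative_eq_intros der)
      show "onorm (\<lambda>c. D (x + s *\<^sub>R v) (c *\<^sub>R v)) \<le> L"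
      proof (rule onorm_le)
        fix c
        have "D (x + s *\<^sub>R v) (c *\<^sub>R v) = c *\<^sub>R D (x + s *\<^sub>R v) v"
          using der has_derivative_bounded_linear linear_simps(5) by blast
        then show "cmod (D (x + s *\<^sub>R v) (c *\<^sub>R v)) \<le> L * norm c"
          using mult_right_mono[OF bd, of "norm c"] by (simp add: mult.commute)
      qed
    qed auto
    then show ?thesis using that by (simp add: add.commute)
  qed
  define B where "B = cball (0::'a) (r + norm v)"
  have q_bd: "cmod (q k x) \<le> L * indicator B x" for k x
  proof (cases "x \<in> B")
    case True
    have "cmod (q k x) = cmod (F (t k *\<^sub>R v + x) - F x) / t k"
      unfolding q_def using t(1)[of k]
      by (simp only: norm_scaleR norm_inverse) (simp add: divide_inverse mult.commute)
    also have "\<dots> \<le> L"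
      using incr[OF t(1), of k x] t(1)[of k] by (simp add: divide_le_eq)
    finally show ?thesis using True by simp
  next
    case False
    then have x: "norm x > r + norm v" by (simp add: B_def)
    have "norm (t k *\<^sub>R v) \<le> norm v" using t[of k] by (simp add: mult_left_le_one_le)
    moreover have "norm x \<le> norm (t k *\<^sub>R v + x) + norm (t k *\<^sub>R v)"
      using norm_triangle_ineq4[of "t k *\<^sub>R v + x" "t k *\<^sub>R v"] by simp
    ultimately have "t k *\<^sub>R v + x \<notin> S" "x \<notin> S"
      using x r[of x] r[of "t k *\<^sub>R v + x"] norm_ge_zero[of v] by linarith+
    then show ?thesis using False supp by (simp add: q_def)
  qed
  have dom: "integrable lborel (\<lambda>x. L * indicator B x)"
    unfolding B_def by (intro integrable_mult_right integrable_real_indicator emeasure_lborel_cball_finite) auto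
  have [measurable]: "(\<lambda>x. D x v) \<in> borel_measurable lborel"
    by (rule borel_measurable_LIMSEQ_metric[OF _ q_lim]) measurable
  show "integrable lborel (\<lambda>x. D x v)"
    by (rule integrable_dominated_convergence[where s=q and w="\<lambda>x. L * indicator B x"])
       (use dom q_lim q_bd in auto)
  have "(\<lambda>k. \<integral>x. q k x \<partial>lborel) \<longlonglongrightarrow> (\<integral>x. D x v \<partial>lborel)"
    by (rule integral_dominated_convergence[where w="\<lambda>x. L * indicator B x"])
       (use dom q_lim q_bd in auto)
  moreover have "(\<integral>x. q k x \<partial>lborel) = 0" for k
  proof -
    have "integrable lborel (\<lambda>x. F (t k *\<^sub>R v + x))"
      using F_int integrable_distr_eq[of "(+) (t k *\<^sub>R v)" lborel borel F]
      by (simp add: lborel_distr_plus)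
    then show ?thesis
      using F_int integral_lborel_translate[of F "t k *\<^sub>R v"] by (simp add: q_def)
  qed
  ultimately have "(\<lambda>k. 0) \<longlonglongrightarrow> (\<integral>x. D x v \<partial>lborel)" by simp
  then show "(\<integral>x. D x v \<partial>lborel) = 0"
    by (rule LIMSEQ_unique[OF _ tendsto_const])
qed

text \<open>Cauchy estimates at distance \<open>e\<close> inside \<open>\<Omega>\<close>, with the bound of \<open>h\<close> on the compact
  \<open>e\<close>-neighbourhood \<open>K'\<close> of \<open>K\<close>.\<close>

lemma holomorphic_derivative_bounded_on_compact:
  fixes h :: "complex^'n \<Rightarrow> complex"
  assumes op: "open \<Omega>" and K: "compact K" "K \<subseteq> \<Omega>" and hol: "holomorphic_fun \<Omega> h"
    and der: "\<And>z. z \<in> \<Omega> \<Longrightarrow> (h has_derivative D z) (at z)"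
    and lin: "\<And>z c v. z \<in> \<Omega> \<Longrightarrow> D z (c *s v) = c * D z v"
  obtains B where "\<And>z. z \<in> K \<Longrightarrow> cmod (D z v) \<le> B"
proof -
  obtain e where e: "e > 0" "(\<Union>x\<in>K. cball x e) \<subseteq> \<Omega>"
    using compact_subset_open_imp_cball_epsilon_subset[OF K(1) op K(2)] by blast
  define K' where "K' = {x + y |x y. x \<in> K \<and> y \<in> cball 0 e}"
  have K'_cball: "cball x e \<subseteq> K'" if "x \<in> K" for x
  proof
    fix y assume "y \<in> cball x e"
    then have "y = x + (y - x)" "y - x \<in> cball 0 e" by (auto simp: dist_norm norm_minus_commute)
    then show "y \<in> K'" using that unfolding K'_def by blast
  qed
  have "K' \<subseteq> \<Omega>"
    using e(2) by (force simp: K'_def dist_norm subset_iff)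
  moreover have "compact K'" unfolding K'_def by (intro compact_sums K) auto
  ultimately have "bounded (h ` K')"
    using holomorphic_fun_continuous_on[OF hol] by (meson compact_continuous_image compact_imp_bounded continuous_on_subset)
  then obtain C where C: "\<And>x. x \<in> K' \<Longrightarrow> cmod (h x) \<le> C" by (auto simp: bounded_iff)
  show ?thesis
  proof
    fix z assume z: "z \<in> K"
    show "cmod (D z v) \<le> C / e * norm v"
      using z K e K'_cball[OF z] der lin
      by (intro directional_cauchy_estimate[OF hol, of z e]) (auto intro!: C)
  qed
qed

lemma integral_lborel_indicator_eq_lebesgue_on:
  fixes f :: "'a::euclidean_space \<Rightarrow> complex"
  assumes "open \<Omega>" "integrable lborel (\<lambda>z. indicator \<Omega> z *\<^sub>R f z)"
  shows "(LINT z|lebesgue_on \<Omega>. f z) = (\<integral>z. indicator \<Omega> z *\<^sub>R f z \<partial>lborel)"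
proof -
  have "(LINT z|lebesgue_on \<Omega>. f z) = (\<integral>z. indicator \<Omega> z *\<^sub>R f z \<partial>lebesgue)"
    using assms by (subst integral_restrict_space) auto
  also have "\<dots> = (\<integral>z. indicator \<Omega> z *\<^sub>R f z \<partial>lborel)"
    using assms by (intro integral_completion) auto
  finally show ?thesis .
qed

text \<open>The expression \<open>U z a - \<i> * U z (\<i> *s a)\<close> is twice the Wirtinger derivative of \<open>u\<close> in the complex
  direction \<open>a\<close>. The same operator kills \<open>cnj \<circ> h\<close>, so its value on \<open>u * cnj h\<close>, whose integral is \<open>0\<close>, is its
  value on \<open>u\<close> times \<open>cnj h\<close>.\<close>

lemma wirtinger_derivative_orthogonal_compact_support:
  fixes h u :: "complex^'n \<Rightarrow> complex"
  assumes op: "open \<Omega>" and K: "compact K" "K \<subseteq> \<Omega>" and hol: "holomorphic_fun \<Omega> h"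
    and der: "\<And>z. z \<in> \<Omega> \<Longrightarrow> (u has_derivative U z) (at z)"
    and bd: "\<And>z. z \<in> K \<Longrightarrow> cmod (U z a) \<le> L" "\<And>z. z \<in> K \<Longrightarrow> cmod (U z (\<i> *s a)) \<le> L"
    and supp: "\<And>z. z \<in> \<Omega> - K \<Longrightarrow> u z = 0"
  shows "(LINT z|lebesgue_on \<Omega>. (U z a - \<i> * U z (\<i> *s a)) * cnj (h z)) = 0"
proof -
  obtain E where E: "\<And>z. z \<in> \<Omega> \<Longrightarrow> (h has_derivative E z) (at z)"
      "\<And>z c v. z \<in> \<Omega> \<Longrightarrow> E z (c *s v) = c * E z v"
    using hol unfolding holomorphic_fun_def by metis
  define F where "F z = (if z \<in> \<Omega> then u z * cnj (h z) else 0)" for z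
  define D where "D z v = (if z \<in> \<Omega> then U z v * cnj (h z) + u z * cnj (E z v) else 0)" for z v
  have opK: "open (- K)" using K(1) compact_imp_closed by blast
  have U0: "U z v = 0" if "z \<in> \<Omega> - K" for z v
  proof -
    have "open (\<Omega> - K)" using op K(1) compact_imp_closed by blast
    then have "((\<lambda>_. 0) has_derivative U z) (at z)"
      using has_derivative_transform_within_open[OF der[of z], of "\<Omega> - K" "\<lambda>_. 0"] that supp by auto
    moreover have "((\<lambda>_. 0::complex) has_derivative (\<lambda>_. 0)) (at z)" by simp
    ultimately have "U z = (\<lambda>_. 0)" by (rule has_derivative_unique)
    then show ?thesis by simp
  qed
  have derF: "(F has_derivative D z) (at z)" for z
  proof (cases "z \<in> \<Omega>")
    case True
    have "((\<lambda>z. u z * cnj (h z)) has_derivative (\<lambda>v. u z * cnj (E z v) + U z v * cnj (h z))) (at z)"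
      by (rule has_derivative_mult[OF der[OF True] has_derivative_cnj[OF E(1)[OF True]]])
    then have "(F has_derivative (\<lambda>v. u z * cnj (E z v) + U z v * cnj (h z))) (at z)"
      by (rule has_derivative_transform_within_open[OF _ op True]) (simp add: F_def)
    then show ?thesis using True by (simp add: D_def[abs_def] add.commute)
  next
    case False
    then have "z \<in> - K" using K by auto
    have "((\<lambda>_. 0) has_derivative (\<lambda>_. 0::complex)) (at z)" by simp
    then have "(F has_derivative (\<lambda>_. 0)) (at z)"
      by (rule has_derivative_transform_within_open[OF _ opK \<open>z \<in> - K\<close>]) (use supp in \<open>auto simp: F_def\<close>)
    then show ?thesis using False by (simp add: D_def[abs_def])
  qed
  have cont_u: "continuous_on \<Omega> u"
    using der by (meson continuous_at_imp_continuous_on has_derivative_continuous)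
  have "bounded (h ` K)" "bounded (u ` K)"
    using holomorphic_fun_continuous_on[OF hol] cont_u K
    by (meson compact_continuous_image compact_imp_bounded continuous_on_subset)+
  then obtain H M where HM: "\<And>z. z \<in> K \<Longrightarrow> cmod (h z) \<le> H" "\<And>z. z \<in> K \<Longrightarrow> cmod (u z) \<le> M"
    by (auto simp: bounded_iff)
  have deriv_int: "integrable lborel (\<lambda>z. D z v) \<and> (\<integral>z. D z v \<partial>lborel) = 0"
    if U_bd: "\<And>z. z \<in> K \<Longrightarrow> cmod (U z v) \<le> L" for v
  proof -
    obtain B where B: "\<And>z. z \<in> K \<Longrightarrow> cmod (E z v) \<le> B"
      using holomorphic_derivative_bounded_on_compact[OF op K hol E] by blast
    define C where "C = \<bar>L\<bar> * \<bar>H\<bar> + \<bar>M\<bar> * \<bar>B\<bar>"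
    have C0: "C \<ge> 0" by (simp add: C_def)
    have "cmod (D z v) \<le> C" for z
    proof (cases "z \<in> K")
      case True
      then have "cmod (D z v) \<le> cmod (U z v) * cmod (h z) + cmod (u z) * cmod (E z v)"
        using K norm_triangle_ineq[of "U z v * cnj (h z)" "u z * cnj (E z v)"] by (auto simp: D_def norm_mult)
      also have "\<dots> \<le> C" unfolding C_def
        using U_bd[OF True] HM[OF True] B[OF True] by (intro add_mono mult_mono) auto
      finally show ?thesis .
    next
      case False
      then show ?thesis using U0[of z v] supp[of z] C0 by (auto simp: D_def)
    qed
    then show ?thesis
      using integral_directional_derivative_eq_0[OF derF, of v C K] K(1) supp
      by (auto simp: F_def compact_imp_bounded)
  qed
  have I: "integrable lborel (\<lambda>z. D z a)" "(\<integral>z. D z a \<partial>lborel) = 0"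
       "integrable lborel (\<lambda>z. D z (\<i> *s a))" "(\<integral>z. D z (\<i> *s a) \<partial>lborel) = 0"
    using deriv_int bd by auto
  have eq: "indicator \<Omega> z *\<^sub>R ((U z a - \<i> * U z (\<i> *s a)) * cnj (h z)) = D z a - \<i> * D z (\<i> *s a)" for z
    by (auto simp: D_def E(2) algebra_simps indicator_def)
  show ?thesis
    by (subst integral_lborel_indicator_eq_lebesgue_on[OF op]) (use I in \<open>auto simp: eq\<close>)
qed

section \<open>Square integrable functions\<close>

lemma mult_le_sum_squares: "(x::real) * y \<le> x\<^sup>2 + y\<^sup>2"
  using sum_squares_bound[of x y] zero_le_power2[of x] zero_le_power2[of y] by linarith

lemma integrable_mult_cnj_square:
  fixes f g :: "'a \<Rightarrow> complex"
  assumes [measurable]: "f \<in> borel_measurable M" "g \<in> borel_measurable M"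
    and "integrable M (\<lambda>x. (cmod (f x))\<^sup>2)" "integrable M (\<lambda>x. (cmod (g x))\<^sup>2)"
  shows "integrable M (\<lambda>x. f x * cnj (g x))"
proof (rule Bochner_Integration.integrable_bound)
  have [measurable]: "(\<lambda>x. cnj (g x)) \<in> borel_measurable M"
    by (rule measurable_compose[OF assms(2) borel_measurable_continuous_onI]) (intro continuous_intros)
  show "(\<lambda>x. f x * cnj (g x)) \<in> borel_measurable M" by measurable
  show "integrable M (\<lambda>x. (cmod (f x))\<^sup>2 + (cmod (g x))\<^sup>2)" using assms by auto
  show "AE x in M. norm (f x * cnj (g x)) \<le> norm ((cmod (f x))\<^sup>2 + (cmod (g x))\<^sup>2)"
    by (auto simp: norm_mult mult_le_sum_squares)
qed

lemma cmod_add_scaled_square: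
  "(cmod (x - c * y))\<^sup>2 = (cmod x)\<^sup>2 - 2 * Re (cnj c * (x * cnj y)) + (cmod c)\<^sup>2 * (cmod y)\<^sup>2"
  by (simp add: cmod_power2) (simp add: power2_eq_square algebra_simps)

text \<open>The expansion of \<open>|f - c g|\<^sup>2\<close> in \<open>c\<close>, which yields both the vector space structure of \<open>L\<^sup>2\<close> and the
  variational argument for orthogonality.\<close>

lemma integrable_square_diff_scaled:
  fixes f g :: "'a \<Rightarrow> complex"
  assumes [measurable]: "f \<in> borel_measurable M" "g \<in> borel_measurable M"
    and f: "integrable M (\<lambda>x. (cmod (f x))\<^sup>2)" and g: "integrable M (\<lambda>x. (cmod (g x))\<^sup>2)"
  shows "integrable M (\<lambda>x. (cmod (f x - c * g x))\<^sup>2)"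
    and "(\<integral>x. (cmod (f x - c * g x))\<^sup>2 \<partial>M) = (\<integral>x. (cmod (f x))\<^sup>2 \<partial>M)
          - 2 * Re (cnj c * (\<integral>x. f x * cnj (g x) \<partial>M)) + (cmod c)\<^sup>2 * (\<integral>x. (cmod (g x))\<^sup>2 \<partial>M)"
proof -
  have fg: "integrable M (\<lambda>x. f x * cnj (g x))" using assms by (rule integrable_mult_cnj_square)
  define R where "R x = Re (cnj c * (f x * cnj (g x)))" for x
  have i: "integrable M R"
    unfolding R_def using fg by (intro integrable_Re integrable_mult_right)
  have iR: "(\<integral>x. R x \<partial>M) = Re (cnj c * (\<integral>x. f x * cnj (g x) \<partial>M))"
    unfolding R_def using fg by (subst integral_Re) auto
  have eq: "(cmod (f x - c * g x))\<^sup>2 = (cmod (f x))\<^sup>2 - 2 * R x + (cmod c)\<^sup>2 * (cmod (g x))\<^sup>2" for x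
    unfolding R_def by (rule cmod_add_scaled_square)
  show "integrable M (\<lambda>x. (cmod (f x - c * g x))\<^sup>2)"
    unfolding eq using f g i by auto
  show "(\<integral>x. (cmod (f x - c * g x))\<^sup>2 \<partial>M) = (\<integral>x. (cmod (f x))\<^sup>2 \<partial>M)
          - 2 * Re (cnj c * (\<integral>x. f x * cnj (g x) \<partial>M)) + (cmod c)\<^sup>2 * (\<integral>x. (cmod (g x))\<^sup>2 \<partial>M)"
    unfolding eq iR[symmetric] using f g i by simp
qed

lemma Lp_space_2_iff:
  "f \<in> Lp_space 2 \<Omega> \<longleftrightarrow> f \<in> borel_measurable (lebesgue_on \<Omega>) \<and> integrable (lebesgue_on \<Omega>) (\<lambda>z. (cmod (f z))\<^sup>2)"
  by (simp add: Lp_space_def)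

lemma holomorphic_fun_diff_scaled:
  assumes "holomorphic_fun \<Omega> f" "holomorphic_fun \<Omega> g"
  shows "holomorphic_fun \<Omega> (\<lambda>z. f z - c * g z)"
  unfolding holomorphic_fun_def
proof
  fix z assume "z \<in> \<Omega>"
  then obtain D E where D: "(f has_derivative D) (at z)" "\<And>c v. D (c *s v) = c * D v"
      and E: "(g has_derivative E) (at z)" "\<And>c v. E (c *s v) = c * E v"
    using assms unfolding holomorphic_fun_def by meson
  have "((\<lambda>z. f z - c * g z) has_derivative (\<lambda>v. D v - c * E v)) (at z)"
    using D E by (auto intro!: derivative_eq_intros)
  then show "\<exists>D. ((\<lambda>z. f z - c * g z) has_derivative D) (at z) \<and> (\<forall>c v. D (c *s v) = c * D v)"
    by (intro exI[where x="\<lambda>v. D v - c * E v"] conjI) (auto simp: D E algebra_simps)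
qed

lemma bergman_space_diff_scaled:
  assumes "f \<in> bergman_space 2 \<Omega>" "g \<in> bergman_space 2 \<Omega>"
  shows "(\<lambda>z. f z - c * g z) \<in> bergman_space 2 \<Omega>"
  using assms
  by (auto simp: bergman_space_def Lp_space_2_iff intro: holomorphic_fun_diff_scaled integrable_square_diff_scaled(1))

lemma Lp_space_2_diff_scaled:
  assumes "f \<in> Lp_space 2 \<Omega>" "g \<in> Lp_space 2 \<Omega>"
  shows "(\<lambda>z. f z - c * g z) \<in> Lp_space 2 \<Omega>"
  using assms by (auto simp: Lp_space_2_iff intro: integrable_square_diff_scaled(1))

lemma zero_in_bergman_space: "(\<lambda>_. 0) \<in> bergman_space 2 \<Omega>"
  by (auto simp: bergman_space_def Lp_space_2_iff holomorphic_fun_def intro!: exI[where x="\<lambda>_. 0"])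

section \<open>Existence of the Bergman projection\<close>

text \<open>Locally uniform convergence of the functions gives locally uniform convergence of the derivatives by
  the Cauchy estimates, and complex linearity passes to the limit.\<close>

lemma holomorphic_fun_limit:
  fixes h :: "nat \<Rightarrow> complex^'n \<Rightarrow> complex"
  assumes op: "open \<Omega>" and hol: "\<And>n. holomorphic_fun \<Omega> (h n)"
    and Cauchy: "\<And>z0. z0 \<in> \<Omega> \<Longrightarrow> \<exists>\<rho>>0. cball z0 \<rho> \<subseteq> \<Omega> \<and>
       (\<forall>e>0. \<exists>N. \<forall>m\<ge>N. \<forall>n\<ge>N. \<forall>z\<in>cball z0 \<rho>. cmod (h m z - h n z) \<le> e)"
  obtains H where "holomorphic_fun \<Omega> H" "\<And>z. z \<in> \<Omega> \<Longrightarrow> (\<lambda>n. h n z) \<longlonglongrightarrow> H z"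
proof -
  have "\<exists>E. \<forall>z\<in>\<Omega>. (h n has_derivative E z) (at z) \<and> (\<forall>c v. E z (c *s v) = c * E z v)" for n
    using hol unfolding holomorphic_fun_def by metis
  then obtain E where E: "\<And>n z. z \<in> \<Omega> \<Longrightarrow> (h n has_derivative E n z) (at z)"
      and lin: "\<And>n z c v. z \<in> \<Omega> \<Longrightarrow> E n z (c *s v) = c * E n z v"
    by metis
  define H where "H z = lim (\<lambda>n. h n z)" for z
  have loc: "(\<lambda>n. h n z0) \<longlonglongrightarrow> H z0 \<and> (\<exists>D. (H has_derivative D) (at z0) \<and> (\<forall>c v. D (c *s v) = c * D v))"
    if z0: "z0 \<in> \<Omega>" for z0
  proof -
    obtain \<rho> where \<rho>: "\<rho> > 0" "cball z0 \<rho> \<subseteq> \<Omega>"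
      and unif: "\<And>e. e > 0 \<Longrightarrow> \<exists>N. \<forall>m\<ge>N. \<forall>n\<ge>N. \<forall>z\<in>cball z0 \<rho>. cmod (h m z - h n z) \<le> e"
      using Cauchy[OF z0] by blast
    define r where "r = \<rho> / 2"
    let ?S = "ball z0 r"
    have r: "r > 0" using \<rho> by (simp add: r_def)
    have S\<Omega>: "z \<in> \<Omega>" if "z \<in> ?S" for z
      using that \<rho> by (auto simp: r_def subset_iff)
    have E_diff: "cmod (E m z v - E n z v) \<le> e / r * norm v"
      if z: "z \<in> ?S" and e: "\<forall>z\<in>cball z0 \<rho>. cmod (h m z - h n z) \<le> e" for m n z v e
    proof (rule directional_cauchy_estimate[where D="\<lambda>v. E m z v - E n z v" and h="\<lambda>z. h m z - h n z" and z=z and \<Omega>=\<Omega>])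
      have sub: "cball z r \<subseteq> cball z0 \<rho>"
      proof
        fix x assume "x \<in> cball z r"
        then show "x \<in> cball z0 \<rho>"
          using z dist_triangle[of z0 x z] by (simp add: r_def)
      qed
      then show "cball z r \<subseteq> \<Omega>" using \<rho> by blast
      show "cmod (h m x - h n x) \<le> e" if "x \<in> cball z r" for x using that sub e by blast
      show "holomorphic_fun \<Omega> (\<lambda>z. h m z - h n z)"
        using holomorphic_fun_diff_scaled[OF hol[of m] hol[of n], of 1] by simp
      show "((\<lambda>z. h m z - h n z) has_derivative (\<lambda>v. E m z v - E n z v)) (at z)"
        by (intro has_derivative_diff E S\<Omega> z)
      show "E m z (c *s u) - E n z (c *s u) = c * (E m z u - E n z u)" for c u
        using lin[OF S\<Omega>[OF z]] by (simp add: algebra_simps)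
    qed (fact r)
    have E_unif: "\<exists>N. \<forall>m\<ge>N. \<forall>n\<ge>N. \<forall>z\<in>?S. \<forall>v. cmod (E m z v - E n z v) \<le> e * norm v" if e_pos: "e > 0" for e
    proof -
      obtain N where N: "\<forall>m\<ge>N. \<forall>n\<ge>N. \<forall>z\<in>cball z0 \<rho>. cmod (h m z - h n z) \<le> e * r"
        using unif[OF mult_pos_pos[OF e_pos r]] by blast
      have "cmod (E m z v - E n z v) \<le> e * norm v" if "m \<ge> N" "n \<ge> N" "z \<in> ?S" for m n z v
        using E_diff[OF \<open>z \<in> ?S\<close>, of m n "e * r" v] N that r by simp
      then show ?thesis by blast
    qed
    define G where "G z v = lim (\<lambda>n. E n z v)" for z v
    have E_conv: "(\<lambda>n. E n z v) \<longlonglongrightarrow> G z v" if z: "z \<in> ?S" for z v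
    proof -
      have "Cauchy (\<lambda>n. E n z v)"
      proof (rule metric_CauchyI)
        fix e :: real assume e: "e > 0"
        define e' where "e' = e / (norm v + 1) / 2"
        have "e' > 0" using e by (simp add: e'_def add_nonneg_pos)
        have "0 < norm v + 1" by (simp add: add_nonneg_pos)
        then have "e' * (norm v + 1) = e / 2" unfolding e'_def by (simp del: distrib_left_numeral distrib_right_numeral)
        moreover have "e' * norm v \<le> e' * (norm v + 1)" using \<open>e' > 0\<close> by simp
        ultimately have *: "e' * norm v < e" using e by linarith
        obtain N where "\<forall>m\<ge>N. \<forall>n\<ge>N. \<forall>z\<in>?S. \<forall>v. cmod (E m z v - E n z v) \<le> e' * norm v"
          using E_unif[OF \<open>e' > 0\<close>] by blast
        then show "\<exists>N. \<forall>m\<ge>N. \<forall>n\<ge>N. dist (E m z v) (E n z v) < e"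
          using * z unfolding dist_norm by (meson order.strict_trans1)
      qed
      then show ?thesis unfolding G_def by (simp add: Cauchy_convergent_iff convergent_LIMSEQ_iff)
    qed
    have "Cauchy (\<lambda>n. h n z0)"
    proof (rule metric_CauchyI)
      fix e :: real assume e: "e > 0"
      then obtain N where N: "\<forall>m\<ge>N. \<forall>n\<ge>N. \<forall>z\<in>cball z0 \<rho>. cmod (h m z - h n z) \<le> e / 2"
        using unif[OF half_gt_zero[OF e]] by blast
      have "dist (h m z0) (h n z0) < e" if "m \<ge> N" "n \<ge> N" for m n
      proof -
        have "cmod (h m z0 - h n z0) \<le> e / 2" using N that \<rho> by simp
        then show ?thesis using e by (simp add: dist_norm)
      qed
      then show "\<exists>N. \<forall>m\<ge>N. \<forall>n\<ge>N. dist (h m z0) (h n z0) < e" by blast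
    qed
    then obtain l where l: "(\<lambda>n. h n z0) \<longlonglongrightarrow> l" using convergent_eq_Cauchy by blast
    have "\<exists>g. \<forall>x\<in>?S. (\<lambda>n. h n x) \<longlonglongrightarrow> g x \<and> (g has_derivative G x) (at x within ?S)"
    proof (rule has_derivative_sequence[where f=h and f'=E, OF _ _ _ _ l])
      show "(h n has_derivative E n x) (at x within ?S)" if "x \<in> ?S" for n x
        using E[OF S\<Omega>[OF that]] by (rule has_derivative_at_withinI)
      show "\<forall>\<^sub>F n in sequentially. \<forall>x\<in>?S. \<forall>v. norm (E n x v - G x v) \<le> e * norm v" if e_pos: "e > 0" for e
      proof -
        obtain N where N: "\<And>m n z v. m \<ge> N \<Longrightarrow> n \<ge> N \<Longrightarrow> z \<in> ?S \<Longrightarrow> cmod (E m z v - E n z v) \<le> e * norm v"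
          using E_unif[OF e_pos] by blast
        have "cmod (E n z v - G z v) \<le> e * norm v" if "n \<ge> N" "z \<in> ?S" for n z v
        proof (rule tendsto_upperbound)
          show "((\<lambda>m. cmod (E n z v - E m z v)) \<longlongrightarrow> cmod (E n z v - G z v)) sequentially"
            by (intro tendsto_intros E_conv that)
          show "\<forall>\<^sub>F m in sequentially. cmod (E n z v - E m z v) \<le> e * norm v"
            using N that unfolding eventually_sequentially by blast
        qed simp
        then show ?thesis unfolding eventually_sequentially by blast
      qed
    qed (use r in auto)
    then obtain g where g: "\<And>x. x \<in> ?S \<Longrightarrow> (\<lambda>n. h n x) \<longlonglongrightarrow> g x"
        "\<And>x. x \<in> ?S \<Longrightarrow> (g has_derivative G x) (at x within ?S)" by blast
    have Hg: "H x = g x" if "x \<in> ?S" for x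
      unfolding H_def using g(1)[OF that] by (rule limI)
    have z0S: "z0 \<in> ?S" using r by simp
    have "(g has_derivative G z0) (at z0)"
      using g(2)[OF z0S] at_within_open[OF z0S] by simp
    then have "(H has_derivative G z0) (at z0)"
      by (rule has_derivative_transform_within_open[OF _ open_ball z0S]) (simp add: Hg)
    moreover have "G z0 (c *s v) = c * G z0 v" for c v
    proof (rule LIMSEQ_unique)
      show "(\<lambda>n. E n z0 (c *s v)) \<longlonglongrightarrow> G z0 (c *s v)" by (rule E_conv[OF z0S])
      show "(\<lambda>n. E n z0 (c *s v)) \<longlonglongrightarrow> c * G z0 v"
        unfolding lin[OF z0] by (intro tendsto_intros E_conv[OF z0S])
    qed
    ultimately show ?thesis using g(1)[OF z0S] Hg[OF z0S] by auto
  qed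
  show ?thesis
    by (rule that[of H]) (use loc in \<open>auto simp: holomorphic_fun_def\<close>)
qed

text \<open>For a minimizing sequence the parallelogram identity makes the differences small in \<open>L\<^sup>2\<close>, hence
  small uniformly on compact sets by the pointwise bound. The limit is holomorphic, and Fatou's
  lemma shows that it attains the infimum.\<close>

lemma bergman_best_approximation:
  fixes \<phi> :: "complex^'n \<Rightarrow> complex"
  assumes op: "open \<Omega>" and \<phi>: "\<phi> \<in> Lp_space 2 \<Omega>"
  obtains H where "H \<in> bergman_space 2 \<Omega>"
    "\<And>k. k \<in> bergman_space 2 \<Omega> \<Longrightarrow>
      (LINT z|lebesgue_on \<Omega>. (cmod (\<phi> z - H z))\<^sup>2) \<le> (LINT z|lebesgue_on \<Omega>. (cmod (\<phi> z - k z))\<^sup>2)"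
proof -
  let ?M = "lebesgue_on \<Omega>" and ?A = "bergman_space 2 \<Omega>"
  define J where "J k = (LINT z|?M. (cmod (\<phi> z - k z))\<^sup>2)" for k
  define d where "d = Inf (J ` ?A)"
  have J0: "J k \<ge> 0" for k by (simp add: J_def)
  have bdd: "bdd_below (J ` ?A)" using J0 by (auto intro!: bdd_belowI[where m=0])
  have d_le: "d \<le> J k" if "k \<in> ?A" for k
    unfolding d_def using bdd that by (intro cInf_lower) auto
  have "\<exists>k\<in>?A. J k < d + inverse (real (Suc n))" for n
    using cInf_lessD[of "J ` ?A" "d + inverse (real (Suc n))"] zero_in_bergman_space[of \<Omega>]
    by (auto simp: d_def)
  then obtain h where hA: "\<And>n. h n \<in> ?A" and hJ: "\<And>n. J (h n) < d + inverse (real (Suc n))"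
    by metis
  have AL: "k \<in> Lp_space 2 \<Omega>" if "k \<in> ?A" for k using that by (simp add: bergman_space_def)
  have sq_int: "integrable ?M (\<lambda>z. (cmod (\<phi> z - k z))\<^sup>2)" if "k \<in> ?A" for k
    using Lp_space_2_diff_scaled[OF \<phi> AL[OF that], of 1] by (simp add: Lp_space_2_iff)
  have diff_A: "(\<lambda>z. h m z - h n z) \<in> ?A" for m n
    using bergman_space_diff_scaled[OF hA hA, of _ 1] by simp
  have par: "(LINT z|?M. (cmod (h m z - h n z))\<^sup>2) \<le> 2 * inverse (real (Suc m)) + 2 * inverse (real (Suc n))" for m n
  proof -
    let ?k = "\<lambda>z. (1/2) * (h m z + h n z)"
    have kA: "?k \<in> ?A"
      using bergman_space_diff_scaled[OF hA[of m] bergman_space_diff_scaled[OF hA[of m] hA[of n], of 1], of "1/2"]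
      by (simp add: algebra_simps)
    \<comment> \<open>parallelogram identity with the midpoint \<open>?k\<close>, which is again a competitor\<close>
    have "(cmod (h m z - h n z))\<^sup>2 = 2 * (cmod (\<phi> z - h m z))\<^sup>2 + 2 * (cmod (\<phi> z - h n z))\<^sup>2
        - 4 * (cmod (\<phi> z - ?k z))\<^sup>2" for z
      by (simp add: cmod_power2) (simp add: power2_eq_square field_simps)
    then have "(LINT z|?M. (cmod (h m z - h n z))\<^sup>2) = 2 * J (h m) + 2 * J (h n) - 4 * J ?k"
      unfolding J_def using sq_int[OF hA] sq_int[OF kA] by simp
    then show ?thesis using d_le[OF kA] hJ[of m] hJ[of n] by simp
  qed
  obtain H where H: "holomorphic_fun \<Omega> H" and lim: "\<And>z. z \<in> \<Omega> \<Longrightarrow> (\<lambda>n. h n z) \<longlonglongrightarrow> H z"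
  proof (rule holomorphic_fun_limit[OF op, of h])
    show "holomorphic_fun \<Omega> (h n)" for n using hA by (simp add: bergman_space_def)
    show "\<exists>\<rho>>0. cball z0 \<rho> \<subseteq> \<Omega> \<and> (\<forall>e>0. \<exists>N. \<forall>m\<ge>N. \<forall>n\<ge>N. \<forall>z\<in>cball z0 \<rho>. cmod (h m z - h n z) \<le> e)"
      if z0: "z0 \<in> \<Omega>" for z0
    proof -
      obtain R where R: "R > 0" "cball z0 R \<subseteq> \<Omega>" using op z0 open_contains_cball by blast
      define \<rho> where "\<rho> = R / 2"
      have \<rho>: "\<rho> > 0" using R by (simp add: \<rho>_def)
      define V where "V = measure lborel (cball z0 \<rho>)"
      have V: "V > 0" unfolding V_def using \<rho> by simp
      have bound: "(cmod (h m z - h n z))\<^sup>2 * V \<le> 2 * inverse (real (Suc m)) + 2 * inverse (real (Suc n))"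
        if z: "z \<in> cball z0 \<rho>" for m n z
      proof -
        have "cball z \<rho> \<subseteq> cball z0 R"
        proof
          fix x assume "x \<in> cball z \<rho>"
          then show "x \<in> cball z0 R"
            using z dist_triangle[of z0 x z] by (simp add: \<rho>_def)
        qed
        then have "cball z \<rho> \<subseteq> \<Omega>" using R by blast
        then have "(cmod (h m z - h n z))\<^sup>2 * measure lborel (cball z \<rho>) \<le> (LINT z|?M. (cmod (h m z - h n z))\<^sup>2)"
          using diff_A[of m n]
          by (intro bergman_pointwise_bound[OF op, of "\<lambda>z. h m z - h n z"]) (auto simp: bergman_space_def Lp_space_2_iff)
        moreover have "measure lborel (cball z \<rho>) = V" unfolding V_def using \<rho> by (simp add: content_cball)
        ultimately show ?thesis using par[of m n] by simp
      qed
      show ?thesis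
      proof (intro exI[of _ \<rho>] conjI \<rho> allI impI)
        show "cball z0 \<rho> \<subseteq> \<Omega>" using R by (auto simp: \<rho>_def subset_iff)
        fix e :: real assume e: "e > 0"
        obtain N where N: "inverse (real (Suc N)) < e\<^sup>2 * V / 4"
          using reals_Archimedean[of "e\<^sup>2 * V / 4"] e V by auto
        show "\<exists>N. \<forall>m\<ge>N. \<forall>n\<ge>N. \<forall>z\<in>cball z0 \<rho>. cmod (h m z - h n z) \<le> e"
        proof (intro exI[of _ N] allI impI ballI)
          fix m n z assume mn: "m \<ge> N" "n \<ge> N" and z: "z \<in> cball z0 \<rho>"
          have "inverse (real (Suc m)) \<le> inverse (real (Suc N))" "inverse (real (Suc n)) \<le> inverse (real (Suc N))"
            using mn by (auto intro!: le_imp_inverse_le)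
          then have "(cmod (h m z - h n z))\<^sup>2 * V \<le> e\<^sup>2 * V" using bound[OF z, of m n] N by linarith
          then have "(cmod (h m z - h n z))\<^sup>2 \<le> e\<^sup>2" using V by simp
          then show "cmod (h m z - h n z) \<le> e" by (rule power2_le_imp_le) (use e in simp)
        qed
      qed
    qed
  qed (rule that)
  have [measurable]: "H \<in> borel_measurable ?M"
    using holomorphic_fun_continuous_on[OF H] op by (intro borel_measurable_lebesgue_on_continuous)
  have [measurable]: "\<phi> \<in> borel_measurable ?M" using \<phi> by (simp add: Lp_space_2_iff)
  have [measurable]: "h n \<in> borel_measurable ?M" for n using AL[OF hA] by (simp add: Lp_space_2_iff)
  have nn: "(\<integral>\<^sup>+z. ennreal ((cmod (\<phi> z - H z))\<^sup>2) \<partial>?M) \<le> ennreal d"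
  proof -
    have "(\<integral>\<^sup>+z. ennreal ((cmod (\<phi> z - H z))\<^sup>2) \<partial>?M)
        = (\<integral>\<^sup>+z. liminf (\<lambda>n. ennreal ((cmod (\<phi> z - h n z))\<^sup>2)) \<partial>?M)"
    proof (rule nn_integral_cong)
      fix z assume "z \<in> space ?M"
      then have "z \<in> \<Omega>" by simp
      then have "(\<lambda>n. ennreal ((cmod (\<phi> z - h n z))\<^sup>2)) \<longlonglongrightarrow> ennreal ((cmod (\<phi> z - H z))\<^sup>2)"
        by (intro tendsto_intros lim tendsto_ennrealI)
      then show "ennreal ((cmod (\<phi> z - H z))\<^sup>2) = liminf (\<lambda>n. ennreal ((cmod (\<phi> z - h n z))\<^sup>2))"
        using lim_imp_Liminf by (metis trivial_limit_sequentially)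
    qed
    also have "\<dots> \<le> liminf (\<lambda>n. \<integral>\<^sup>+z. ennreal ((cmod (\<phi> z - h n z))\<^sup>2) \<partial>?M)"
      by (rule nn_integral_liminf) measurable
    also have "\<dots> = liminf (\<lambda>n. ennreal (J (h n)))"
      unfolding J_def using sq_int[OF hA] by (subst nn_integral_eq_integral) auto
    also have "\<dots> \<le> liminf (\<lambda>n. ennreal (d + inverse (real (Suc n))))"
      by (intro Liminf_mono always_eventually allI ennreal_leI less_imp_le hJ)
    also have "\<dots> = ennreal (d + 0)"
      by (intro lim_imp_Liminf tendsto_intros tendsto_ennrealI LIMSEQ_inverse_real_of_nat) simp
    finally show ?thesis by simp
  qed
  have d0: "d \<ge> 0" unfolding d_def using J0 zero_in_bergman_space[of \<Omega>] by (intro cInf_greatest) auto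
  have int: "integrable ?M (\<lambda>z. (cmod (\<phi> z - H z))\<^sup>2)"
  proof (rule integrableI_bounded)
    show "(\<integral>\<^sup>+z. ennreal (norm ((cmod (\<phi> z - H z))\<^sup>2)) \<partial>?M) < \<infinity>"
      using nn by (simp add: le_less_trans)
  qed measurable
  have "J H \<le> d"
    using nn int d0 unfolding J_def by (subst (asm) nn_integral_eq_integral) auto
  moreover have "H \<in> ?A"
  proof -
    have "(\<lambda>z. \<phi> z - H z) \<in> Lp_space 2 \<Omega>" using int by (simp add: Lp_space_2_iff)
    from Lp_space_2_diff_scaled[OF \<phi> this, of 1] show ?thesis
      using H by (simp add: bergman_space_def)
  qed
  ultimately show ?thesis
    using that[of H] d_le unfolding J_def by force
qed

text \<open>With \<open>I\<close> the inner product of \<open>\<phi> - H\<close> and \<open>k\<close>, minimality of \<open>H\<close> is tested against \<open>H + t I k\<close>. The choice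
  \<open>t = 1 / (K + 1)\<close>, where \<open>K\<close> is the square norm of \<open>k\<close>, makes the linear term dominate the quadratic one.\<close>

lemma bergman_orthogonal_decomposition:
  fixes \<phi> :: "complex^'n \<Rightarrow> complex"
  assumes op: "open \<Omega>" and \<phi>: "\<phi> \<in> Lp_space 2 \<Omega>"
  obtains H where "H \<in> bergman_space 2 \<Omega>"
    "\<And>k. k \<in> bergman_space 2 \<Omega> \<Longrightarrow> (LINT z|lebesgue_on \<Omega>. (\<phi> z - H z) * cnj (k z)) = 0"
proof -
  let ?M = "lebesgue_on \<Omega>" and ?A = "bergman_space 2 \<Omega>"
  obtain H where H: "H \<in> ?A" and min: "\<And>k. k \<in> ?A \<Longrightarrow>
      (LINT z|?M. (cmod (\<phi> z - H z))\<^sup>2) \<le> (LINT z|?M. (cmod (\<phi> z - k z))\<^sup>2)"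
    using bergman_best_approximation[OF op \<phi>] by blast
  have "(LINT z|?M. (\<phi> z - H z) * cnj (k z)) = 0" if k: "k \<in> ?A" for k
  proof -
    define e where "e z = \<phi> z - H z" for z
    define I where "I = (LINT z|?M. e z * cnj (k z))"
    define K where "K = (LINT z|?M. (cmod (k z))\<^sup>2)"
    define t where "t = 1 / (K + 1)"
    have K0: "K \<ge> 0" by (simp add: K_def)
    have "(\<lambda>z. \<phi> z - 1 * H z) \<in> Lp_space 2 \<Omega>"
      using H by (intro Lp_space_2_diff_scaled \<phi>) (simp add: bergman_space_def)
    then have eL: "e \<in> Lp_space 2 \<Omega>" by (simp add: e_def[abs_def])
    have kL: "k \<in> Lp_space 2 \<Omega>" using k by (simp add: bergman_space_def)
    have "(\<lambda>z. H z - (- (of_real t * I)) * k z) \<in> ?A" by (rule bergman_space_diff_scaled[OF H k])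
    from min[OF this]
    have "(LINT z|?M. (cmod (e z))\<^sup>2) \<le> (LINT z|?M. (cmod (e z - (of_real t * I) * k z))\<^sup>2)"
      by (simp add: e_def algebra_simps)
    also have "\<dots> = (LINT z|?M. (cmod (e z))\<^sup>2) - 2 * Re (cnj (of_real t * I) * I) + (cmod (of_real t * I))\<^sup>2 * K"
      unfolding I_def K_def using eL kL by (intro integrable_square_diff_scaled(2)) (auto simp: Lp_space_2_iff)
    finally have "2 * Re (cnj (of_real t * I) * I) \<le> (cmod (of_real t * I))\<^sup>2 * K" by simp
    moreover have "Re (cnj (of_real t * I) * I) = t * (cmod I)\<^sup>2"
      by (simp add: cmod_power2) (simp add: power2_eq_square algebra_simps)
    moreover have "(cmod (of_real t * I))\<^sup>2 * K = t * (cmod I)\<^sup>2 * (t * K)"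
      by (simp add: norm_mult power2_eq_square)
    ultimately have "t * (cmod I)\<^sup>2 * 2 \<le> t * (cmod I)\<^sup>2 * (t * K)" by simp
    moreover have "t * K \<le> 1" using K0 by (simp add: t_def)
    then have "t * (cmod I)\<^sup>2 * (t * K) \<le> t * (cmod I)\<^sup>2 * 1"
      using K0 by (intro mult_left_mono) (auto simp: t_def)
    ultimately have "t * (cmod I)\<^sup>2 \<le> 0" by simp
    moreover have "t > 0" using K0 by (simp add: t_def)
    ultimately have "(cmod I)\<^sup>2 \<le> 0" by (simp add: mult_le_0_iff)
    then show ?thesis by (simp add: I_def e_def)
  qed
  with H show ?thesis using that by blast
qed

text \<open>The difference of two candidates lies in the Bergman space and is orthogonal to itself, so it
  vanishes almost everywhere, and then everywhere on \<open>\<Omega>\<close> by the pointwise bound.\<close>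

lemma bergman_projection_eqI:
  fixes \<phi> :: "complex^'n \<Rightarrow> complex"
  assumes op: "open \<Omega>" and \<phi>: "\<phi> \<in> Lp_space 2 \<Omega>" and g: "g \<in> bergman_space 2 \<Omega>"
    and orth: "\<And>k. k \<in> bergman_space 2 \<Omega> \<Longrightarrow> (LINT z|lebesgue_on \<Omega>. (\<phi> z - g z) * cnj (k z)) = 0"
  shows "bergman_projection \<Omega> \<phi> = (\<lambda>z. if z \<in> \<Omega> then g z else 0)"
proof -
  let ?M = "lebesgue_on \<Omega>" and ?A = "bergman_space 2 \<Omega>"
  define G where "G z = (if z \<in> \<Omega> then g z else 0)" for z
  have GA: "G \<in> ?A"
  proof -
    have "holomorphic_fun \<Omega> G"
      unfolding holomorphic_fun_def
    proof
      fix z assume z: "z \<in> \<Omega>"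
      then obtain D where D: "(g has_derivative D) (at z)" "\<forall>c v. D (c *s v) = c * D v"
        using g unfolding bergman_space_def holomorphic_fun_def by auto
      have "(G has_derivative D) (at z)"
        by (rule has_derivative_transform_within_open[OF D(1) op z]) (simp add: G_def)
      with D show "\<exists>D. (G has_derivative D) (at z) \<and> (\<forall>c v. D (c *s v) = c * D v)" by blast
    qed
    moreover have "G \<in> Lp_space 2 \<Omega>"
    proof -
      have "g \<in> borel_measurable ?M" "integrable ?M (\<lambda>z. (cmod (g z))\<^sup>2)"
        using g by (auto simp: bergman_space_def Lp_space_2_iff)
      moreover have "g \<in> borel_measurable ?M \<longleftrightarrow> G \<in> borel_measurable ?M"
        by (rule measurable_cong) (simp add: G_def)
      moreover have "integrable ?M (\<lambda>z. (cmod (g z))\<^sup>2) \<longleftrightarrow> integrable ?M (\<lambda>z. (cmod (G z))\<^sup>2)"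
        by (rule Bochner_Integration.integrable_cong) (auto simp: G_def)
      ultimately show ?thesis by (simp add: Lp_space_2_iff)
    qed
    ultimately show ?thesis by (simp add: bergman_space_def)
  qed
  have orthG: "(LINT z|?M. (\<phi> z - G z) * cnj (k z)) = 0" if "k \<in> ?A" for k
  proof -
    have "(LINT z|?M. (\<phi> z - G z) * cnj (k z)) = (LINT z|?M. (\<phi> z - g z) * cnj (k z))"
      by (rule Bochner_Integration.integral_cong) (auto simp: G_def)
    then show ?thesis using orth[OF that] by simp
  qed
  show ?thesis
    unfolding bergman_projection_def G_def[symmetric, abs_def]
  proof (rule the_equality)
    show "G \<in> ?A \<and> (\<forall>z. z \<notin> \<Omega> \<longrightarrow> G z = 0) \<and> (\<forall>h\<in>?A. (LINT z|?M. (\<phi> z - G z) * cnj (h z)) = 0)"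
      using GA orthG by (auto simp: G_def)
  next
    fix F assume F: "F \<in> ?A \<and> (\<forall>z. z \<notin> \<Omega> \<longrightarrow> F z = 0) \<and> (\<forall>h\<in>?A. (LINT z|?M. (\<phi> z - F z) * cnj (h z)) = 0)"
    define k where "k z = F z - 1 * G z" for z
    have kA: "k \<in> ?A" unfolding k_def using F GA by (intro bergman_space_diff_scaled) auto
    have int: "integrable ?M (\<lambda>z. (\<phi> z - f z) * cnj (k z))" if "f \<in> ?A" for f
    proof -
      have "(\<lambda>z. \<phi> z - 1 * f z) \<in> Lp_space 2 \<Omega>"
        using that by (intro Lp_space_2_diff_scaled \<phi>) (simp add: bergman_space_def)
      then show ?thesis
        using kA by (intro integrable_mult_cnj_square) (auto simp: bergman_space_def Lp_space_2_iff)
    qed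
    have "(LINT z|?M. (\<phi> z - G z) * cnj (k z) - (\<phi> z - F z) * cnj (k z)) = 0"
      using F GA kA orthG[OF kA] int[of F] int[of G] by (subst Bochner_Integration.integral_diff) auto
    moreover have "(\<phi> z - G z) * cnj (k z) - (\<phi> z - F z) * cnj (k z) = of_real ((cmod (k z))\<^sup>2)" for z
      unfolding complex_norm_square by (simp add: k_def algebra_simps)
    ultimately have "complex_of_real (LINT z|?M. (cmod (k z))\<^sup>2) = 0"
      by (simp del: of_real_power)
    then have "(LINT z|?M. (cmod (k z))\<^sup>2) = 0" by simp
    moreover have k_hol: "holomorphic_fun \<Omega> k" and k_int: "integrable ?M (\<lambda>z. (cmod (k z))\<^sup>2)"
      using kA by (auto simp: bergman_space_def Lp_space_2_iff)
    ultimately have "(cmod (k z))\<^sup>2 \<le> 0" if "z \<in> \<Omega>" for z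
    proof -
      obtain R where R: "R > 0" "cball z R \<subseteq> \<Omega>" using op \<open>z \<in> \<Omega>\<close> open_contains_cball by blast
      then have "measure lborel (cball z R) > 0" by simp
      moreover have "(cmod (k z))\<^sup>2 * measure lborel (cball z R) \<le> 0"
        using bergman_pointwise_bound[OF op k_hol R(2) k_int] \<open>(LINT z|?M. (cmod (k z))\<^sup>2) = 0\<close> by simp
      ultimately show ?thesis using mult_pos_pos not_le by blast
    qed
    then have "k z = 0" if "z \<in> \<Omega>" for z using that by simp
    then show "F = G" using F by (auto simp: k_def fun_eq_iff G_def)
  qed
qed

section \<open>Cutoff functions and elementary inequalities\<close>

lemma abs_ln_le: "(x::real) > 0 \<Longrightarrow> \<bar>ln x\<bar> \<le> 2 / sqrt x + x"
proof -
  assume x: "x > 0"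
  have "ln x \<le> x" using ln_le_minus_one[OF x] by simp
  moreover have "- ln x \<le> 2 / sqrt x"
  proof -
    have "ln (inverse (sqrt x)) \<le> inverse (sqrt x) - 1" using x by (intro ln_le_minus_one) simp
    then have "- (ln x / 2) \<le> inverse (sqrt x)" using x by (simp add: ln_inverse ln_sqrt)
    moreover have "2 / sqrt x = 2 * inverse (sqrt x)" by (rule divide_inverse)
    ultimately show ?thesis by linarith
  qed
  moreover have "2 / sqrt x \<ge> 0" using x by simp
  ultimately show ?thesis using x by linarith
qed

lemma DERIV_max_0_square: "((\<lambda>x::real. (max 0 x)\<^sup>2) has_real_derivative 2 * max 0 x) (at x)"
proof (cases "x = 0")
  case True
  have "(\<lambda>h::real. ((max 0 (0 + h))\<^sup>2 - (max 0 0)\<^sup>2) / h) \<midarrow>0\<rightarrow> 0"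
  proof (rule Lim_null_comparison)
    show "\<forall>\<^sub>F h in at 0. norm (((max 0 (0 + h))\<^sup>2 - (max 0 0)\<^sup>2) / h) \<le> \<bar>h::real\<bar>"
      by (rule always_eventually) (auto simp: max_def power2_eq_square)
    show "((\<lambda>h::real. \<bar>h\<bar>) \<longlongrightarrow> 0) (at 0)" by (intro tendsto_rabs_zero tendsto_ident_at)
  qed
  then show ?thesis using True by (simp add: DERIV_def)
next
  case False
  show ?thesis
  proof (cases "x > 0")
    case True
    have "((\<lambda>x::real. x\<^sup>2) has_real_derivative 2 * x) (at x)" by (auto intro!: derivative_eq_intros)
    then have "((\<lambda>x::real. (max 0 x)\<^sup>2) has_real_derivative 2 * x) (at x)"
      by (rule has_field_derivative_transform_within_open[of _ _ _ "{0<..}"]) (use True in auto)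
    then show ?thesis using True by simp
  next
    case F: False
    have "((\<lambda>x::real. 0) has_real_derivative 0) (at x)" by simp
    then have "((\<lambda>x::real. (max 0 x)\<^sup>2) has_real_derivative 0) (at x)"
      by (rule has_field_derivative_transform_within_open[of _ _ _ "{..<0}"]) (use F False in auto)
    then show ?thesis using F by simp
  qed
qed

text \<open>For a defining function value \<open>t < 0\<close> the product \<open>t * (cut_ratio \<epsilon> t)\<^sup>2\<close> is a continuously
  differentiable replacement of \<open>t\<close> that vanishes for \<open>t \<ge> - \<epsilon>\<close>. Its derivative
  \<open>2 q - q\<^sup>2\<close>, with \<open>q = cut_ratio \<epsilon> t\<close>, lies between \<open>0\<close> and \<open>1\<close> for every \<open>\<epsilon>\<close> and tends to \<open>1\<close> as \<open>\<epsilon>\<close>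
  tends to \<open>0\<close>, so no boundary term survives in the limit.\<close>

definition cut_ratio :: "real \<Rightarrow> real \<Rightarrow> real" where
  "cut_ratio \<epsilon> t = max 0 (- t - \<epsilon>) / (- t)"

lemma cut_ratio_bounds: "t < 0 \<Longrightarrow> \<epsilon> > 0 \<Longrightarrow> 0 \<le> cut_ratio \<epsilon> t \<and> cut_ratio \<epsilon> t \<le> 1"
  by (auto simp: cut_ratio_def divide_simps max_def)

lemma cut_ratio_zero: "t < 0 \<Longrightarrow> t > - \<epsilon> \<Longrightarrow> cut_ratio \<epsilon> t = 0"
  by (simp add: cut_ratio_def)

lemma DERIV_cut:
  assumes t: "t < 0"
  shows "((\<lambda>t. t * (cut_ratio \<epsilon> t)\<^sup>2) has_real_derivative (2 * cut_ratio \<epsilon> t - (cut_ratio \<epsilon> t)\<^sup>2)) (at t)"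
proof -
  let ?x = "max 0 (- t - \<epsilon>)"
  have "((\<lambda>t. (max 0 (- t - \<epsilon>))\<^sup>2) has_real_derivative 2 * ?x * (- 1)) (at t)"
    by (rule DERIV_chain'[where f="\<lambda>t. - t - \<epsilon>", OF _ DERIV_max_0_square]) (auto intro!: derivative_eq_intros)
  then have "((\<lambda>t. (max 0 (- t - \<epsilon>))\<^sup>2 / t) has_real_derivative
      (2 * ?x * (- 1) * t - ?x\<^sup>2 * 1) / (t * t)) (at t)"
    using t by (intro DERIV_divide) auto
  also have "(2 * ?x * (- 1) * t - ?x\<^sup>2 * 1) / (t * t) = 2 * cut_ratio \<epsilon> t - (cut_ratio \<epsilon> t)\<^sup>2"
    using t by (simp add: cut_ratio_def divide_simps power2_eq_square)
  finally show ?thesis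
    by (rule has_field_derivative_transform_within_open[of _ _ _ "{..<0}"])
       (use t in \<open>auto simp: cut_ratio_def power2_eq_square\<close>)
qed

lemma continuous_cut_ratio: "continuous_on {..<0} (cut_ratio \<epsilon>)"
  unfolding cut_ratio_def[abs_def] by (intro continuous_intros) auto

lemma cut_ratio_tendsto:
  assumes t: "t < 0"
  shows "(\<lambda>n. cut_ratio (inverse (real (Suc n))) t) \<longlonglongrightarrow> 1"
proof -
  have "(\<lambda>n. max 0 (- t - inverse (real (Suc n))) / (- t)) \<longlonglongrightarrow> max 0 (- t - 0) / (- t)"
    using t by (intro tendsto_intros LIMSEQ_inverse_real_of_nat) auto
  then show ?thesis using t by (simp add: cut_ratio_def)
qed

lemma le_powr_plus_1: "0 \<le> t \<Longrightarrow> 1 \<le> p \<Longrightarrow> t \<le> t powr p + (1::real)"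
proof (cases "t \<le> 1")
  case False
  assume "1 \<le> p"
  then have "t powr 1 \<le> t powr p" using False by (intro powr_mono) auto
  then show ?thesis using False by simp
qed (simp add: add_increasing)

lemma powr_le_1_plus: "0 \<le> x \<Longrightarrow> 0 < e \<Longrightarrow> e \<le> 1 \<Longrightarrow> x powr e \<le> 1 + (x::real)"
proof -
  assume *: "0 \<le> x" "0 < e" "e \<le> 1"
  show ?thesis
  proof (cases "x \<le> 1")
    case True
    then have "x powr e \<le> 1 powr e" using * by (intro powr_mono2) auto
    then show ?thesis using * by simp
  next
    case False
    then have "x powr e \<le> x powr 1" using * by (intro powr_mono) auto
    then show ?thesis using * by simp
  qed
qed

section \<open>The logarithmic peak function\<close>

definition hermitian_inner :: "complex^'n \<Rightarrow> complex^'n \<Rightarrow> complex" where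
  "hermitian_inner z a = (\<Sum>i\<in>UNIV. z $ i * cnj (a $ i))"

lemma Re_hermitian_inner: "Re (hermitian_inner z a) = z \<bullet> a"
  by (simp add: hermitian_inner_def inner_vec_def inner_complex_def)

lemma hermitian_inner_add: "hermitian_inner (x + y) a = hermitian_inner x a + hermitian_inner y a"
  by (simp add: hermitian_inner_def algebra_simps sum.distrib)

lemma hermitian_inner_smult: "hermitian_inner (c *s x) a = c * hermitian_inner x a"
  by (simp add: hermitian_inner_def sum_distrib_left mult.assoc)

lemma hermitian_inner_diff: "hermitian_inner (x - y) a = hermitian_inner x a - hermitian_inner y a"
  by (simp add: hermitian_inner_def algebra_simps sum_subtractf)

lemma hermitian_inner_scaleR: "hermitian_inner (t *\<^sub>R x) a = of_real t * hermitian_inner x a"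
  by (simp add: hermitian_inner_def sum_distrib_left scaleR_conv_of_real[symmetric])

lemma hermitian_inner_self: "hermitian_inner a a = of_real ((norm a)\<^sup>2)"
proof (rule complex_eqI)
  show "Re (hermitian_inner a a) = Re (complex_of_real ((norm a)\<^sup>2))"
    by (simp add: Re_hermitian_inner power2_norm_eq_inner)
  show "Im (hermitian_inner a a) = Im (complex_of_real ((norm a)\<^sup>2))"
    by (simp add: hermitian_inner_def)
qed

lemma cmod_hermitian_inner_le: "cmod (hermitian_inner z a) \<le> norm z * norm a"
proof (cases "hermitian_inner z a = 0")
  case False
  define u where "u = cnj (hermitian_inner z a) / of_real (cmod (hermitian_inner z a))"
  have "cmod u = 1" using False by (simp add: u_def norm_divide)
  have "hermitian_inner (u *s z) a = of_real (cmod (hermitian_inner z a))"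
    using False complex_norm_square[of "hermitian_inner z a"]
    by (simp add: hermitian_inner_smult u_def power2_eq_square mult.commute divide_eq_eq)
  then have "cmod (hermitian_inner z a) = (u *s z) \<bullet> a" by (metis Re_complex_of_real Re_hermitian_inner)
  also have "\<dots> \<le> norm (u *s z) * norm a" by (rule norm_cauchy_schwarz)
  finally show ?thesis using \<open>cmod u = 1\<close> by (simp add: norm_smult_vec)
qed simp

lemma bounded_linear_hermitian_inner: "bounded_linear (\<lambda>z. hermitian_inner z a)"
  by (rule bounded_linear_intro[where K="norm a"])
     (auto simp: hermitian_inner_add hermitian_inner_scaleR scaleR_conv_of_real[of _ "hermitian_inner _ _"] cmod_hermitian_inner_le)

text \<open>The geometry used by the analytic part of the proof: \<open>a\<close> is a boundary point of \<open>\<Omega>\<close> at maximal distance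
  from \<open>0\<close>, \<open>r\<close> is a defining function with derivative \<open>R\<close>, and \<open>s0\<close> is the value at \<open>a\<close> of
  \<open>R z a - \<i> * R z (\<i> *s a)\<close>. The quantity \<open>1 - hermitian_inner z a / of_real ((norm a)\<^sup>2)\<close> vanishes at \<open>a\<close> and controls
  \<open>r z\<close>; the last condition lets \<open>\<Omega>\<close> contain balls of radius comparable to their distance from \<open>a\<close>.\<close>

locale peak_point =
  fixes \<Omega> :: "(complex^'n) set" and a :: "complex^'n" and r :: "complex^'n \<Rightarrow> real"
    and R :: "complex^'n \<Rightarrow> complex^'n \<Rightarrow> real" and s0 C \<sigma>0 :: real
  assumes op: "open \<Omega>" and bdd: "bounded \<Omega>"
    and a0: "a \<noteq> 0" and in_ball: "\<And>z. z \<in> \<Omega> \<Longrightarrow> norm z < norm a"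
    and r_neg: "\<And>z. z \<in> \<Omega> \<Longrightarrow> r z < 0"
    and r_der: "\<And>z. z \<in> \<Omega> \<Longrightarrow> (r has_derivative R z) (at z)"
    and R_cont: "\<And>v. continuous_on \<Omega> (\<lambda>z. R z v)"
    and sub_compact: "\<And>\<epsilon>. \<epsilon> > 0 \<Longrightarrow> compact {z \<in> \<Omega>. r z \<le> - \<epsilon>}"
    and s0: "s0 > 0"
    and r_bd: "\<And>z. z \<in> \<Omega> \<Longrightarrow> \<bar>r z\<bar> \<le> C * cmod (1 - hermitian_inner z a / of_real ((norm a)\<^sup>2))"
    and s_bd: "\<And>z. z \<in> \<Omega> \<Longrightarrow> cmod (Complex (R z a) (- R z (\<i> *s a)) - of_real s0) \<le> C * norm (z - a)"
    and \<sigma>0: "\<sigma>0 > 0" and inner_balls: "\<And>\<sigma>. 0 < \<sigma> \<Longrightarrow> \<sigma> < \<sigma>0 \<Longrightarrow> ball (a - \<sigma> *\<^sub>R a) (\<sigma> * norm a / 2) \<subseteq> \<Omega>"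
begin

definition "w z = 1 - hermitian_inner z a / of_real ((norm a)\<^sup>2)"
definition "g z = Ln (w z)"

text \<open>Twice the Wirtinger derivative of \<open>r\<close> in direction \<open>a\<close>.\<close>

definition "s z = Complex (R z a) (- R z (\<i> *s a))"

text \<open>This is \<open>g - L (r g) / s0\<close> for the operator \<open>L F = DF(a) - \<i> DF(\<i> a)\<close>, because \<open>L g = - 2 / w\<close>.\<close>

definition "f z = g z * (1 - s z / of_real s0) + of_real (2 / s0) * of_real (r z) / w z"

lemma norm_a: "norm a > 0" using a0 by simp

lemma Re_w: "Re (w z) = 1 - z \<bullet> a / (norm a)\<^sup>2"
  by (simp add: w_def Re_hermitian_inner del: of_real_power)

lemma Re_w_pos: "z \<in> \<Omega> \<Longrightarrow> Re (w z) > 0"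
proof -
  assume "z \<in> \<Omega>"
  then have "z \<bullet> a < norm a * norm a"
    using norm_cauchy_schwarz[of z a] mult_strict_right_mono[OF in_ball norm_a] by fastforce
  then show ?thesis using norm_a by (simp add: Re_w power2_eq_square)
qed

lemma w_nz: "z \<in> \<Omega> \<Longrightarrow> w z \<noteq> 0"
  using Re_w_pos[of z] by auto

lemma w_notin: "z \<in> \<Omega> \<Longrightarrow> w z \<notin> \<real>\<^sub>\<le>\<^sub>0"
  using Re_w_pos[of z] by (auto simp: complex_nonpos_Reals_iff)

lemma cmod_w_le_2: "z \<in> \<Omega> \<Longrightarrow> cmod (w z) \<le> 2"
proof -
  assume z: "z \<in> \<Omega>"
  have "cmod (hermitian_inner z a) \<le> norm a * norm a"
    by (rule order_trans[OF cmod_hermitian_inner_le mult_right_mono[OF less_imp_le[OF in_ball[OF z]]]]) simp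
  then have "cmod (hermitian_inner z a / of_real ((norm a)\<^sup>2)) \<le> 1"
    using norm_a by (simp add: norm_divide norm_mult power2_eq_square)
  then show ?thesis unfolding w_def
    using norm_triangle_ineq4[of 1 "hermitian_inner z a / of_real ((norm a)\<^sup>2)"] by simp
qed

text \<open>Inside the ball of radius \<open>norm a\<close> the distance to \<open>a\<close> is at most of order \<open>sqrt (cmod (w z))\<close>, as
  \<open>|z - a|\<^sup>2 \<le> 2 (|a|\<^sup>2 - z \<bullet> a)\<close>.\<close>

lemma norm_diff_a_le: "z \<in> \<Omega> \<Longrightarrow> norm (z - a) \<le> sqrt 2 * norm a * sqrt (cmod (w z))"
proof -
  assume z: "z \<in> \<Omega>"
  have "(norm (z - a))\<^sup>2 = (norm z)\<^sup>2 + (norm a)\<^sup>2 - 2 * (z \<bullet> a)"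
    by (simp add: power2_norm_eq_inner inner_diff inner_commute)
  also have "\<dots> \<le> 2 * (norm a)\<^sup>2 - 2 * (z \<bullet> a)"
    using power_mono[OF less_imp_le[OF in_ball[OF z]] norm_ge_zero, of 2] by simp
  also have "\<dots> = 2 * (norm a)\<^sup>2 * Re (w z)"
    using norm_a by (simp add: Re_w algebra_simps)
  also have "\<dots> \<le> 2 * (norm a)\<^sup>2 * cmod (w z)"
    by (intro mult_left_mono complex_Re_le_cmod) auto
  finally have "sqrt ((norm (z - a))\<^sup>2) \<le> sqrt (2 * (norm a)\<^sup>2 * cmod (w z))" by (rule real_sqrt_le_mono)
  then show ?thesis by (simp add: real_sqrt_mult)
qed

lemma w_der: "(w has_derivative (\<lambda>v. - hermitian_inner v a / of_real ((norm a)\<^sup>2))) (at z)"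
proof -
  have "((\<lambda>z. hermitian_inner z a / of_real ((norm a)\<^sup>2)) has_derivative (\<lambda>v. hermitian_inner v a / of_real ((norm a)\<^sup>2))) (at z)"
    by (intro bounded_linear_imp_has_derivative bounded_linear_compose[OF bounded_linear_divide bounded_linear_hermitian_inner])
  from has_derivative_diff[OF has_derivative_const[of 1] this] show ?thesis
    by (simp add: w_def[abs_def])
qed

definition "Dg z v = - hermitian_inner v a / of_real ((norm a)\<^sup>2) / w z"

lemma g_der: "z \<in> \<Omega> \<Longrightarrow> (g has_derivative Dg z) (at z)"
proof -
  assume z: "z \<in> \<Omega>"
  have "(Ln has_derivative (\<lambda>x. inverse (w z) * x)) (at (w z))"
    using has_field_derivative_Ln[OF w_notin[OF z]] by (simp add: has_field_derivative_def)
  from has_derivative_compose[OF w_der this] show ?thesis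
    by (simp add: g_def[abs_def] Dg_def[abs_def] field_simps)
qed

lemma Dg_smult: "Dg z (c *s v) = c * Dg z v"
  by (simp add: Dg_def hermitian_inner_smult)

lemma Dg_a: "Dg z a = - 1 / w z"
  using norm_a by (simp add: Dg_def hermitian_inner_self)

lemma g_hol: "holomorphic_fun \<Omega> g"
  unfolding holomorphic_fun_def using g_der Dg_smult by blast

lemma cont_w: "continuous_on A w"
  using w_der by (meson continuous_at_imp_continuous_on has_derivative_continuous)

lemma cont_g: "continuous_on \<Omega> g"
  by (rule holomorphic_fun_continuous_on[OF g_hol])

lemma cont_r: "continuous_on \<Omega> r"
  using r_der by (meson continuous_at_imp_continuous_on has_derivative_continuous)

lemma cont_s: "continuous_on \<Omega> s"
  unfolding s_def[abs_def] Complex_eq by (intro continuous_intros R_cont)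

lemma cont_f: "continuous_on \<Omega> f"
  unfolding f_def[abs_def]
  by (intro continuous_intros cont_g cont_s cont_r cont_w) (use s0 w_nz in auto)

lemma meas [measurable]: "g \<in> borel_measurable (lebesgue_on \<Omega>)" "f \<in> borel_measurable (lebesgue_on \<Omega>)"
  by (intro borel_measurable_lebesgue_on_continuous op cont_f cont_g)+

lemma cmod_g_le: "z \<in> \<Omega> \<Longrightarrow> cmod (g z) \<le> \<bar>ln (cmod (w z))\<bar> + pi"
proof -
  assume z: "z \<in> \<Omega>"
  have "cmod (g z) \<le> \<bar>Re (g z)\<bar> + \<bar>Im (g z)\<bar>" by (rule cmod_le)
  moreover have "\<bar>Im (g z)\<bar> \<le> pi"
    using mpi_less_Im_Ln[OF w_nz[OF z]] Im_Ln_le_pi[OF w_nz[OF z]] by (simp add: g_def)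
  ultimately show ?thesis using w_nz[OF z] by (simp add: g_def)
qed

text \<open>The first summand of \<open>f\<close> is at most of order \<open>|ln |w|| * |z - a|\<close>, hence of order \<open>|ln |w|| * |w|\<^sup>1\<^sup>/\<^sup>2\<close>,
  and the second is of order \<open>|r| / |w|\<close>, which \<open>r_bd\<close> controls.\<close>

lemma f_bounded: "\<exists>M>0. \<forall>z\<in>\<Omega>. cmod (f z) \<le> M"
proof -
  define M where "M = (2 + (2 + pi) * sqrt 2) * (\<bar>C\<bar> * (sqrt 2 * norm a)) / s0 + 2 / s0 * \<bar>C\<bar>"
  have "cmod (f z) \<le> M" if z: "z \<in> \<Omega>" for z
  proof -
    let ?x = "cmod (w z)"
    have x: "?x > 0" using w_nz[OF z] by simp
    have x2: "sqrt ?x \<le> sqrt 2" using cmod_w_le_2[OF z] by simp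
    have gb: "cmod (g z) * sqrt ?x \<le> 2 + (2 + pi) * sqrt 2"
    proof -
      have "cmod (g z) * sqrt ?x \<le> (2 / sqrt ?x + 2 + pi) * sqrt ?x"
        using cmod_g_le[OF z] abs_ln_le[OF x] cmod_w_le_2[OF z] by (intro mult_right_mono) auto
      also have "\<dots> = 2 + (2 + pi) * sqrt ?x" using x by (simp add: algebra_simps)
      also have "\<dots> \<le> 2 + (2 + pi) * sqrt 2" using x2 pi_gt_zero by (intro add_left_mono mult_left_mono) auto
      finally show ?thesis .
    qed
    have "1 - s z / of_real s0 = - (s z - of_real s0) / of_real s0" using s0 by (simp add: field_simps)
    then have "cmod (1 - s z / of_real s0) = cmod (s z - of_real s0) / s0"
      using s0 by (simp add: norm_divide norm_minus_commute)
    also have "\<dots> \<le> \<bar>C\<bar> * (sqrt 2 * norm a * sqrt ?x) / s0"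
    proof -
      have "cmod (s z - of_real s0) \<le> C * norm (z - a)" using s_bd[OF z] by (simp add: s_def)
      also have "\<dots> \<le> \<bar>C\<bar> * (sqrt 2 * norm a * sqrt ?x)"
        using norm_diff_a_le[OF z] by (intro mult_mono) auto
      finally show ?thesis using s0 by (simp add: divide_right_mono)
    qed
    finally have "cmod (g z * (1 - s z / of_real s0)) \<le> cmod (g z) * (\<bar>C\<bar> * (sqrt 2 * norm a * sqrt ?x) / s0)"
      unfolding norm_mult by (rule mult_left_mono) simp
    also have "\<dots> = (cmod (g z) * sqrt ?x) * (\<bar>C\<bar> * (sqrt 2 * norm a) / s0)" by simp
    also have "\<dots> \<le> (2 + (2 + pi) * sqrt 2) * (\<bar>C\<bar> * (sqrt 2 * norm a) / s0)"
      using gb s0 by (intro mult_right_mono) auto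
    finally have 1: "cmod (g z * (1 - s z / of_real s0)) \<le> (2 + (2 + pi) * sqrt 2) * (\<bar>C\<bar> * (sqrt 2 * norm a)) / s0"
      by simp
    have "\<bar>r z\<bar> \<le> \<bar>C\<bar> * ?x"
      using r_bd[OF z] mult_right_mono[OF abs_ge_self[of C], of ?x] by (simp add: w_def)
    then have "\<bar>r z\<bar> / ?x \<le> \<bar>C\<bar>" using x by (simp add: divide_le_eq)
    then have "2 / s0 * (\<bar>r z\<bar> / ?x) \<le> 2 / s0 * \<bar>C\<bar>" using s0 by (intro mult_left_mono) auto
    then have 2: "cmod (of_real (2 / s0) * of_real (r z) / w z) \<le> 2 / s0 * \<bar>C\<bar>"
      using s0 by (simp add: norm_divide norm_mult)
    show ?thesis unfolding f_def M_def
      using norm_triangle_ineq[of "g z * (1 - s z / of_real s0)" "of_real (2 / s0) * of_real (r z) / w z"] 1 2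
      by linarith
  qed
  then have "cmod (f z) \<le> \<bar>M\<bar> + 1" if "z \<in> \<Omega>" for z
    using that by (meson abs_ge_self add_increasing2 order_trans zero_le_one)
  moreover have "\<bar>M\<bar> + 1 > 0" by simp
  ultimately show ?thesis by blast
qed

text \<open>Where \<open>cmod (w z) \<le> 1\<close>, the value \<open>cmod (g z)\<close> exceeds \<open>- ln (cmod (w z))\<close> by at most \<open>pi\<close>. The constant
  \<open>5\<close> also covers \<open>1 \<le> cmod (w z) \<le> 2\<close>, where \<open>pi + 2 * ln 2 < 5\<close>.\<close>

lemma cmod_w_le_exp: "z \<in> \<Omega> \<Longrightarrow> cmod (w z) \<le> exp (5 - cmod (g z))"
proof -
  assume z: "z \<in> \<Omega>"
  have x: "cmod (w z) > 0" using w_nz[OF z] by simp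
  have "ln (cmod (w z)) \<le> ln 2" using cmod_w_le_2[OF z] x by simp
  also have "ln 2 < (0.7::real)" using ln2_le_25_over_36 by simp
  finally have "ln (cmod (w z)) \<le> 0.7" by simp
  moreover have "pi \<le> 3.2" using pi_approx(2) by simp
  ultimately have "ln (cmod (w z)) \<le> 5 - cmod (g z)"
    using cmod_g_le[OF z] by linarith
  then have "exp (ln (cmod (w z))) \<le> exp (5 - cmod (g z))" by (rule exp_le_cancel_iff[THEN iffD2])
  then show ?thesis unfolding exp_ln[OF x] .
qed

lemma finite_measure_\<Omega>: "emeasure (lebesgue_on \<Omega>) (space (lebesgue_on \<Omega>)) < \<infinity>"
proof -
  have "\<Omega> \<in> lmeasurable" using bdd op by (simp add: lmeasurable_open)
  then interpret finite_measure "lebesgue_on \<Omega>" by (rule finite_measure_lebesgue_on)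
  show ?thesis using emeasure_finite[of "space (lebesgue_on \<Omega>)"] by (simp add: less_top[symmetric])
qed

text \<open>The set where \<open>cmod (g z) \<ge> k\<close> lies in a ball about \<open>a\<close> of radius of order \<open>exp (- k / 2)\<close>, so its measure
  decays exponentially in \<open>k\<close>, and the sum of \<open>(k + 1)\<^sup>q\<close> against these measures converges.\<close>

lemma g_powr_integrable:
  assumes q: "q > 0"
  shows "integrable (lebesgue_on \<Omega>) (\<lambda>z. cmod (g z) powr q)"
proof (rule integrableI_bounded)
  let ?M = "lebesgue_on \<Omega>" and ?N = "DIM(complex^'n)"
  define A where "A k = {z \<in> \<Omega>. real k \<le> cmod (g z)}" for k
  \<comment> \<open>the volume of the ball that contains \<open>A 0\<close> by \<open>cmod_w_le_exp\<close>\<close>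
  define c where "c = unit_ball_vol ?N * (sqrt 2 * norm a * exp (5/2)) ^ ?N"
  have c: "c \<ge> 0"
    unfolding c_def using norm_a by (intro mult_nonneg_nonneg unit_ball_vol_nonneg zero_le_power) auto
  have [measurable]: "A k \<in> sets ?M" for k
  proof -
    have "{z \<in> space ?M. real k \<le> cmod (g z)} \<in> sets ?M" by measurable
    then show ?thesis by (simp add: A_def)
  qed
  have emeas: "emeasure ?M (A k) \<le> ennreal (c * exp (- real k / 2))" for k
  proof -
    let ?\<rho> = "sqrt 2 * norm a * exp (5/2) * exp (- real k / 2)"
    have sub: "A k \<subseteq> cball a ?\<rho>"
    proof
      fix z assume z: "z \<in> A k"
      then have "sqrt (cmod (w z)) \<le> sqrt (exp (5 - real k))"
        using cmod_w_le_exp[of z] by (auto simp: A_def intro: order_trans)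
      also have "\<dots> = exp (5/2) * exp (- real k / 2)"
        by (rule real_sqrt_unique) (auto simp: power2_eq_square exp_add[symmetric])
      finally have "sqrt 2 * norm a * sqrt (cmod (w z)) \<le> sqrt 2 * norm a * (exp (5/2) * exp (- real k / 2))"
        by (intro mult_left_mono) auto
      moreover have "norm (z - a) \<le> sqrt 2 * norm a * sqrt (cmod (w z))"
        using norm_diff_a_le z by (simp add: A_def)
      ultimately have "norm (z - a) \<le> ?\<rho>" by (simp only: mult.assoc)
      then show "z \<in> cball a ?\<rho>"
        by (simp only: mem_cball dist_norm norm_minus_commute)
    qed
    have "emeasure ?M (A k) = emeasure lebesgue (A k)"
      using op by (subst emeasure_restrict_space) (auto simp: A_def)
    also have "\<dots> \<le> emeasure lebesgue (cball a ?\<rho>)" using sub by (intro emeasure_mono) auto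
    also have "\<dots> = emeasure lborel (cball a ?\<rho>)" by simp
    also have "\<dots> = ennreal (unit_ball_vol ?N * ?\<rho> ^ ?N)"
      using norm_a by (intro emeasure_cball) simp
    also have "\<dots> \<le> ennreal (c * exp (- real k / 2))"
    proof (rule ennreal_leI)
      have "unit_ball_vol ?N * ?\<rho> ^ ?N = c * exp (- real k / 2) ^ ?N" by (simp add: c_def power_mult_distrib)
      also have "\<dots> \<le> c * exp (- real k / 2) ^ 1"
        using c DIM_positive[where 'a="complex^'n"]
        by (intro mult_left_mono power_decreasing) auto
      finally show "unit_ball_vol ?N * ?\<rho> ^ ?N \<le> c * exp (- real k / 2)" by simp
    qed
    finally show ?thesis .
  qed
  have "(\<integral>\<^sup>+z. ennreal (norm (cmod (g z) powr q)) \<partial>?M)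
      \<le> (\<integral>\<^sup>+z. (\<Sum>k. ennreal ((real k + 1) powr q) * indicator (A k) z) \<partial>?M)"
  proof (rule nn_integral_mono)
    fix z assume "z \<in> space ?M"
    then have z: "z \<in> \<Omega>" by simp
    define k where "k = nat \<lfloor>cmod (g z)\<rfloor>"
    have k: "real k \<le> cmod (g z)" "cmod (g z) \<le> real k + 1" 
    proof -
      have "real k = of_int \<lfloor>cmod (g z)\<rfloor>" by (simp add: k_def)
      then show "real k \<le> cmod (g z)" "cmod (g z) \<le> real k + 1" by linarith+
    qed
    have "ennreal (norm (cmod (g z) powr q)) \<le> ennreal ((real k + 1) powr q) * indicator (A k) z"
      using k z q by (auto simp: A_def intro!: ennreal_leI powr_mono2)
    also have "\<dots> \<le> (\<Sum>k. ennreal ((real k + 1) powr q) * indicator (A k) z)"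
    proof -
      define F where "F k = ennreal ((real k + 1) powr q) * indicator (A k) z" for k
      have "F k \<le> suminf F" using sum_le_suminf[of F "{k}"] by simp
      then show ?thesis unfolding F_def .
    qed
    finally show "ennreal (norm (cmod (g z) powr q)) \<le> (\<Sum>k. ennreal ((real k + 1) powr q) * indicator (A k) z)" .
  qed
  also have "\<dots> = (\<Sum>k. \<integral>\<^sup>+z. ennreal ((real k + 1) powr q) * indicator (A k) z \<partial>?M)"
    by (rule nn_integral_suminf) measurable
  also have "\<dots> = (\<Sum>k. ennreal ((real k + 1) powr q) * emeasure ?M (A k))"
    by (simp add: nn_integral_cmult_indicator)
  also have "\<dots> \<le> (\<Sum>k. ennreal ((real k + 1) powr q * (c * exp (- real k / 2))))"
  proof (rule suminf_le)
    fix k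
    show "ennreal ((real k + 1) powr q) * emeasure ?M (A k) \<le> ennreal ((real k + 1) powr q * (c * exp (- real k / 2)))"
      using mult_left_mono[OF emeas[of k], of "ennreal ((real k + 1) powr q)"] c by (simp add: ennreal_mult')
  qed auto
  also have "\<dots> < \<infinity>"
  proof -
    have "(\<lambda>k. (real k + 1) powr q * exp (- real k / 2)) \<in> O(\<lambda>k. exp (- real k / 4))"
      using q by real_asymp
    moreover have "summable (\<lambda>k. norm (exp (- real k / 4)))"
    proof -
      have "norm (exp (- real k / 4)) = exp (- (1/4)) ^ k" for k
        by (simp add: exp_of_nat_mult[symmetric])
      then show ?thesis by (simp add: summable_geometric)
    qed
    ultimately have "summable (\<lambda>k. c * ((real k + 1) powr q * exp (- real k / 2)))"
      by (intro summable_mult) (rule summable_comparison_test_bigo)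
    then have "summable (\<lambda>k. (real k + 1) powr q * (c * exp (- real k / 2)))"
      by (simp add: mult_ac)
    then show ?thesis using c by (subst suminf_ennreal2) auto
  qed
  finally show "(\<integral>\<^sup>+z. ennreal (norm (cmod (g z) powr q)) \<partial>?M) < \<infinity>" .
qed measurable

lemma g_bergman: "g \<in> bergman_space 2 \<Omega>"
  using g_powr_integrable[of 2] g_hol by (simp add: bergman_space_def Lp_space_def)

text \<open>On the ball \<open>B\<close> with parameter \<open>\<sigma> = exp (- q) / 2\<close> one has \<open>cmod (w z) \<le> exp (- q)\<close>, hence \<open>cmod (g z) \<ge> q\<close>. The
  measure of \<open>B\<close> is a constant times \<open>exp (- q)\<close> to the power of the real dimension, and its \<open>q\<close>-th
  root is bounded below.\<close>

lemma g_norm_lower_bound: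
  obtains p0 \<kappa> where "p0 > 2" "\<kappa> > 0"
    "\<And>q. q > p0 \<Longrightarrow> \<kappa> * q \<le> (LINT z|lebesgue_on \<Omega>. cmod (g z) powr q) powr (1 / q)"
proof -
  let ?N = "DIM(complex^'n)"
  define c where "c = unit_ball_vol ?N * (norm a / 4) ^ ?N"
  have c: "c > 0"
    unfolding c_def using norm_a by (intro mult_pos_pos unit_ball_vol_pos zero_less_power) auto
  define p0 where "p0 = max 3 (- ln (2 * \<sigma>0))"
  define \<kappa> where "\<kappa> = exp (- real ?N) * min 1 c"
  show ?thesis
  proof
    show "p0 > 2" by (simp add: p0_def)
    show "\<kappa> > 0" using c by (simp add: \<kappa>_def)
    fix q assume q: "q > p0"
    then have q3: "q > 3" by (simp add: p0_def)
    \<comment> \<open>points of the ball satisfy \<open>cmod (w z) \<le> \<sigma> + \<sigma> / 2\<close>\<close>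
    define \<sigma> where "\<sigma> = exp (- q) / 2"
    have "- q < ln (2 * \<sigma>0)" using q by (simp add: p0_def)
    then have "exp (- q) < 2 * \<sigma>0" using \<sigma>0 by (metis exp_less_mono exp_ln mult_pos_pos zero_less_numeral)
    then have \<sigma>: "0 < \<sigma>" "\<sigma> < \<sigma>0" by (auto simp: \<sigma>_def)
    let ?B = "ball (a - \<sigma> *\<^sub>R a) (\<sigma> * norm a / 2)"
    have B\<Omega>: "?B \<subseteq> \<Omega>" using inner_balls[OF \<sigma>] .
    have g_ge: "q \<le> cmod (g z)" if z: "z \<in> ?B" for z
    proof -
      have z\<Omega>: "z \<in> \<Omega>" using z B\<Omega> by blast
      define y where "y = z - (a - \<sigma> *\<^sub>R a)"
      have y: "norm y \<le> \<sigma> * norm a / 2" using z by (simp add: y_def dist_norm norm_minus_commute)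
      have "w z = of_real \<sigma> - hermitian_inner y a / of_real ((norm a)\<^sup>2)"
      proof -
        have "hermitian_inner y a = hermitian_inner z a - (hermitian_inner a a - of_real \<sigma> * hermitian_inner a a)"
          by (simp only: y_def hermitian_inner_diff hermitian_inner_scaleR)
        then show ?thesis using norm_a by (simp add: w_def hermitian_inner_self field_simps del: of_real_power)
      qed
      then have "cmod (w z) \<le> \<sigma> + cmod (hermitian_inner y a) / (norm a)\<^sup>2"
        using norm_triangle_ineq4[of "of_real \<sigma>" "hermitian_inner y a / of_real ((norm a)\<^sup>2)"] \<sigma>
        by (simp add: norm_divide norm_power)
      also have "cmod (hermitian_inner y a) / (norm a)\<^sup>2 \<le> (\<sigma> * norm a / 2 * norm a) / (norm a)\<^sup>2"
        using cmod_hermitian_inner_le[of y a] mult_right_mono[OF y, of "norm a"] by (intro divide_right_mono) auto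
      also have "\<dots> = \<sigma> / 2" using norm_a by (simp add: power2_eq_square)
      finally have "cmod (w z) \<le> exp (- q)" unfolding \<sigma>_def using exp_gt_zero[of "- q"] by linarith
      then have "ln (cmod (w z)) \<le> - q"
        using w_nz[OF z\<Omega>] by (metis exp_ln exp_le_cancel_iff zero_less_norm_iff)
      moreover have "\<bar>Re (g z)\<bar> \<le> cmod (g z)" by (rule abs_Re_le_cmod)
      ultimately show ?thesis using w_nz[OF z\<Omega>] by (simp add: g_def)
    qed
    have "c * exp (- q) ^ ?N * q powr q \<le> (LINT z|lebesgue_on \<Omega>. cmod (g z) powr q)"
    proof -
      have mB: "measure (lebesgue_on \<Omega>) ?B = c * exp (- q) ^ ?N"
      proof -
        have "measure (lebesgue_on \<Omega>) ?B = measure lebesgue ?B"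
          using op B\<Omega> by (subst measure_restrict_space) auto
        also have "\<dots> = unit_ball_vol ?N * (\<sigma> * norm a / 2) ^ ?N"
          using \<sigma> norm_a by (subst content_ball[symmetric]) auto
        also have "\<dots> = c * exp (- q) ^ ?N"
        proof -
          have "\<sigma> * norm a / 2 = norm a / 4 * exp (- q)" by (simp add: \<sigma>_def)
          then show ?thesis by (simp only: c_def power_mult_distrib mult.assoc)
        qed
        finally show ?thesis .
      qed
      have fin: "emeasure (lebesgue_on \<Omega>) ?B < \<infinity>"
        using finite_measure_\<Omega> emeasure_space[of "lebesgue_on \<Omega>" ?B] by (auto simp: le_less_trans)
      have Bs: "?B \<in> sets (lebesgue_on \<Omega>)" using op B\<Omega> by (auto simp: sets_restrict_space_iff)
      have "c * exp (- q) ^ ?N * q powr q = (LINT z|lebesgue_on \<Omega>. q powr q * indicator ?B z)"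
        using mB Bs fin by (simp add: mult.commute Int_absorb2[OF B\<Omega>])
      also have "\<dots> \<le> (LINT z|lebesgue_on \<Omega>. cmod (g z) powr q)"
      proof (rule integral_mono)
        show "integrable (lebesgue_on \<Omega>) (\<lambda>z. q powr q * indicator ?B z)"
          using Bs fin by (intro integrable_mult_right integrable_real_indicator)
        show "integrable (lebesgue_on \<Omega>) (\<lambda>z. cmod (g z) powr q)" using q3 by (intro g_powr_integrable) simp
        show "q powr q * indicator ?B z \<le> cmod (g z) powr q" for z
          using g_ge[of z] q3 by (auto simp: indicator_def intro!: powr_mono2)
      qed
      finally show ?thesis .
    qed
    then have "(c * exp (- q) ^ ?N * q powr q) powr (1 / q) \<le> (LINT z|lebesgue_on \<Omega>. cmod (g z) powr q) powr (1 / q)"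
      using c q3 by (intro powr_mono2) auto
    moreover have "(c * exp (- q) ^ ?N * q powr q) powr (1 / q) = c powr (1 / q) * exp (- real ?N) * q"
    proof -
      have "exp (- q) ^ ?N = exp (- real ?N * q)" by (simp add: exp_of_nat_mult[symmetric])
      moreover have "exp (- real ?N * q) powr (1 / q) = exp (- real ?N)"
        using q3 by (simp add: powr_def)
      ultimately show ?thesis using c q3 by (simp add: powr_mult powr_powr)
    qed
    moreover have "min 1 c \<le> c powr (1 / q)"
    proof (cases "c \<ge> 1")
      case True
      then have "1 \<le> c powr (1 / q)" using q3 by (intro ge_one_powr_ge_zero) auto
      then show ?thesis by simp
    next
      case False
      then have "c powr 1 \<le> c powr (1 / q)" using c q3 by (intro powr_mono') auto
      then show ?thesis using c by simp
    qed
    then have "\<kappa> * q \<le> c powr (1 / q) * exp (- real ?N) * q"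
      using q3 unfolding \<kappa>_def by (intro mult_right_mono) (auto simp: mult.commute)
    ultimately show "\<kappa> * q \<le> (LINT z|lebesgue_on \<Omega>. cmod (g z) powr q) powr (1 / q)" by linarith
  qed
qed

section \<open>The peak function as the projection of a bounded function\<close>

lemma bergman_mult_integrable:
  assumes k: "k \<in> bergman_space 2 \<Omega>"
  shows "integrable (lebesgue_on \<Omega>) (\<lambda>z. (A * cmod (g z) + B) * cmod (k z))"
proof -
  have kL: "k \<in> borel_measurable (lebesgue_on \<Omega>)" "integrable (lebesgue_on \<Omega>) (\<lambda>z. (cmod (k z))\<^sup>2)"
    and gL: "integrable (lebesgue_on \<Omega>) (\<lambda>z. (cmod (g z))\<^sup>2)"
    using k g_bergman by (auto simp: bergman_space_def Lp_space_2_iff)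
  note [measurable] = kL(1)
  have 1: "integrable (lebesgue_on \<Omega>) (\<lambda>z. cmod (g z) * cmod (k z))"
    using integrable_norm[OF integrable_mult_cnj_square[OF meas(1) kL(1) gL kL(2)]] by (simp add: norm_mult)
  have one: "integrable (lebesgue_on \<Omega>) (\<lambda>z. 1 :: real)"
    using finite_measure_\<Omega> by (simp add: integrable_iff_bounded)
  have 2: "integrable (lebesgue_on \<Omega>) (\<lambda>z. cmod (k z))"
  proof (rule Bochner_Integration.integrable_bound)
    show "integrable (lebesgue_on \<Omega>) (\<lambda>z. 1 + (cmod (k z))\<^sup>2)"
      by (rule Bochner_Integration.integrable_add[OF one kL(2)])
    have "cmod (k z) \<le> 1 + (cmod (k z))\<^sup>2" for z
      using mult_le_sum_squares[of 1 "cmod (k z)"] by simp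
    then show "AE z in lebesgue_on \<Omega>. norm (cmod (k z)) \<le> norm (1 + (cmod (k z))\<^sup>2)"
      by (intro AE_I2) simp
  qed measurable
  have "integrable (lebesgue_on \<Omega>) (\<lambda>z. A * (cmod (g z) * cmod (k z)) + B * cmod (k z))"
    using 1 2 by (intro Bochner_Integration.integrable_add integrable_mult_right)
  then show ?thesis by (simp only: distrib_right mult.assoc)
qed

lemma s_bounded: "z \<in> \<Omega> \<Longrightarrow> cmod (s z) \<le> s0 + \<bar>C\<bar> * (2 * norm a)"
proof -
  assume z: "z \<in> \<Omega>"
  have "cmod (s z - of_real s0) \<le> C * norm (z - a)" using s_bd[OF z] by (simp add: s_def)
  also have "\<dots> \<le> \<bar>C\<bar> * (2 * norm a)"
    using norm_triangle_ineq4[of z a] in_ball[OF z] by (intro mult_mono) auto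
  finally show ?thesis
    using norm_triangle_sub[of "s z" "of_real s0"] s0 by simp
qed

lemma r_div_w_bounded: "z \<in> \<Omega> \<Longrightarrow> \<bar>r z\<bar> / cmod (w z) \<le> \<bar>C\<bar>"
proof -
  assume z: "z \<in> \<Omega>"
  have "\<bar>r z\<bar> \<le> C * cmod (w z)" using r_bd[OF z] by (simp add: w_def)
  also have "\<dots> \<le> \<bar>C\<bar> * cmod (w z)" by (intro mult_right_mono) auto
  finally show ?thesis using w_nz[OF z] by (simp add: divide_le_eq)
qed

text \<open>Integration by parts for \<open>u = t * (cut_ratio \<epsilon> t)\<^sup>2 * g\<close> with \<open>t = r z\<close>, which is supported in the compact
  set \<open>r \<le> - \<epsilon>\<close>.\<close>

lemma wirtinger_cut_orthogonal:
  assumes k: "holomorphic_fun \<Omega> k" and \<epsilon>: "\<epsilon> > 0"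
  shows "(LINT z|lebesgue_on \<Omega>. (of_real (2 * cut_ratio \<epsilon> (r z) - (cut_ratio \<epsilon> (r z))\<^sup>2) * (s z * g z)
      - 2 * of_real (r z * (cut_ratio \<epsilon> (r z))\<^sup>2) / w z) * cnj (k z)) = 0"
proof -
  let ?q = "\<lambda>z. cut_ratio \<epsilon> (r z)"
  define K where "K = {z \<in> \<Omega>. r z \<le> - \<epsilon>}"
  have K: "compact K" "K \<subseteq> \<Omega>" using sub_compact[OF \<epsilon>] by (auto simp: K_def)
  define u where "u z = of_real (r z * (?q z)\<^sup>2) * g z" for z
  define U where "U z v = of_real (r z * (?q z)\<^sup>2) * Dg z v + of_real ((2 * ?q z - (?q z)\<^sup>2) * R z v) * g z" for z v
  have der: "(u has_derivative U z) (at z)" if z: "z \<in> \<Omega>" for z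
  proof -
    have "((\<lambda>t. t * (cut_ratio \<epsilon> t)\<^sup>2) has_derivative (\<lambda>h. (2 * ?q z - (?q z)\<^sup>2) * h)) (at (r z))"
      using DERIV_cut[OF r_neg[OF z]] by (simp add: has_field_derivative_def)
    from has_derivative_compose[OF r_der[OF z] this]
    have "((\<lambda>z. r z * (?q z)\<^sup>2) has_derivative (\<lambda>v. (2 * ?q z - (?q z)\<^sup>2) * R z v)) (at z)" .
    then have "((\<lambda>z. complex_of_real (r z * (?q z)\<^sup>2)) has_derivative
        (\<lambda>v. of_real ((2 * ?q z - (?q z)\<^sup>2) * R z v))) (at z)"
      by (rule has_derivative_of_real)
    from has_derivative_mult[OF this g_der[OF z]] show ?thesis
      by (simp add: u_def[abs_def] U_def[abs_def])
  qed
  have cont_q: "continuous_on \<Omega> ?q"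
    by (rule continuous_on_compose2[OF continuous_cut_ratio cont_r]) (use r_neg in auto)
  have cont_U: "continuous_on \<Omega> (\<lambda>z. U z v)" for v
    unfolding U_def Dg_def
    by (intro continuous_intros cont_q cont_r cont_g cont_w R_cont) (use w_nz in auto)
  have U_bd: "\<exists>L. \<forall>z\<in>K. cmod (U z v) \<le> L" for v
  proof -
    have "bounded ((\<lambda>z. U z v) ` K)"
      using K cont_U by (meson compact_continuous_image compact_imp_bounded continuous_on_subset)
    then show ?thesis by (auto simp: bounded_iff)
  qed
  obtain L1 L2 where L: "\<And>z. z \<in> K \<Longrightarrow> cmod (U z a) \<le> L1" "\<And>z. z \<in> K \<Longrightarrow> cmod (U z (\<i> *s a)) \<le> L2"
    using U_bd by metis
  have "(LINT z|lebesgue_on \<Omega>. (U z a - \<i> * U z (\<i> *s a)) * cnj (k z)) = 0"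
  proof (rule wirtinger_derivative_orthogonal_compact_support[OF op K k der, where L="max L1 L2"])
    show "cmod (U z a) \<le> max L1 L2" if "z \<in> K" for z using L(1)[OF that] by simp
    show "cmod (U z (\<i> *s a)) \<le> max L1 L2" if "z \<in> K" for z using L(2)[OF that] by simp
    show "u z = 0" if "z \<in> \<Omega> - K" for z
    proof -
      have "r z > - \<epsilon>" "r z < 0" using that r_neg by (auto simp: K_def)
      then show ?thesis by (simp add: u_def cut_ratio_zero)
    qed
  qed
  moreover have "U z a - \<i> * U z (\<i> *s a) = of_real (2 * ?q z - (?q z)\<^sup>2) * (s z * g z)
      - 2 * of_real (r z * (?q z)\<^sup>2) / w z" for z
    unfolding U_def Dg_smult Dg_a s_def Complex_eq by (simp add: algebra_simps)
  ultimately show ?thesis by simp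
qed

text \<open>The limit \<open>\<epsilon> \<rightarrow> 0\<close> of the previous identity. All integrands are dominated by
  \<open>(S |g| + 2 |C|) |k|\<close>, because \<open>s\<close> and \<open>r / w\<close> are bounded.\<close>

lemma wirtinger_orthogonal:
  assumes k: "k \<in> bergman_space 2 \<Omega>"
  shows "(LINT z|lebesgue_on \<Omega>. (s z * g z - 2 * of_real (r z) / w z) * cnj (k z)) = 0"
proof -
  have k_hol: "holomorphic_fun \<Omega> k" using k by (simp add: bergman_space_def)
  have cont_k: "continuous_on \<Omega> k" by (rule holomorphic_fun_continuous_on[OF k_hol])
  define q where "q n z = cut_ratio (inverse (real (Suc n))) (r z)" for n z
  define \<Phi> where "\<Phi> n z = (of_real (2 * q n z - (q n z)\<^sup>2) * (s z * g z) - 2 * of_real (r z * (q n z)\<^sup>2) / w z) * cnj (k z)" for n z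
  have q_bd: "0 \<le> q n z \<and> q n z \<le> 1" if "z \<in> \<Omega>" for n z
    unfolding q_def using r_neg[OF that] by (intro cut_ratio_bounds) auto
  have q_lim: "(\<lambda>n. q n z) \<longlonglongrightarrow> 1" if "z \<in> \<Omega>" for z
    unfolding q_def using r_neg[OF that] by (rule cut_ratio_tendsto)
  have cont_q: "continuous_on \<Omega> (q n)" for n
    unfolding q_def[abs_def]
    by (rule continuous_on_compose2[OF continuous_cut_ratio cont_r]) (use r_neg in auto)
  define S where "S = s0 + \<bar>C\<bar> * (2 * norm a)"
  have "(\<lambda>n. LINT z|lebesgue_on \<Omega>. \<Phi> n z) \<longlonglongrightarrow> (LINT z|lebesgue_on \<Omega>. (s z * g z - 2 * of_real (r z) / w z) * cnj (k z))"
  proof (rule integral_dominated_convergence[where w="\<lambda>z. (S * cmod (g z) + 2 * \<bar>C\<bar>) * cmod (k z)"])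
    show "(\<lambda>z. (s z * g z - 2 * of_real (r z) / w z) * cnj (k z)) \<in> borel_measurable (lebesgue_on \<Omega>)"
      by (intro borel_measurable_lebesgue_on_continuous op continuous_intros cont_s cont_g cont_r cont_w cont_k)
         (use w_nz in auto)
    show "\<Phi> n \<in> borel_measurable (lebesgue_on \<Omega>)" for n
      unfolding \<Phi>_def[abs_def]
      by (intro borel_measurable_lebesgue_on_continuous op continuous_intros cont_q cont_s cont_g cont_r cont_w cont_k)
         (use w_nz in auto)
    show "integrable (lebesgue_on \<Omega>) (\<lambda>z. (S * cmod (g z) + 2 * \<bar>C\<bar>) * cmod (k z))"
      by (rule bergman_mult_integrable[OF k])
    show "AE z in lebesgue_on \<Omega>. (\<lambda>n. \<Phi> n z) \<longlonglongrightarrow> (s z * g z - 2 * of_real (r z) / w z) * cnj (k z)"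
    proof (rule AE_I2)
      fix z assume "z \<in> space (lebesgue_on \<Omega>)"
      then have z: "z \<in> \<Omega>" by simp
      have "(\<lambda>n. \<Phi> n z) \<longlonglongrightarrow> (of_real (2 * 1 - 1\<^sup>2) * (s z * g z) - 2 * of_real (r z * 1\<^sup>2) / w z) * cnj (k z)"
        unfolding \<Phi>_def by (intro tendsto_intros q_lim[OF z] w_nz[OF z])
      then show "(\<lambda>n. \<Phi> n z) \<longlonglongrightarrow> (s z * g z - 2 * of_real (r z) / w z) * cnj (k z)" by simp
    qed
    show "AE z in lebesgue_on \<Omega>. norm (\<Phi> n z) \<le> (S * cmod (g z) + 2 * \<bar>C\<bar>) * cmod (k z)" for n
    proof (rule AE_I2)
      fix z assume "z \<in> space (lebesgue_on \<Omega>)"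
      then have z: "z \<in> \<Omega>" by simp
      have qq: "0 \<le> 2 * q n z - (q n z)\<^sup>2" "2 * q n z - (q n z)\<^sup>2 \<le> 1" "(q n z)\<^sup>2 \<le> 1"
      proof -
        show "(q n z)\<^sup>2 \<le> 1" using q_bd[OF z, of n] by (simp add: power_le_one)
        have "(q n z)\<^sup>2 \<le> q n z" using q_bd[OF z, of n] by (simp add: power2_eq_square mult_left_le)
        then show "0 \<le> 2 * q n z - (q n z)\<^sup>2" using q_bd[OF z, of n] by simp
        have "0 \<le> (1 - q n z)\<^sup>2" by simp
        then show "2 * q n z - (q n z)\<^sup>2 \<le> 1" by (simp add: power2_diff)
      qed
      have 1: "cmod (of_real (2 * q n z - (q n z)\<^sup>2) * (s z * g z)) \<le> S * cmod (g z)"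
      proof -
        have "cmod (of_real (2 * q n z - (q n z)\<^sup>2) * (s z * g z)) = (2 * q n z - (q n z)\<^sup>2) * (cmod (s z) * cmod (g z))"
          using qq(1) by (simp only: norm_mult norm_of_real abs_of_nonneg)
        also have "\<dots> \<le> 1 * (S * cmod (g z))"
          using qq s_bounded[OF z] by (intro mult_mono) (use s0 in \<open>auto simp: S_def\<close>)
        finally show ?thesis by simp
      qed
      have 2: "cmod (2 * of_real (r z * (q n z)\<^sup>2) / w z) \<le> 2 * \<bar>C\<bar>"
      proof -
        have "cmod (2 * of_real (r z * (q n z)\<^sup>2) / w z) = 2 * ((q n z)\<^sup>2 * (\<bar>r z\<bar> / cmod (w z)))"
          by (simp add: norm_mult norm_divide abs_mult norm_power)
        also have "\<dots> \<le> 2 * (1 * \<bar>C\<bar>)"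
          using qq(3) r_div_w_bounded[OF z] by (intro mult_left_mono mult_mono) auto
        finally show ?thesis by simp
      qed
      show "norm (\<Phi> n z) \<le> (S * cmod (g z) + 2 * \<bar>C\<bar>) * cmod (k z)"
        unfolding \<Phi>_def norm_mult[of _ "cnj (k z)"] complex_mod_cnj
        by (intro mult_right_mono order_trans[OF norm_triangle_ineq4] add_mono 1 2) simp
    qed
  qed
  moreover have "(LINT z|lebesgue_on \<Omega>. \<Phi> n z) = 0" for n
    unfolding \<Phi>_def q_def by (rule wirtinger_cut_orthogonal[OF k_hol]) simp
  ultimately have "(\<lambda>n. 0) \<longlonglongrightarrow> (LINT z|lebesgue_on \<Omega>. (s z * g z - 2 * of_real (r z) / w z) * cnj (k z))" by simp
  then show ?thesis by (rule LIMSEQ_unique[OF _ tendsto_const])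
qed

text \<open>In other words, \<open>g\<close> is the Bergman projection of the bounded function \<open>f\<close>.\<close>

lemma f_minus_g_orthogonal:
  assumes k: "k \<in> bergman_space 2 \<Omega>"
  shows "(LINT z|lebesgue_on \<Omega>. (f z - g z) * cnj (k z)) = 0"
proof -
  have "x * (1 - y / c) + 2 / c * t / v - x = - 1 / c * (y * x - 2 * t / v)" for x y c t v :: complex
    by (simp add: algebra_simps diff_divide_distrib)
  then have "f z - g z = of_real (- 1 / s0) * (s z * g z - 2 * of_real (r z) / w z)" for z
    by (simp add: f_def)
  then have "(f z - g z) * cnj (k z) = of_real (- 1 / s0) * ((s z * g z - 2 * of_real (r z) / w z) * cnj (k z))" for z
    by (simp only: mult.assoc)
  then show ?thesis using wirtinger_orthogonal[OF k] by simp
qed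

lemma f_powr_integrable:
  assumes p: "p > 0"
  shows "integrable (lebesgue_on \<Omega>) (\<lambda>z. cmod (f z) powr p)"
proof -
  obtain M where M: "\<And>z. z \<in> \<Omega> \<Longrightarrow> cmod (f z) \<le> M" using f_bounded by blast
  interpret finite_measure "lebesgue_on \<Omega>" using finite_measure_\<Omega> by (intro finite_measureI) auto
  show ?thesis
    by (rule integrable_const_bound[where B="M powr p"]) (use M p in \<open>auto intro!: AE_I2 powr_mono2\<close>)
qed

lemma f_Lp: "p > 0 \<Longrightarrow> f \<in> Lp_space p \<Omega>"
  by (simp add: Lp_space_def f_powr_integrable)

lemma Lp_norm_eq:
  "h \<in> Lp_space p \<Omega> \<Longrightarrow> Lp_norm p \<Omega> h = ennreal ((LINT z|lebesgue_on \<Omega>. cmod (h z) powr p) powr (1 / p))"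
  by (simp add: Lp_norm_def)

lemma g_Lp: "p > 0 \<Longrightarrow> g \<in> Lp_space p \<Omega>"
  by (simp add: Lp_space_def g_powr_integrable)

lemma Lp_norm_restrict: "Lp_norm p \<Omega> (\<lambda>z. if z \<in> \<Omega> then h z else 0) = Lp_norm p \<Omega> h"
proof -
  let ?h = "\<lambda>z. if z \<in> \<Omega> then h z else 0"
  have "?h \<in> borel_measurable (lebesgue_on \<Omega>) \<longleftrightarrow> h \<in> borel_measurable (lebesgue_on \<Omega>)"
    by (rule measurable_cong) simp
  moreover have "integrable (lebesgue_on \<Omega>) (\<lambda>z. cmod (?h z) powr p) \<longleftrightarrow> integrable (lebesgue_on \<Omega>) (\<lambda>z. cmod (h z) powr p)"
    by (rule Bochner_Integration.integrable_cong) auto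
  moreover have "(LINT z|lebesgue_on \<Omega>. cmod (?h z) powr p) = (LINT z|lebesgue_on \<Omega>. cmod (h z) powr p)"
    by (rule Bochner_Integration.integral_cong) auto
  ultimately show ?thesis by (simp add: Lp_norm_def Lp_space_def)
qed

lemma ratio_le_bergman_norm:
  assumes "\<phi> \<in> Lp_space 2 \<Omega>" "\<phi> \<in> Lp_space p \<Omega>" and H: "H \<in> bergman_space 2 \<Omega>"
    and orth: "\<And>k. k \<in> bergman_space 2 \<Omega> \<Longrightarrow> (LINT z|lebesgue_on \<Omega>. (\<phi> z - H z) * cnj (k z)) = 0"
    and c: "c \<ge> 0" and N: "Lp_norm p \<Omega> \<phi> = ennreal N" "N > 0" and le: "ennreal (c * N) \<le> Lp_norm p \<Omega> H"
  shows "ennreal c \<le> bergman_norm p \<Omega>"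
proof -
  have "ennreal c = ennreal (c * N) / ennreal N"
    using N c by (simp add: divide_ennreal)
  also have "\<dots> \<le> Lp_norm p \<Omega> H / ennreal N" using le by (rule divide_right_mono_ennreal)
  also have "Lp_norm p \<Omega> H = Lp_norm p \<Omega> (bergman_projection \<Omega> \<phi>)"
    using bergman_projection_eqI[OF op assms(1) H orth] by (simp add: Lp_norm_restrict)
  also have "Lp_norm p \<Omega> (bergman_projection \<Omega> \<phi>) / ennreal N \<le> bergman_norm p \<Omega>"
    unfolding bergman_norm_def N(1)[symmetric]
    by (rule SUP_upper) (use assms(1,2) N in simp)
  finally show ?thesis .
qed

section \<open>Lower bounds for the operator norm\<close>

definition "V = measure (lebesgue_on \<Omega>) \<Omega>"

lemma V_nonneg: "V \<ge> 0" by (simp add: V_def)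

lemma const_integrable: "integrable (lebesgue_on \<Omega>) (\<lambda>_. c :: real)"
proof -
  interpret finite_measure "lebesgue_on \<Omega>" using finite_measure_\<Omega> by (intro finite_measureI) auto
  show ?thesis by simp
qed

lemma AE_zero_if_powr_integral_zero:
  assumes "h \<in> Lp_space p \<Omega>" "(LINT z|lebesgue_on \<Omega>. cmod (h z) powr p) = 0"
  shows "AE z in lebesgue_on \<Omega>. h z = 0"
proof -
  have "AE z in lebesgue_on \<Omega>. cmod (h z) powr p = 0"
    using assms integral_nonneg_eq_0_iff_AE[of "lebesgue_on \<Omega>" "\<lambda>z. cmod (h z) powr p"]
    by (simp add: Lp_space_def)
  then show ?thesis by eventually_elim simp
qed

text \<open>The quotient in the definition of the norm is evaluated at \<open>f\<close>, whose projection is \<open>g\<close>. The norm of \<open>f\<close>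
  does not vanish, as otherwise \<open>g\<close> would be orthogonal to itself.\<close>

lemma bergman_norm_lower_bound_large:
  assumes p: "p > 1" and \<kappa>: "\<kappa> > 0" and M: "M > 0" "\<And>z. z \<in> \<Omega> \<Longrightarrow> cmod (f z) \<le> M"
    and g_ge: "\<kappa> * p \<le> (LINT z|lebesgue_on \<Omega>. cmod (g z) powr p) powr (1 / p)"
  shows "ennreal (\<kappa> * p / (M * (1 + V))) \<le> bergman_norm p \<Omega>"
proof -
  let ?M = "lebesgue_on \<Omega>"
  define J where "J = (LINT z|?M. cmod (f z) powr p)"
  have J0: "J \<ge> 0" by (simp add: J_def)
  have "J \<noteq> 0"
  proof
    assume "J = 0"
    then have f0: "AE z in ?M. f z = 0"
      using AE_zero_if_powr_integral_zero[OF f_Lp, of p] p by (simp add: J_def)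
    have "(LINT z|?M. (f z - g z) * cnj (g z)) = (LINT z|?M. of_real (- ((cmod (g z))\<^sup>2)))"
    proof (rule integral_cong_AE)
      show "AE z in ?M. (f z - g z) * cnj (g z) = of_real (- ((cmod (g z))\<^sup>2))"
        using f0 by eventually_elim (simp only: of_real_minus complex_norm_square, simp)
      show "(\<lambda>z. (f z - g z) * cnj (g z)) \<in> borel_measurable ?M"
        by (intro borel_measurable_lebesgue_on_continuous op continuous_intros cont_f cont_g)
    qed measurable
    then have "(LINT z|?M. cmod (g z) powr 2) = 0"
      using f_minus_g_orthogonal[OF g_bergman] by (simp del: of_real_power of_real_minus)
    then have "AE z in ?M. g z = 0" using AE_zero_if_powr_integral_zero[OF g_Lp, of 2] by simp
    then have "AE z in ?M. cmod (g z) powr p = 0" by eventually_elim simp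
    then have "(LINT z|?M. cmod (g z) powr p) = (LINT z|?M. 0)"
      by (intro integral_cong_AE) auto
    then have "\<kappa> * p \<le> 0" using g_ge by simp
    moreover have "\<kappa> * p > 0" using \<kappa> p by simp
    ultimately show False by linarith
  qed
  then have "J > 0" using J0 by simp
  have J_le: "J powr (1 / p) \<le> M * (1 + V)"
  proof -
    have "J \<le> (LINT z|?M. M powr p)"
      unfolding J_def using f_powr_integrable[of p] p M
      by (intro integral_mono const_integrable) (auto intro!: powr_mono2)
    also have "\<dots> = M powr p * V" by (simp add: V_def mult.commute)
    finally have "J powr (1 / p) \<le> (M powr p * V) powr (1 / p)"
      using J0 p by (intro powr_mono2) auto
    also have "\<dots> = M * V powr (1 / p)"
      using M(1) V_nonneg p by (simp add: powr_mult powr_powr)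
    also have "\<dots> \<le> M * (1 + V)"
      using M(1) V_nonneg p by (intro mult_left_mono powr_le_1_plus) auto
    finally show ?thesis .
  qed
  show ?thesis
  proof (rule ratio_le_bergman_norm[of f p g])
    show "f \<in> Lp_space 2 \<Omega>" by (rule f_Lp) simp
    show "f \<in> Lp_space p \<Omega>" using p by (auto intro: f_Lp)
    show "Lp_norm p \<Omega> f = ennreal (J powr (1 / p))"
      unfolding J_def using p by (intro Lp_norm_eq f_Lp) simp
    show "J powr (1 / p) > 0" using \<open>J > 0\<close> by simp
    show "ennreal (\<kappa> * p / (M * (1 + V)) * J powr (1 / p)) \<le> Lp_norm p \<Omega> g"
    proof -
      have "\<kappa> * p / (M * (1 + V)) * J powr (1 / p) \<le> \<kappa> * p / (M * (1 + V)) * (M * (1 + V))"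
        using J_le \<kappa> p M(1) V_nonneg by (intro mult_left_mono) auto
      also have "\<dots> = \<kappa> * p" using M(1) V_nonneg by simp
      also note g_ge
      finally show ?thesis using p by (subst Lp_norm_eq[OF g_Lp]) (auto intro: ennreal_leI)
    qed
  qed (use p \<kappa> M V_nonneg f_minus_g_orthogonal g_bergman in auto)
qed

text \<open>A substitute for Hoelder's inequality, with the constant \<open>1 + V\<close>, from integrating \<open>t \<le> t\<^sup>p + 1\<close> for
  \<open>t = |H| / X\<close>, where \<open>X\<close> is the \<open>L\<^sup>p\<close> norm of \<open>H\<close>.\<close>

lemma L1_norm_le:
  assumes H: "H \<in> Lp_space p \<Omega>" and p: "p \<ge> 1"
    and pos: "(LINT z|lebesgue_on \<Omega>. cmod (H z) powr p) > 0"
  shows "integrable (lebesgue_on \<Omega>) (\<lambda>z. cmod (H z))"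
    and "(LINT z|lebesgue_on \<Omega>. cmod (H z)) \<le> (LINT z|lebesgue_on \<Omega>. cmod (H z) powr p) powr (1 / p) * (1 + V)"
proof -
  let ?M = "lebesgue_on \<Omega>"
  have Hm [measurable]: "H \<in> borel_measurable ?M" and Hi: "integrable ?M (\<lambda>z. cmod (H z) powr p)"
    using H by (auto simp: Lp_space_def)
  define J where "J = (LINT z|?M. cmod (H z) powr p)"
  define X where "X = J powr (1 / p)"
  have X: "X > 0" using pos by (simp add: X_def J_def)
  have XJ: "X powr p = J" using pos p by (simp add: X_def powr_powr J_def)
  have bd: "cmod (H z) \<le> X * (cmod (H z) powr p / J + 1)" for z
  proof -
    have "cmod (H z) / X \<le> (cmod (H z) / X) powr p + 1" using X p by (intro le_powr_plus_1) auto
    also have "(cmod (H z) / X) powr p = cmod (H z) powr p / J" using X XJ by (simp add: powr_divide)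
    finally show ?thesis using X by (simp add: divide_le_eq mult.commute)
  qed
  have i: "integrable ?M (\<lambda>z. X * (cmod (H z) powr p / J + 1))"
    using Hi const_integrable[of 1] by (intro integrable_mult_right Bochner_Integration.integrable_add) auto
  show 1: "integrable ?M (\<lambda>z. cmod (H z))"
    by (rule Bochner_Integration.integrable_bound[OF i])
       (use bd in \<open>auto intro!: AE_I2 intro: order_trans[OF _ abs_ge_self]\<close>)
  have "(LINT z|?M. cmod (H z)) \<le> (LINT z|?M. X * (cmod (H z) powr p / J + 1))"
    by (intro integral_mono 1 i bd)
  also have "\<dots> = X * (J / J + V)"
    using Hi const_integrable[of 1] by (simp add: J_def V_def)
  also have "\<dots> = X * (1 + V)" using pos by (simp add: J_def)
  finally show "(LINT z|?M. cmod (H z)) \<le> (LINT z|?M. cmod (H z) powr p) powr (1 / p) * (1 + V)"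
    by (simp add: X_def J_def)
qed

text \<open>The quotient is evaluated at \<open>\<phi> = |g|\<^sup>q\<^sup>-\<^sup>2 g\<close>, with projection \<open>H\<close>. Then
  \<open>I = <\<phi>, g> = <H, g> = <H, f> \<le> M |H|\<^sub>1\<close>, where \<open>I\<close> is the integral of \<open>|g|\<^sup>q\<close> and the third equality holds since
  \<open>f - g\<close> is orthogonal to \<open>H\<close>. The \<open>L\<^sup>p\<close> norm of \<open>\<phi>\<close> is \<open>I\<^sup>1\<^sup>/\<^sup>p\<close>, so the quotient is at least of order \<open>I\<^sup>1\<^sup>/\<^sup>q\<close>.\<close>

lemma bergman_norm_lower_bound_dual:
  assumes q: "q > 2" and p: "p = q / (q - 1)" and \<kappa>: "\<kappa> > 0"
    and M: "M > 0" "\<And>z. z \<in> \<Omega> \<Longrightarrow> cmod (f z) \<le> M"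
    and g_ge: "\<kappa> * q \<le> (LINT z|lebesgue_on \<Omega>. cmod (g z) powr q) powr (1 / q)"
  shows "ennreal (\<kappa> * q / (M * (1 + V))) \<le> bergman_norm p \<Omega>"
proof -
  let ?M = "lebesgue_on \<Omega>"
  have p1: "p > 1" and p2: "p < 2" using q by (auto simp: p divide_simps)
  have pq: "(q - 1) * p = q" using q by (simp add: p)
  have inv: "1 / p = 1 - 1 / q" using q by (simp add: p field_simps)
  define I where "I = (LINT z|?M. cmod (g z) powr q)"
  have I_root: "I powr (1 / q) > 0"
    using g_ge mult_pos_pos[of \<kappa> q] \<kappa> q unfolding I_def by linarith
  then have "I \<noteq> 0" by auto
  moreover have "I \<ge> 0" by (simp add: I_def)
  ultimately have I: "I > 0" by simp
  define \<phi> where "\<phi> z = of_real (cmod (g z) powr (q - 2)) * g z" for z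
  have \<phi>_cmod: "cmod (\<phi> z) = cmod (g z) powr (q - 1)" for z
  proof (cases "g z = 0")
    case False
    then have "cmod (g z) powr (q - 2) * cmod (g z) powr 1 = cmod (g z) powr (q - 2 + 1)"
      by (simp only: powr_add)
    then show ?thesis using False by (simp add: \<phi>_def norm_mult)
  qed (simp add: \<phi>_def)
  have [measurable]: "\<phi> \<in> borel_measurable ?M" unfolding \<phi>_def[abs_def] by measurable
  have \<phi>_powr: "cmod (\<phi> z) powr t = cmod (g z) powr ((q - 1) * t)" for z t
    by (simp add: \<phi>_cmod powr_powr)
  have \<phi>_L: "\<phi> \<in> Lp_space t \<Omega>" if "t > 0" for t
    using g_powr_integrable[of "(q - 1) * t"] that q by (simp add: Lp_space_def \<phi>_powr)
  obtain H where H: "H \<in> bergman_space 2 \<Omega>"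
    and orth: "\<And>k. k \<in> bergman_space 2 \<Omega> \<Longrightarrow> (LINT z|?M. (\<phi> z - H z) * cnj (k z)) = 0"
    using bergman_orthogonal_decomposition[OF op \<phi>_L[of 2]] by auto
  have Hm [measurable]: "H \<in> borel_measurable ?M" and H2: "integrable ?M (\<lambda>z. (cmod (H z))\<^sup>2)"
    using H by (auto simp: bergman_space_def Lp_space_2_iff)
  have H_Lp: "H \<in> Lp_space p \<Omega>"
  proof -
    have "integrable ?M (\<lambda>z. cmod (H z) powr p)"
    proof (rule Bochner_Integration.integrable_bound)
      show "integrable ?M (\<lambda>z. 1 + (cmod (H z))\<^sup>2)"
        by (intro Bochner_Integration.integrable_add const_integrable H2)
      \<comment> \<open>as \<open>p < 2\<close> and \<open>\<Omega>\<close> is bounded, \<open>L\<^sup>2\<close> is contained in \<open>L\<^sup>p\<close>\<close>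
      have "cmod (H z) powr p \<le> 1 + (cmod (H z))\<^sup>2" for z
      proof -
        have "((cmod (H z))\<^sup>2) powr (p / 2) = cmod (H z) powr p"
          by (simp add: powr_powr flip: powr_numeral)
        then show ?thesis using powr_le_1_plus[of "(cmod (H z))\<^sup>2" "p / 2"] p1 p2 by simp
      qed
      then show "AE z in ?M. norm (cmod (H z) powr p) \<le> norm (1 + (cmod (H z))\<^sup>2)"
        by (intro AE_I2) simp
    qed measurable
    then show ?thesis by (simp add: Lp_space_def)
  qed
  have sq: "integrable ?M (\<lambda>z. (cmod (g z))\<^sup>2)" "integrable ?M (\<lambda>z. (cmod (f z))\<^sup>2)" "integrable ?M (\<lambda>z. (cmod (\<phi> z))\<^sup>2)"
    using g_Lp[of 2] f_Lp[of 2] \<phi>_L[of 2] by (simp_all add: Lp_space_2_iff)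
  have ints: "integrable ?M (\<lambda>z. \<phi> z * cnj (g z))" "integrable ?M (\<lambda>z. H z * cnj (g z))"
     "integrable ?M (\<lambda>z. f z * cnj (H z))" "integrable ?M (\<lambda>z. g z * cnj (H z))"
    by (intro integrable_mult_cnj_square sq H2; measurable)+
  have "of_real I = (LINT z|?M. \<phi> z * cnj (g z))"
  proof -
    have "\<phi> z * cnj (g z) = of_real (cmod (g z) powr q)" for z
    proof (cases "g z = 0")
      case False
      have "\<phi> z * cnj (g z) = of_real (cmod (g z) powr (q - 2) * (cmod (g z))\<^sup>2)"
        by (simp only: \<phi>_def of_real_mult complex_norm_square mult.assoc)
      also have "cmod (g z) powr (q - 2) * (cmod (g z))\<^sup>2 = cmod (g z) powr (q - 2 + 2)"
        using False by (subst powr_add) simp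
      finally show ?thesis by simp
    qed (simp add: \<phi>_def)
    then show ?thesis by (simp add: I_def)
  qed
  also have "\<dots> = (LINT z|?M. H z * cnj (g z))"
    using orth[OF g_bergman] ints by (simp add: left_diff_distrib)
  also have "\<dots> = (LINT z|?M. cnj (g z * cnj (H z)))" by (simp add: mult.commute)
  also have "\<dots> = cnj (LINT z|?M. g z * cnj (H z))" by (rule Bochner_Integration.integral_cnj)
  also have "(LINT z|?M. g z * cnj (H z)) = (LINT z|?M. f z * cnj (H z))"
    using f_minus_g_orthogonal[OF H] ints by (simp add: left_diff_distrib)
  finally have "cmod (of_real I) = cmod (LINT z|?M. f z * cnj (H z))" by (simp only: complex_mod_cnj)
  then have I_eq: "I = cmod (LINT z|?M. f z * cnj (H z))" using I by simp
  define X where "X = (LINT z|?M. cmod (H z) powr p) powr (1 / p)"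
  have J_pos: "(LINT z|?M. cmod (H z) powr p) > 0"
  proof (rule ccontr)
    assume "\<not> ?thesis"
    then have "(LINT z|?M. cmod (H z) powr p) = 0" by (simp add: order_antisym)
    then have "AE z in ?M. H z = 0" using AE_zero_if_powr_integral_zero[OF H_Lp] by simp
    then have "(LINT z|?M. f z * cnj (H z)) = (LINT z|?M. 0)"
      using ints(3) by (intro integral_cong_AE) (auto elim: eventually_mono)
    then show False using I_eq I by simp
  qed
  note L1 = L1_norm_le[OF H_Lp less_imp_le[OF p1] J_pos]
  have "I \<le> (LINT z|?M. cmod (f z * cnj (H z)))" unfolding I_eq by (rule integral_norm_bound)
  also have "\<dots> \<le> (LINT z|?M. M * cmod (H z))"
  proof (rule integral_mono)
    show "integrable ?M (\<lambda>z. cmod (f z * cnj (H z)))" by (rule integrable_norm[OF ints(3)])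
    show "integrable ?M (\<lambda>z. M * cmod (H z))" by (rule integrable_mult_right[OF L1(1)])
    show "cmod (f z * cnj (H z)) \<le> M * cmod (H z)" if "z \<in> space ?M" for z
      using M that by (auto simp: norm_mult intro!: mult_right_mono)
  qed
  also have "\<dots> \<le> M * (X * (1 + V))"
    using L1(2) M(1) by (simp add: X_def)
  finally have I_le: "I \<le> M * (1 + V) * X" by (simp add: mult_ac)
  show ?thesis
  proof (rule ratio_le_bergman_norm[OF _ _ H orth])
    show "\<phi> \<in> Lp_space 2 \<Omega>" "\<phi> \<in> Lp_space p \<Omega>" using p1 by (auto intro: \<phi>_L)
    show "Lp_norm p \<Omega> \<phi> = ennreal (I powr (1 / p))"
      using p1 by (subst Lp_norm_eq) (auto intro: \<phi>_L simp: \<phi>_powr pq I_def)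
    show "I powr (1 / p) > 0" using I by simp
    show "ennreal (\<kappa> * q / (M * (1 + V)) * I powr (1 / p)) \<le> Lp_norm p \<Omega> H"
    proof -
      have "\<kappa> * q * I powr (1 / p) \<le> I powr (1 / q) * I powr (1 / p)"
        using g_ge by (intro mult_right_mono) (auto simp: I_def)
      also have "\<dots> = I" using I by (simp add: inv powr_add[symmetric])
      also note I_le
      finally have "\<kappa> * q / (M * (1 + V)) * I powr (1 / p) \<le> X"
        using M(1) V_nonneg by (simp add: divide_le_eq mult.commute)
      then show ?thesis by (subst Lp_norm_eq[OF H_Lp]) (auto simp: X_def intro: ennreal_leI)
    qed
  qed (use p1 q \<kappa> M V_nonneg in auto)
qed

text \<open>On both ranges \<open>p\<^sup>2 / (p - 1)\<close> is at most twice the larger of \<open>p\<close> and its conjugate exponent, since the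
  smaller of the two is at most \<open>2\<close>.\<close>

lemma bergman_norm_lower_bound:
  "\<exists>p0 q0 C' :: real. 2 < p0 \<and> 1 / p0 + 1 / q0 = 1 \<and> C' > 0 \<and>
     (\<forall>p \<in> {1<..<q0} \<union> {p0<..}. ennreal (C' * (p\<^sup>2 / (p - 1))) \<le> bergman_norm p \<Omega>)"
proof -
  obtain p0 \<kappa> where p0: "p0 > 2" and \<kappa>: "\<kappa> > 0"
    and g_ge: "\<And>q. q > p0 \<Longrightarrow> \<kappa> * q \<le> (LINT z|lebesgue_on \<Omega>. cmod (g z) powr q) powr (1 / q)"
    using g_norm_lower_bound by blast
  obtain M where M: "M > 0" "\<And>z. z \<in> \<Omega> \<Longrightarrow> cmod (f z) \<le> M" using f_bounded by blast
  define q0 where "q0 = p0 / (p0 - 1)"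
  define C' where "C' = \<kappa> / (M * (1 + V)) / 2"
  have C': "C' > 0" using \<kappa> M(1) V_nonneg by (simp add: C'_def)
  have C'_mult: "2 * C' * t = \<kappa> * t / (M * (1 + V))" for t by (simp add: C'_def)
  have "ennreal (C' * (p\<^sup>2 / (p - 1))) \<le> bergman_norm p \<Omega>" if "p \<in> {1<..<q0} \<union> {p0<..}" for p
  proof (cases "p > p0")
    case True
    then have "p * 1 \<le> p * (p - 1)" using p0 by (intro mult_left_mono) auto
    then have "p\<^sup>2 / (p - 1) \<le> 2 * p"
      using True p0 by (simp add: divide_le_eq power2_eq_square algebra_simps)
    then have "C' * (p\<^sup>2 / (p - 1)) \<le> C' * (2 * p)" using C' by (intro mult_left_mono) auto
    also have "\<dots> = \<kappa> * p / (M * (1 + V))" using C'_mult[of p] by simp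
    finally have "ennreal (C' * (p\<^sup>2 / (p - 1))) \<le> ennreal (\<kappa> * p / (M * (1 + V)))" by (rule ennreal_leI)
    also have "\<dots> \<le> bergman_norm p \<Omega>"
      using True p0 by (intro bergman_norm_lower_bound_large[OF _ \<kappa> M g_ge]) auto
    finally show ?thesis .
  next
    case False
    then have p1: "p > 1" and pq0: "p < q0" using that by auto
    define q where "q = p / (p - 1)"
    have "p * (p0 - 1) < p0" using pq0 p0 by (simp add: q0_def less_divide_eq)
    then have q: "q > p0" using p1 by (simp add: q_def less_divide_eq algebra_simps)
    have p_eq: "p = q / (q - 1)" using p1 by (simp add: q_def field_simps)
    have "q0 \<le> 2" using p0 by (simp add: q0_def divide_le_eq)
    then have "p * q \<le> 2 * q" using pq0 q p0 by (intro mult_right_mono) auto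
    moreover have "p\<^sup>2 / (p - 1) = p * q" by (simp add: q_def power2_eq_square)
    ultimately have "C' * (p\<^sup>2 / (p - 1)) \<le> C' * (2 * q)" using C' by (intro mult_left_mono) auto
    also have "\<dots> = \<kappa> * q / (M * (1 + V))" using C'_mult[of q] by simp
    finally have "ennreal (C' * (p\<^sup>2 / (p - 1))) \<le> ennreal (\<kappa> * q / (M * (1 + V)))" by (rule ennreal_leI)
    also have "\<dots> \<le> bergman_norm p \<Omega>"
      using q p0 by (intro bergman_norm_lower_bound_dual[OF _ p_eq \<kappa> M g_ge]) auto
    finally show ?thesis .
  qed
  moreover have "1 / p0 + 1 / q0 = 1" using p0 by (simp add: q0_def field_simps)
  ultimately show ?thesis using p0 C' by blast
qed

end

section \<open>A farthest boundary point\<close>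

text \<open>Near \<open>a\<close> the estimate is differentiability at \<open>a\<close>; at distance at least \<open>d\<close> from \<open>a\<close> it follows from
  boundedness.\<close>

lemma differentiable_imp_lipschitz_at:
  fixes F :: "'a::real_normed_vector \<Rightarrow> real"
  assumes diff: "F differentiable (at a)" and bd: "bounded (F ` S)"
  obtains C where "C \<ge> 0" "\<And>x. x \<in> S \<Longrightarrow> \<bar>F x - F a\<bar> \<le> C * norm (x - a)"
proof -
  obtain D where D: "(F has_derivative D) (at a)" using diff unfolding differentiable_def by blast
  then have blin: "bounded_linear D" by (rule has_derivative_bounded_linear)
  from D obtain d where d: "d > 0"
    and near: "\<And>y. norm (y - a) < d \<Longrightarrow> norm (F y - F a - D (y - a)) \<le> 1 * norm (y - a)"
    unfolding has_derivative_at_alt by (metis zero_less_one)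
  obtain B where B: "\<And>x. x \<in> S \<Longrightarrow> \<bar>F x\<bar> \<le> B" using bd by (auto simp: bounded_iff)
  define C where "C = (1 + onorm D) + (\<bar>B\<bar> + \<bar>F a\<bar>) / d"
  have on: "onorm D \<ge> 0" using blin by (rule onorm_pos_le)
  show ?thesis
  proof
    show "C \<ge> 0" using on d by (simp add: C_def)
    fix x assume x: "x \<in> S"
    show "\<bar>F x - F a\<bar> \<le> C * norm (x - a)"
    proof (cases "norm (x - a) < d")
      case True
      have "\<bar>F x - F a\<bar> \<le> norm (F x - F a - D (x - a)) + norm (D (x - a))"
        using norm_triangle_sub[of "F x - F a" "D (x - a)"] by (simp add: add.commute)
      also have "\<dots> \<le> (1 + onorm D) * norm (x - a)"
        using near[OF True] onorm[OF blin, of "x - a"] by (simp add: distrib_right)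
      also have "\<dots> \<le> C * norm (x - a)" using d by (intro mult_right_mono) (auto simp: C_def)
      finally show ?thesis .
    next
      case False
      have "\<bar>F x - F a\<bar> \<le> \<bar>B\<bar> + \<bar>F a\<bar>" using B[OF x] by linarith
      also have "\<dots> = (\<bar>B\<bar> + \<bar>F a\<bar>) / d * d" using d by simp
      also have "\<dots> \<le> C * norm (x - a)"
        using False d on by (intro mult_mono) (auto simp: C_def)
      finally show ?thesis .
    qed
  qed
qed

text \<open>The mean value inequality for \<open>y \<mapsto> r y - R a (y - a)\<close> on \<open>S\<close> cut with the ball of radius \<open>norm (x - a)\<close>: there
  the derivative \<open>R y - R a\<close> has operator norm at most \<open>K * norm (x - a)\<close>, as seen on a basis.\<close>

lemma smooth_first_order_remainder:
  fixes r :: "'a::euclidean_space \<Rightarrow> real"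
  assumes S: "convex S" "a \<in> S"
    and der: "\<And>x. x \<in> S \<Longrightarrow> (r has_derivative R x) (at x)"
    and Rdiff: "\<And>v. (\<lambda>x. R x v) differentiable (at a)"
    and Rbd: "\<And>v. bounded ((\<lambda>x. R x v) ` S)"
  obtains K where "K \<ge> 0" "\<And>x. x \<in> S \<Longrightarrow> \<bar>r x - r a - R a (x - a)\<bar> \<le> K * (norm (x - a))\<^sup>2"
proof -
  have "\<exists>C. C \<ge> 0 \<and> (\<forall>x\<in>S. \<bar>R x v - R a v\<bar> \<le> C * norm (x - a))" for v
    using differentiable_imp_lipschitz_at[OF Rdiff Rbd] by metis
  then obtain c where c0: "\<And>v. c v \<ge> 0"
    and c: "\<And>v x. x \<in> S \<Longrightarrow> \<bar>R x v - R a v\<bar> \<le> c v * norm (x - a)" by metis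
  define K where "K = (\<Sum>i\<in>Basis. c i)"
  have K0: "K \<ge> 0" unfolding K_def by (intro sum_nonneg c0)
  have blin: "bounded_linear (R x)" if "x \<in> S" for x
    using der[OF that] by (rule has_derivative_bounded_linear)
  have R_diff: "\<bar>R x v - R a v\<bar> \<le> K * norm (x - a) * norm v" if x: "x \<in> S" for x v
  proof -
    have expand: "R y v = (\<Sum>i\<in>Basis. (v \<bullet> i) * R y i)" if "y \<in> S" for y
    proof -
      interpret bounded_linear "R y" using blin[OF that] .
      have "R y v = R y (\<Sum>i\<in>Basis. (v \<bullet> i) *\<^sub>R i)" by (simp add: euclidean_representation)
      then show ?thesis by (simp add: sum scaleR)
    qed
    have "R x v - R a v = (\<Sum>i\<in>Basis. (v \<bullet> i) * (R x i - R a i))"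
      by (simp add: expand[OF x] expand[OF S(2)] sum_subtractf right_diff_distrib)
    also have "\<bar>\<dots>\<bar> \<le> (\<Sum>i\<in>Basis. \<bar>v \<bullet> i\<bar> * \<bar>R x i - R a i\<bar>)"
      using sum_abs[of "\<lambda>i. (v \<bullet> i) * (R x i - R a i)" Basis] by (simp add: abs_mult)
    also have "\<dots> \<le> (\<Sum>i\<in>Basis. norm v * (c i * norm (x - a)))"
      by (intro sum_mono mult_mono c x Basis_le_norm) auto
    also have "\<dots> = K * norm (x - a) * norm v"
      by (simp add: K_def sum_distrib_left sum_distrib_right mult_ac)
    finally show ?thesis .
  qed
  show ?thesis
  proof
    show "K \<ge> 0" by (rule K0)
    fix x assume x: "x \<in> S"
    let ?T = "S \<inter> cball a (norm (x - a))"
    have "norm ((r x - R a (x - a)) - (r a - R a (a - a))) \<le> (K * norm (x - a)) * norm (x - a)"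
    proof (rule differentiable_bound[where S="?T" and f="\<lambda>y. r y - R a (y - a)" and f'="\<lambda>y v. R y v - R a v"])
      show "convex ?T" using S(1) by (intro convex_Int) auto
      fix y assume y: "y \<in> ?T"
      have "((\<lambda>y. R a (y - a)) has_derivative R a) (at y within ?T)"
        by (rule bounded_linear.has_derivative[OF blin[OF S(2)]]) (auto intro!: derivative_eq_intros)
      then show "((\<lambda>y. r y - R a (y - a)) has_derivative (\<lambda>v. R y v - R a v)) (at y within ?T)"
        using y by (intro has_derivative_diff has_derivative_at_withinI[OF der]) auto
      show "onorm (\<lambda>v. R y v - R a v) \<le> K * norm (x - a)"
      proof (rule onorm_le)
        fix v
        have "\<bar>R y v - R a v\<bar> \<le> K * norm (y - a) * norm v" using R_diff y by blast
        also have "\<dots> \<le> K * norm (x - a) * norm v"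
          using y K0 by (intro mult_right_mono mult_left_mono) (auto simp: dist_norm norm_minus_commute)
        finally show "norm (R y v - R a v) \<le> K * norm (x - a) * norm v" by simp
      qed
    qed (use x S in \<open>auto simp: dist_norm norm_minus_commute\<close>)
    then show "\<bar>r x - r a - R a (x - a)\<bar> \<le> K * (norm (x - a))\<^sup>2"
      using linear_0[OF bounded_linear.linear[OF blin[OF S(2)]]]
      by (simp add: power2_eq_square algebra_simps)
  qed
qed

text \<open>The hypothesis \<open>neg\<close> applied to \<open>v0 + t v\<close>, with \<open>L v0 < 0\<close> and \<open>L v = 0\<close>, for all real \<open>t\<close> forces \<open>v \<bullet> a = 0\<close>. So the
  kernel of \<open>L\<close> is contained in the orthogonal complement of \<open>a\<close>, and \<open>neg\<close> at \<open>a\<close> itself fixes the sign.\<close>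

lemma linear_functional_proportional:
  fixes L :: "'a::real_inner \<Rightarrow> real"
  assumes lin: "linear L" and nz: "L \<noteq> (\<lambda>_. 0)" and a: "a \<noteq> 0"
    and neg: "\<And>v. L v < 0 \<Longrightarrow> v \<bullet> a \<le> 0"
  obtains b where "b > 0" "\<And>v. L v = b * (v \<bullet> a)"
proof -
  obtain u where "L u \<noteq> 0" using nz by (auto simp: fun_eq_iff)
  then obtain v0 where v0: "L v0 < 0"
    using linear_neg[OF lin, of u] by (cases "L u < 0") (auto intro: that[of u] that[of "- u"])
  have ker: "v \<bullet> a = 0" if v: "L v = 0" for v
  proof -
    have le: "v0 \<bullet> a + t * (v \<bullet> a) \<le> 0" for t
    proof -
      have "L (v0 + t *\<^sub>R v) < 0" using v v0 lin by (simp add: linear_add linear_scale)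
      from neg[OF this] show ?thesis by (simp add: inner_add_left)
    qed
    show ?thesis
    proof (rule ccontr)
      assume "v \<bullet> a \<noteq> 0"
      then show False using le[of "(1 - v0 \<bullet> a) / (v \<bullet> a)"] by simp
    qed
  qed
  have aa: "a \<bullet> a > 0" using a by simp
  have La: "L a \<noteq> 0" using ker[of a] aa by auto
  have "\<not> L a < 0" using neg[of a] aa by auto
  then have La_pos: "L a > 0" using La by simp
  show ?thesis
  proof
    show "L a / (a \<bullet> a) > 0" using La_pos aa by simp
    fix v
    have "L (v - (L v / L a) *\<^sub>R a) = 0" using lin La by (simp add: linear_diff linear_scale)
    from ker[OF this] have "v \<bullet> a = L v / L a * (a \<bullet> a)" by (simp add: inner_diff_left)
    then show "L v = L a / (a \<bullet> a) * (v \<bullet> a)" using La aa by simp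
  qed
qed

lemma open_norm_not_maximal:
  fixes \<Omega> :: "'a::euclidean_space set"
  assumes "open \<Omega>" "z \<in> \<Omega>"
  obtains y where "y \<in> \<Omega>" "norm y > norm z"
proof -
  obtain e where e: "e > 0" "cball z e \<subseteq> \<Omega>" using assms open_contains_cball by blast
  show ?thesis
  proof (cases "z = 0")
    case True
    obtain y :: 'a where "norm y = e" using vector_choose_size[of e] e by auto
    then show ?thesis using that[of y] True e by (auto simp: subset_iff dist_norm)
  next
    case False
    let ?y = "z + (e / norm z) *\<^sub>R z"
    have "?y \<in> cball z e" using False e by (simp add: dist_norm)
    moreover have "norm ?y = norm z + e"
    proof -
      have "?y = (1 + e / norm z) *\<^sub>R z" by (simp add: scaleR_add_left)
      then have "norm ?y = (1 + e / norm z) * norm z" using e by simp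
      then show ?thesis using False by (simp add: distrib_right)
    qed
    ultimately show ?thesis using that[of ?y] e by auto
  qed
qed

text \<open>For a farthest point \<open>a\<close> of the closure, a direction along which \<open>r\<close> decreases enters \<open>\<Omega>\<close>, hence the ball of
  radius \<open>norm a\<close>, so it has nonpositive inner product with \<open>a\<close>. Therefore the derivative of \<open>r\<close> at \<open>a\<close>
  is \<open>b * (v \<bullet> a)\<close> with \<open>b > 0\<close>, and the quantitative conditions follow from the second order expansion of \<open>r\<close> at \<open>a\<close>.\<close>

lemma smoothly_bounded_imp_peak_point:
  fixes \<Omega> :: "(complex^'n) set"
  assumes "smoothly_bounded_domain \<Omega>"
  shows "\<exists>a r R s0 C \<sigma>0. peak_point \<Omega> a r R s0 C \<sigma>0"
proof -
  from assms obtain U and r :: "complex^'n \<Rightarrow> real" where op: "open \<Omega>" and ne: "\<Omega> \<noteq> {}" and bdd: "bounded \<Omega>"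
    and U: "open U" "closure \<Omega> \<subseteq> U" and smooth: "C_infinity_on U r" and \<Omega>: "\<Omega> = {z\<in>U. r z < 0}"
    and grad: "\<And>z. z \<in> U \<Longrightarrow> r z = 0 \<Longrightarrow> frechet_derivative r (at z) \<noteq> (\<lambda>v. 0)"
    unfolding smoothly_bounded_domain_def by blast
  define R where "R z = frechet_derivative r (at z)" for z
  have C2: "C_k_on (Suc (Suc 0)) U r" using smooth unfolding C_infinity_on_def by blast
  have der: "(r has_derivative R z) (at z)" if "z \<in> U" for z
    using C2 that unfolding R_def by (simp add: frechet_derivative_works[symmetric])
  have R_diff: "(\<lambda>x. R x v) differentiable (at z)" if "z \<in> U" for z v
    using C2 that unfolding R_def by simp
  have R_cont: "continuous_on U (\<lambda>x. R x v)" for v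
    using R_diff differentiable_imp_continuous_within continuous_at_imp_continuous_on by blast
  have r_cont: "continuous_on U r"
    using der by (meson continuous_at_imp_continuous_on has_derivative_continuous)
  have comp: "compact (closure \<Omega>)" using bdd by (simp add: compact_closure)
  obtain a where a: "a \<in> closure \<Omega>" and a_max: "\<And>z. z \<in> closure \<Omega> \<Longrightarrow> norm z \<le> norm a"
    using continuous_attains_sup[OF comp, of norm] ne by (auto intro: continuous_on_norm_id)
  have in_ball: "norm z < norm a" if z: "z \<in> \<Omega>" for z
  proof -
    obtain y where "y \<in> \<Omega>" "norm y > norm z" using open_norm_not_maximal[OF op z] by blast
    then show ?thesis using a_max[of y] closure_subset[of \<Omega>] by force
  qed
  have a0: "a \<noteq> 0" using ne in_ball by (metis ex_in_conv norm_zero norm_not_less_zero)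
  have na: "norm a > 0" using a0 by simp
  have aU: "a \<in> U" using a U by blast
  have "a \<notin> \<Omega>" using in_ball by blast
  then have "r a \<ge> 0" using aU \<Omega> by auto
  moreover have "r a \<le> 0"
    by (rule continuous_le_on_closure[OF continuous_on_subset[OF r_cont U(2)] a]) (use \<Omega> in auto)
  ultimately have ra: "r a = 0" by simp
  have Rlin: "linear (R z)" if "z \<in> U" for z
    using der[OF that] has_derivative_bounded_linear bounded_linear.linear by blast
  have tangent: "v \<bullet> a \<le> 0" if v: "R a v < 0" for v
  proof -
    have v0: "v \<noteq> 0" using v linear_0[OF Rlin[OF aU]] by auto
    obtain d1 where d1: "d1 > 0" "ball a d1 \<subseteq> U" using U(1) aU open_contains_ball by blast
    \<comment> \<open>with this error slope \<open>r\<close> still decreases along \<open>v\<close> at half the rate \<open>R a v\<close>\<close>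
    define e where "e = - R a v / (2 * norm v)"
    have e: "e > 0" using v v0 by (simp add: e_def divide_neg_pos)
    obtain d where d: "d > 0"
      and near: "\<And>y. norm (y - a) < d \<Longrightarrow> norm (r y - r a - R a (y - a)) \<le> e * norm (y - a)"
      using der[OF aU] e unfolding has_derivative_at_alt by metis
    define t where "t = min d d1 / (2 * norm v)"
    have t: "t > 0" using d d1 v0 by (simp add: t_def)
    have "min d d1 > 0" using d d1 by simp
    moreover have "norm (t *\<^sub>R v) = min d d1 / 2" using d d1 v0 by (simp add: t_def)
    ultimately have tv: "norm (t *\<^sub>R v) < min d d1" by linarith
    have "r (a + t *\<^sub>R v) \<le> t * R a v + e * (t * norm v)"
      using near[of "a + t *\<^sub>R v"] tv t ra Rlin[OF aU] by (simp add: linear_scale)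
    also have "\<dots> = t * R a v / 2" using v0 by (simp add: e_def field_simps)
    also have "\<dots> < 0" using t v by (simp add: mult_pos_neg)
    finally have "r (a + t *\<^sub>R v) < 0" .
    moreover have "a + t *\<^sub>R v \<in> U" using d1 tv by (auto simp: subset_iff dist_norm)
    ultimately have "norm (a + t *\<^sub>R v) < norm a" using \<Omega> by (intro in_ball) auto
    then have "(norm (a + t *\<^sub>R v))\<^sup>2 < (norm a)\<^sup>2" by (intro power_strict_mono) auto
    then have "2 * t * (v \<bullet> a) + t * t * (v \<bullet> v) < 0"
      by (simp add: power2_norm_eq_inner inner_add inner_commute algebra_simps)
    moreover have "t * t * (v \<bullet> v) \<ge> 0" using t by simp
    ultimately have "t * (v \<bullet> a) < 0" by linarith
    then show ?thesis using t by (simp add: mult_less_0_iff)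
  qed
  obtain b where b: "b > 0" and Ra: "\<And>v. R a v = b * (v \<bullet> a)"
    using linear_functional_proportional[OF Rlin[OF aU] _ a0 tangent] grad[OF aU ra] unfolding R_def by blast
  define s0 where "s0 = b * (norm a)\<^sup>2"
  have s0: "s0 > 0" using b na by (simp add: s0_def)
  have Raa: "R a a = s0" by (simp add: Ra s0_def power2_norm_eq_inner)
  have Ria: "R a (\<i> *s a) = 0"
    using hermitian_inner_smult[of \<i> a a] Re_hermitian_inner[of "\<i> *s a" a] by (simp add: Ra hermitian_inner_self)
  have R_bd: "bounded ((\<lambda>x. R x v) ` S)" if "compact S" "S \<subseteq> U" for v S
    using that R_cont by (meson compact_continuous_image compact_imp_bounded continuous_on_subset)
  obtain c1 where c1: "c1 \<ge> 0" "\<And>x. x \<in> closure \<Omega> \<Longrightarrow> \<bar>R x a - R a a\<bar> \<le> c1 * norm (x - a)"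
    using differentiable_imp_lipschitz_at[OF R_diff[OF aU] R_bd[OF comp U(2)]] by blast
  obtain c2 where c2: "c2 \<ge> 0" "\<And>x. x \<in> closure \<Omega> \<Longrightarrow> \<bar>R x (\<i> *s a) - R a (\<i> *s a)\<bar> \<le> c2 * norm (x - a)"
    using differentiable_imp_lipschitz_at[OF R_diff[OF aU] R_bd[OF comp U(2)]] by blast
  obtain d where d: "d > 0" "cball a d \<subseteq> U" using U(1) aU open_contains_cball by blast
  obtain K where K: "K \<ge> 0"
    and near: "\<And>x. x \<in> cball a d \<Longrightarrow> \<bar>r x - r a - R a (x - a)\<bar> \<le> K * (norm (x - a))\<^sup>2"
  proof (rule smooth_first_order_remainder[of "cball a d" a r R])
    show "(r has_derivative R x) (at x)" if "x \<in> cball a d" for x using der d that by blast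
  qed (use d R_diff[OF aU] R_bd[OF compact_cball d(2)] in auto)
  have "bounded (r ` closure \<Omega>)"
    using comp U(2) r_cont by (meson compact_continuous_image compact_imp_bounded continuous_on_subset)
  then obtain B where B: "\<And>x. x \<in> closure \<Omega> \<Longrightarrow> \<bar>r x\<bar> \<le> B" by (auto simp: bounded_iff)
  \<comment> \<open>extends the quadratic estimate from the ball of radius \<open>d\<close> to all of \<open>\<Omega>\<close>, where \<open>\<bar>r\<bar> \<le> B\<close>\<close>
  define K2 where "K2 = K + \<bar>B\<bar> / d\<^sup>2"
  have K2: "K2 \<ge> 0" using K d by (simp add: K2_def)
  \<comment> \<open>one constant for the estimates of both \<open>s\<close> and \<open>r\<close>\<close>
  define C where "C = c1 + c2 + b * (norm a)\<^sup>2 + K2 * (2 * (norm a)\<^sup>2)"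
  define W where "W z = 1 - hermitian_inner z a / of_real ((norm a)\<^sup>2)" for z
  have ReW: "(norm a)\<^sup>2 * Re (W z) = - ((z - a) \<bullet> a)" for z
  proof -
    have "Re (W z) = 1 - z \<bullet> a / (norm a)\<^sup>2" by (simp add: W_def Re_hermitian_inner del: of_real_power)
    then show ?thesis using na by (simp add: field_simps inner_diff_left power2_norm_eq_inner)
  qed
  have sq_le: "(norm (z - a))\<^sup>2 \<le> 2 * (norm a)\<^sup>2 * Re (W z)" if z: "z \<in> \<Omega>" for z
  proof -
    have "(norm z)\<^sup>2 \<le> (norm a)\<^sup>2" using in_ball[OF z] by (intro power_mono) auto
    then show ?thesis unfolding mult.assoc ReW
      by (simp add: power2_norm_eq_inner inner_diff inner_commute)
  qed
  have W_le: "(norm a)\<^sup>2 * Re (W z) \<le> (norm a)\<^sup>2 * cmod (W z)" for z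
    by (intro mult_left_mono complex_Re_le_cmod) auto
  \<comment> \<open>the first bound on \<open>\<sigma>\<close> keeps the inner balls where the expansion of \<open>r\<close> holds, the second makes its
    linear part dominate\<close>
  have "peak_point \<Omega> a r R s0 C (min (d / (2 * norm a)) (b / (8 * (K + 1))))"
  proof
    show "open \<Omega>" "bounded \<Omega>" "a \<noteq> 0" "0 < s0" by fact+
    show "norm z < norm a" if "z \<in> \<Omega>" for z using in_ball[OF that] .
    show "r z < 0" if "z \<in> \<Omega>" for z using that \<Omega> by auto
    show "(r has_derivative R z) (at z)" if "z \<in> \<Omega>" for z using that \<Omega> der by auto
    show "continuous_on \<Omega> (\<lambda>z. R z v)" for v using R_cont \<Omega> by (auto intro: continuous_on_subset)
    show "compact {z \<in> \<Omega>. r z \<le> - \<epsilon>}" if "\<epsilon> > 0" for \<epsilon>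
    proof -
      have "{z \<in> \<Omega>. r z \<le> - \<epsilon>} = closure \<Omega> \<inter> r -` {..- \<epsilon>}"
        using \<Omega> U(2) closure_subset[of \<Omega>] that by auto
      moreover have "closed (closure \<Omega> \<inter> r -` {..- \<epsilon>})"
        by (rule continuous_closed_preimage[OF continuous_on_subset[OF r_cont U(2)]]) auto
      moreover have "bounded (closure \<Omega> \<inter> r -` {..- \<epsilon>})"
        using comp compact_imp_bounded bounded_Int by blast
      ultimately show ?thesis by (simp add: compact_eq_bounded_closed)
    qed
    show "\<bar>r z\<bar> \<le> C * cmod (1 - hermitian_inner z a / of_real ((norm a)\<^sup>2))" if z: "z \<in> \<Omega>" for z
    proof -
      have zc: "z \<in> closure \<Omega>" using z closure_subset by blast
      have Wn: "cmod (W z) \<ge> 0" by simp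
      have Wp: "(norm a)\<^sup>2 * Re (W z) \<ge> 0" using sq_le[OF z] zero_le_power2[of "norm (z - a)"] by linarith
      have "\<bar>r z\<bar> \<le> b * ((norm a)\<^sup>2 * Re (W z)) + K2 * (norm (z - a))\<^sup>2"
      proof (cases "z \<in> cball a d")
        case True
        have "R a (z - a) = - (b * ((norm a)\<^sup>2 * Re (W z)))" by (simp only: Ra ReW)
        then have "\<bar>r z\<bar> \<le> b * ((norm a)\<^sup>2 * Re (W z)) + K * (norm (z - a))\<^sup>2"
          using near[OF True] ra mult_nonneg_nonneg[OF less_imp_le[OF b] Wp] by linarith
        also have "\<dots> \<le> b * ((norm a)\<^sup>2 * Re (W z)) + K2 * (norm (z - a))\<^sup>2"
          by (intro add_left_mono mult_right_mono) (auto simp: K2_def)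
        finally show ?thesis .
      next
        case False
        then have "d \<le> norm (z - a)" by (simp add: dist_norm norm_minus_commute)
        then have dd: "d\<^sup>2 \<le> (norm (z - a))\<^sup>2" using d by (intro power_mono) auto
        have "\<bar>r z\<bar> \<le> \<bar>B\<bar>" using B[OF zc] by linarith
        also have "\<dots> = \<bar>B\<bar> / d\<^sup>2 * d\<^sup>2" using d by simp
        also have "\<dots> \<le> K2 * (norm (z - a))\<^sup>2"
          using dd K d by (intro mult_mono) (auto simp: K2_def)
        finally have "\<bar>r z\<bar> \<le> K2 * (norm (z - a))\<^sup>2" .
        moreover have "b * ((norm a)\<^sup>2 * Re (W z)) \<ge> 0"
          by (rule mult_nonneg_nonneg[OF less_imp_le[OF b] Wp])
        ultimately show ?thesis by linarith
      qed
      also have "\<dots> \<le> b * ((norm a)\<^sup>2 * cmod (W z)) + K2 * (2 * (norm a)\<^sup>2 * cmod (W z))"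
      proof (rule add_mono)
        show "b * ((norm a)\<^sup>2 * Re (W z)) \<le> b * ((norm a)\<^sup>2 * cmod (W z))"
          by (rule mult_left_mono[OF W_le less_imp_le[OF b]])
        show "K2 * (norm (z - a))\<^sup>2 \<le> K2 * (2 * (norm a)\<^sup>2 * cmod (W z))"
          by (rule mult_left_mono[OF _ K2]) (use sq_le[OF z] W_le[of z] in linarith)
      qed
      also have "\<dots> \<le> C * cmod (W z)"
        using mult_nonneg_nonneg[OF c1(1) Wn] mult_nonneg_nonneg[OF c2(1) Wn]
        unfolding C_def distrib_right by (simp add: mult.assoc)
      finally show ?thesis by (simp add: W_def)
    qed
    show "cmod (Complex (R z a) (- R z (\<i> *s a)) - of_real s0) \<le> C * norm (z - a)" if z: "z \<in> \<Omega>" for z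
    proof -
      have zc: "z \<in> closure \<Omega>" using z closure_subset by blast
      have "cmod (Complex (R z a) (- R z (\<i> *s a)) - of_real s0) \<le> \<bar>R z a - R a a\<bar> + \<bar>R z (\<i> *s a) - R a (\<i> *s a)\<bar>"
        using cmod_le[of "Complex (R z a) (- R z (\<i> *s a)) - of_real s0"] by (simp add: Raa Ria)
      also have "\<dots> \<le> (c1 + c2) * norm (z - a)"
        using c1(2)[OF zc] c2(2)[OF zc] by (simp add: distrib_right)
      also have "\<dots> \<le> C * norm (z - a)"
        using b K2 by (intro mult_right_mono) (auto simp: C_def)
      finally show ?thesis .
    qed
    show "0 < min (d / (2 * norm a)) (b / (8 * (K + 1)))" using d na b K by simp
    show "ball (a - \<sigma> *\<^sub>R a) (\<sigma> * norm a / 2) \<subseteq> \<Omega>"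
      if \<sigma>: "0 < \<sigma>" "\<sigma> < min (d / (2 * norm a)) (b / (8 * (K + 1)))" for \<sigma>
    proof
      fix z assume z: "z \<in> ball (a - \<sigma> *\<^sub>R a) (\<sigma> * norm a / 2)"
      define y where "y = z - (a - \<sigma> *\<^sub>R a)"
      have y: "norm y < \<sigma> * norm a / 2" using z by (simp add: y_def dist_norm norm_minus_commute)
      have za: "z - a = y - \<sigma> *\<^sub>R a" by (simp add: y_def)
      have dist: "norm (z - a) \<le> 3 / 2 * (\<sigma> * norm a)"
        using norm_triangle_ineq4[of y "\<sigma> *\<^sub>R a"] y \<sigma> unfolding za by simp
      have "\<sigma> * (2 * norm a) < d" using \<sigma> na by (simp add: less_divide_eq)
      then have "3 / 2 * (\<sigma> * norm a) \<le> d" using \<sigma> na mult_pos_pos[of \<sigma> "norm a"] by linarith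
      then have zd: "z \<in> cball a d" using dist by (simp add: dist_norm norm_minus_commute)
      have "(z - a) \<bullet> a \<le> norm y * norm a - \<sigma> * (norm a)\<^sup>2"
        unfolding za using norm_cauchy_schwarz[of y a] by (simp add: inner_diff_left power2_norm_eq_inner)
      also have "\<dots> \<le> \<sigma> * norm a / 2 * norm a - \<sigma> * (norm a)\<^sup>2"
        using y na by (intro diff_right_mono mult_right_mono) auto
      also have "\<dots> = - (\<sigma> * (norm a)\<^sup>2 / 2)" by (simp add: power2_eq_square)
      finally have "b * ((z - a) \<bullet> a) \<le> b * (- (\<sigma> * (norm a)\<^sup>2 / 2))" using b by (intro mult_left_mono) auto
      moreover have "K * (norm (z - a))\<^sup>2 \<le> K * (3 / 2 * (\<sigma> * norm a))\<^sup>2"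
        using dist K by (intro mult_left_mono power_mono) auto
      moreover have "K * (3 / 2 * (\<sigma> * norm a))\<^sup>2 < b * (\<sigma> * (norm a)\<^sup>2 / 2)"
      proof -
        have "\<sigma> * (8 * (K + 1)) < b" using \<sigma> K by (simp add: less_divide_eq)
        then have "K * (9 / 4) * \<sigma> < b / 2"
          using \<sigma> mult_nonneg_nonneg[OF K less_imp_le[OF \<sigma>(1)]] by (simp add: algebra_simps)
        then have "K * (9 / 4) * \<sigma> * (\<sigma> * (norm a)\<^sup>2) < b / 2 * (\<sigma> * (norm a)\<^sup>2)"
          using \<sigma> na by (intro mult_strict_right_mono) auto
        then show ?thesis by (simp add: power2_eq_square algebra_simps)
      qed
      ultimately have "r z < 0" using near[OF zd] ra Ra[of "z - a"] by linarith
      then show "z \<in> \<Omega>" using \<Omega> zd d by auto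
    qed
  qed
  then show ?thesis by blast
qed

section \<open>The lower bound on smoothly bounded domains\<close>

theorem theorem1p3:
  fixes \<Omega> :: "(complex^'n) set"
  assumes "smoothly_bounded_domain \<Omega>"
    and "condition_R \<Omega>"
  shows "\<exists>p\<^sub>0 q\<^sub>0 C' :: real. 2 < p\<^sub>0 \<and> 1 / p\<^sub>0 + 1 / q\<^sub>0 = 1 \<and> C' > 0 \<and>
           (\<forall>p \<in> {1<..<q\<^sub>0} \<union> {p\<^sub>0<..}.
              ennreal (C' * (p\<^sup>2 / (p - 1))) \<le> bergman_norm p \<Omega>)"
proof -
  obtain a r R s0 C \<sigma>0 where "peak_point \<Omega> a r R s0 C \<sigma>0"
    using smoothly_bounded_imp_peak_point[OF assms(1)] by blast
  then interpret peak_point \<Omega> a r R s0 C \<sigma>0 .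
  show ?thesis by (rule bergman_norm_lower_bound)
qed

end
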